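(* Let $n\ge 1$, let $\sigma\in S_n$ have last descent $l$ (with $l=0$ if $\sigma=\mathrm{id}$), and let $t$ be an integer with $l\le t\le 2n$. Let $\alpha\in S_n$ be such that the tree $K\mathcal{T}_t(\mathrm{id}\star_n\alpha)$ has exactly one leaf whose label is not $\emptyset$, and let $\rho$ be the label of that leaf. Then for every $\pi\in S_\infty$, $$(-1)^{\ell(\sigma)+\ell(\rho)-\ell(\pi)}C^{\pi}_{\sigma,\rho}=\#\{\pi\text{-leaves of }K\mathcal{T}_t(\sigma\star_n\alpha)\}.$$ Moreover, in the cohomology case $\ell(\sigma)+\ell(\rho)=\ell(\pi)$, $$C^{\pi}_{\sigma,\rho}=\#\{\pi\text{-leaves of }\mathcal{T}_t(\sigma\star_n\alpha)\}.$$
   Context: Permutations: $S_\infty=\bigcup_n S_n$ via the standard inclusions $S_n\hookrightarrow S_{n+1}$. $\ell(w)$ is the Coxeter length (number of inversions). The last descent of $\pi$ is the largest $l$ with $\pi(l)>\pi(l+1)$ (taken to be $0$ if $\pi=\mathrm{id}$). For $\sigma,\alpha\in S_n$, $\sigma\star_n\alpha\in S_{2n}$ is the permutation with $(\sigma\star_n\alpha)(i)=\sigma(i)$ for $i\le n$ and $(\sigma\star_n\alpha)(i)=n+\alpha(i-n)$ for $i>n$ (block direct sum of permutation matrices). Structure constants: for $\pi\in S_N$ let $X_\pi$ be the Schubert variety in the variety $\mathrm{Fl}(\mathbb{C}^N)$ of complete flags; the classes $[\mathcal O_{X_\pi}]$ form a $\mathbb Z$-basis of $K(\mathrm{Fl}(\mathbb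 C^N))$, and $C^\pi_{\sigma,\rho}$ is defined by $[\mathcal O_{X_\sigma}][\mathcal O_{X_\rho}]=\sum_\pi C^\pi_{\sigma,\rho}[\mathcal O_{X_\pi}]$; these integers are independent of $N$ for $N$ large, so $C^\pi_{\sigma,\rho}$ is defined for $\sigma,\rho,\pi\in S_\infty$. Equivalently, $\mathfrak G_\sigma\mathfrak G_\rho=\sum_\pi C^\pi_{\sigma,\rho}\mathfrak G_\pi$ for the Grothendieck polynomials $\mathfrak G_w$ (defined by $\mathfrak G_{w_0}=x_1^{N-1}x_2^{N-2}\cdots x_{N-1}$ for the longest $w_0\in S_N$ and $\mathfrak G_{ws_i}=\pi_i\mathfrak G_w$ when $\ell(ws_i)<\ell(w)$, where $\pi_i f=\frac{(1-x_{i+1})f-(1-x_i)f|_{x_i\leftrightarrow x_{i+1}}}{x_i-x_{i+1}}$). When $\ell(\sigma)+\ell(\rho)=\ell(\pi)$, $C^\pi_{\sigma,\rho}$ is the cohomology Schubert structure constant. Diagrams: the permutation matrix $G(\pi)$ has dots at positions $(i,\pi(i))$ (row $i$, column $\pi(i)$; rows increase southward, columns eastward). The diagram is $D(\pi)=\{(p,q):\pi(p)>q,\ \pi^{-1}(q)>p\}$; graphically it is the set of cells not covered by any hook, where the hook of a dot consists of the dot and the cells directly east in its row and directly south in its column. The maximal corner of $\pi$ is the box $(l,m)\in D(\pi)$ that is southernmost, and among those eastmost (its row $l$ is the last descent of $\pi$). A pivot is a dot $(i,\pi(i))$ strictly northwest of $(l,m)$ (i.e. $i<l$, $\pi(i)<m$)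 that is maximally southeast among such dots (no other dot strictly northwest of $(l,m)$ lies southeast of it). Marching: if $\pi$ has no pivots, marching outputs $\emptyset$. Otherwise, for a pivot $(i,j)$, remove the hook of $(i,j)$ and move strictly to the northwest every diagram box in the rectangle with corners $(i,j)$ and $(l,m)$ into the only spaces available (hopping over any hooks in the way), processing boxes starting with the northwest box of the rectangle and proceeding left to right along rows, rows from top to bottom. The resulting set of boxes is the diagram of a permutation $\rho$; write $\pi\xrightarrow{i}\rho$ (marching towards the pivot in row $i$). $K$-marching: for rows $i_1<\dots<i_k$ ($k\ge1$) containing pivots of the maximal corner $(l,m)$ of $\pi$: march $\pi\xrightarrow{i_1}\rho_1$; add a box to $D(\rho_1)$ at $(l,\rho_1(l))$, giving the diagram of a permutation $\rho_1'$ whose maximal corner is this box and for which the dot in row $i_2$ is a pivot; march $\rho_1'\xrightarrow{i_2}\rho_2$, add a box in row $l$ likewise, and so on, ending with $\rho=\rho_k$. Write $\pi\xrightarrow{i_1,\dots,i_k}\rho$. If $\pi$ has no pivots, $K$-marching outputs $\emptyset$. Trees: for $\beta\in S_\infty$ and a positive integer $t$, $\mathcal T_t(\beta)$ is the rooted tree with root labeled $\beta$, vertices labeled by permutations or $\emptyset$; a vertex labeled $\emptyset$ or by a permutation whose last descent is $\le t$ is a leaf; otherwise its children are labeled by the outputs of all marchings from it (one for each pivot, or a single child $\emptyset$ if there are no pivots). $K\mathcal T_t(\beta)$ is defined in the same way using all $K$-marchings (one child per nonempty set of pivot rows). A $\pi$-leaf is a leaf labeled $\pi$. *)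

theory Defs
  imports
    Complex_Main
    "HOL-Library.Poly_Mapping"
    "HOL-Combinatorics.Permutations"
begin

section \<open>Permutations\<close>

text \<open>Permutations act on the positive integers; \<^term>\<open>0::nat\<close> is always a fixed point and is
  never a row, a column or a variable index.\<close>

definition S_inf :: "(nat \<Rightarrow> nat) set" where
  "S_inf = {w. \<exists>n. w permutes {1..n}}"

definition len :: "(nat \<Rightarrow> nat) \<Rightarrow> nat" where
  "len w = card {(i, j). 1 \<le> i \<and> i < j \<and> w i > w j}"

definition last_descent :: "(nat \<Rightarrow> nat) \<Rightarrow> nat" where
  "last_descent w = (if w = id then 0 else Max {l. 1 \<le> l \<and> w l > w (l + 1)})"

definition star :: "nat \<Rightarrow> (nat \<Rightarrow> nat) \<Rightarrow> (nat \<Rightarrow> nat) \<Rightarrow> nat \<Rightarrow> nat" where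
  "star n \<sigma> \<alpha> i = (if i \<le> n then \<sigma> i else n + \<alpha> (i - n))"


section \<open>Grothendieck polynomials and structure constants\<close>

text \<open>Polynomials in the variables \<open>x\<^sub>1, x\<^sub>2, \<dots>\<close>: finitely supported functions from
  exponent vectors to integers.\<close>

type_synonym int_mpoly = "(nat \<Rightarrow>\<^sub>0 nat) \<Rightarrow>\<^sub>0 int"

definition X :: "nat \<Rightarrow> int_mpoly" where
  "X i = Poly_Mapping.single (Poly_Mapping.single i 1) 1"

definition swap_vars :: "nat \<Rightarrow> int_mpoly \<Rightarrow> int_mpoly" where
  "swap_vars i = Poly_Mapping.map_key (Poly_Mapping.map_key (transpose i (i + 1)))"

text \<open>The quotient is exact, and unique because the polynomial ring is a domain.\<close>

definition isobaric :: "nat \<Rightarrow> int_mpoly \<Rightarrow> int_mpoly" where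
  "isobaric i f =
     (THE g. (X i - X (i + 1)) * g = (1 - X (i + 1)) * f - (1 - X i) * swap_vars i f)"

definition longest :: "nat \<Rightarrow> nat \<Rightarrow> nat" where
  "longest N i = (if 1 \<le> i \<and> i \<le> N then N + 1 - i else i)"

inductive is_groth :: "(nat \<Rightarrow> nat) \<Rightarrow> int_mpoly \<Rightarrow> bool" where
  longest: "is_groth (longest N) (\<Prod>i\<in>{1..<N}. X i ^ (N - i))"
| step: "is_groth w f \<Longrightarrow> 1 \<le> i \<Longrightarrow> len (w \<circ> transpose i (i + 1)) < len w \<Longrightarrow>
    is_groth (w \<circ> transpose i (i + 1)) (isobaric i f)"

definition groth :: "(nat \<Rightarrow> nat) \<Rightarrow> int_mpoly" where
  "groth w = (THE f. is_groth w f)"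

text \<open>\<open>struct_const \<sigma> \<rho> \<pi>\<close> is $C^\pi_{\sigma,\rho}$.\<close>

definition struct_const :: "(nat \<Rightarrow> nat) \<Rightarrow> (nat \<Rightarrow> nat) \<Rightarrow> (nat \<Rightarrow> nat) \<Rightarrow> int" where
  "struct_const \<sigma> \<rho> =
     (THE c. finite {\<pi>. c \<pi> \<noteq> 0} \<and> {\<pi>. c \<pi> \<noteq> 0} \<subseteq> S_inf \<and>
        groth \<sigma> * groth \<rho> = (\<Sum>\<pi> | c \<pi> \<noteq> 0. of_int (c \<pi>) * groth \<pi>))"


section \<open>Diagrams, maximal corner, pivots\<close>

text \<open>Cells are pairs (row, column).\<close>

definition hook :: "nat \<times> nat \<Rightarrow> (nat \<times> nat) set" where
  "hook d = {(p, q). p = fst d \<and> q \<ge> snd d \<or> q = snd d \<and> p \<ge> fst d}"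

definition diagram :: "(nat \<Rightarrow> nat) \<Rightarrow> (nat \<times> nat) set" where
  "diagram w = {(p, q). 1 \<le> p \<and> 1 \<le> q \<and> w p > q \<and> inv w q > p}"

definition corner_row :: "(nat \<Rightarrow> nat) \<Rightarrow> nat" where
  "corner_row w = Max (fst ` diagram w)"

definition corner_col :: "(nat \<Rightarrow> nat) \<Rightarrow> nat" where
  "corner_col w = Max {q. (corner_row w, q) \<in> diagram w}"

definition nw_rows :: "(nat \<Rightarrow> nat) \<Rightarrow> nat set" where
  "nw_rows w = {i. 1 \<le> i \<and> i < corner_row w \<and> w i < corner_col w}"

definition pivot_rows :: "(nat \<Rightarrow> nat) \<Rightarrow> nat set" where
  "pivot_rows w = {i \<in> nw_rows w. \<not> (\<exists>a \<in> nw_rows w. i < a \<and> w i < w a)}"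


section \<open>Marching\<close>

definition perm_of_diagram :: "(nat \<times> nat) set \<Rightarrow> nat \<Rightarrow> nat" where
  "perm_of_diagram B = (THE w. w \<in> S_inf \<and> diagram w = B)"

text \<open>The cells left uncovered once the hook of the dot in row \<open>i\<close> has been removed.\<close>

definition open_cells :: "(nat \<Rightarrow> nat) \<Rightarrow> nat \<Rightarrow> (nat \<times> nat) set" where
  "open_cells w i =
     {(p, q). 1 \<le> p \<and> 1 \<le> q \<and> (\<forall>a. 1 \<le> a \<and> a \<noteq> i \<longrightarrow> (p, q) \<notin> hook (a, w a))}"

text \<open>\<open>move_box A b B\<close> moves the box \<open>b\<close> of the box set \<open>B\<close> strictly northwest into the only
  available space, i.e. the only cell there that lies in \<open>A\<close> and is not occupied by a box.\<close>

definition move_box :: "(nat \<times> nat) set \<Rightarrow> nat \<times> nat \<Rightarrow> (nat \<times> nat) set \<Rightarrow> (nat \<times> nat) set" where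
  "move_box A b B =
     insert (THE c. c \<in> A \<and> c \<notin> B \<and> fst c < fst b \<and> snd c < snd b) (B - {b})"

text \<open>\<^const>\<open>List.product\<close> lists the rectangle row by row, each row from left to right.\<close>

definition march :: "(nat \<Rightarrow> nat) \<Rightarrow> nat \<Rightarrow> nat \<Rightarrow> nat" where
  "march w i =
     perm_of_diagram
       (fold (move_box (open_cells w i))
         (filter (\<lambda>b. b \<in> diagram w)
           (List.product [i..<corner_row w + 1] [w i..<corner_col w + 1]))
         (diagram w))"

definition add_box :: "nat \<Rightarrow> (nat \<Rightarrow> nat) \<Rightarrow> nat \<Rightarrow> nat" where
  "add_box l w = perm_of_diagram (insert (l, w l) (diagram w))"

fun K_march_list :: "nat \<Rightarrow> (nat \<Rightarrow> nat) \<Rightarrow> nat list \<Rightarrow> nat \<Rightarrow> nat" where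
  "K_march_list l w [] = w"
| "K_march_list l w [i] = march w i"
| "K_march_list l w (i # i' # is) = K_march_list l (add_box l (march w i)) (i' # is)"

definition K_march :: "(nat \<Rightarrow> nat) \<Rightarrow> nat set \<Rightarrow> nat \<Rightarrow> nat" where
  "K_march w I = K_march_list (corner_row w) w (sorted_list_of_set I)"


section \<open>Marching trees\<close>

text \<open>A vertex of a tree is represented by the pair of its path from the root and its label. The
  path is the list of the sets of pivot rows marched to, so vertices with equal labels stay
  distinct. The label \<^const>\<open>None\<close> stands for $\emptyset$; the edge to such a vertex is \<open>{}\<close>.\<close>

type_synonym label = "(nat \<Rightarrow> nat) option"

definition march_children :: "(nat \<Rightarrow> nat) \<Rightarrow> (nat set \<times> label) set" where
  "march_children w =
     (if pivot_rows w = {} then {({}, None)}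
      else {({i}, Some (march w i)) | i. i \<in> pivot_rows w})"

definition K_march_children :: "(nat \<Rightarrow> nat) \<Rightarrow> (nat set \<times> label) set" where
  "K_march_children w =
     (if pivot_rows w = {} then {({}, None)}
      else {(I, Some (K_march w I)) | I. I \<noteq> {} \<and> I \<subseteq> pivot_rows w})"

fun leaf_label :: "nat \<Rightarrow> label \<Rightarrow> bool" where
  "leaf_label t None = True"
| "leaf_label t (Some w) = (last_descent w \<le> t)"

inductive_set tree :: "((nat \<Rightarrow> nat) \<Rightarrow> (nat set \<times> label) set) \<Rightarrow> nat \<Rightarrow> (nat \<Rightarrow> nat)
    \<Rightarrow> (nat set list \<times> label) set"
  for children :: "(nat \<Rightarrow> nat) \<Rightarrow> (nat set \<times> label) set" and t :: nat and \<beta> :: "nat \<Rightarrow> nat"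
where
  root: "([], Some \<beta>) \<in> tree children t \<beta>"
| child: "(path, Some w) \<in> tree children t \<beta> \<Longrightarrow> \<not> leaf_label t (Some w) \<Longrightarrow>
    (e, L) \<in> children w \<Longrightarrow> (path @ [e], L) \<in> tree children t \<beta>"

definition T_leaves :: "nat \<Rightarrow> (nat \<Rightarrow> nat) \<Rightarrow> (nat set list \<times> label) set" where
  "T_leaves t \<beta> = {v \<in> tree march_children t \<beta>. leaf_label t (snd v)}"

definition KT_leaves :: "nat \<Rightarrow> (nat \<Rightarrow> nat) \<Rightarrow> (nat set list \<times> label) set" where
  "KT_leaves t \<beta> = {v \<in> tree K_march_children t \<beta>. leaf_label t (snd v)}"

end

theory Submission
  imports Defs "HOL-Computational_Algebra.Fraction_Field"
begin

text \<open>
  For the last descent \<open>l\<close> of \<open>w\<close>, Lascoux's transition formula expresses the Grothendieck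
  polynomial of \<open>w\<close> at \<open>x\<^sub>l = 0\<close> as the signed sum of the Grothendieck polynomials of the outputs
  of the \<open>K\<close>-marchings of \<open>w\<close>. Iterating, setting \<open>x\<^sub>i = 0\<close> for all \<open>i > t\<close> turns the polynomial of
  \<open>\<beta>\<close> into the signed sum over the leaves of the tree of \<open>\<beta>\<close>. The polynomial of \<open>\<sigma> \<star> \<alpha>\<close> is the
  product of those of \<open>\<sigma>\<close> and of \<open>id \<star> \<alpha>\<close>; the truncation fixes the first factor and turns the
  second one into the polynomial of \<open>\<rho>\<close>, so that the leaves of the tree of \<open>\<sigma> \<star> \<alpha>\<close> compute the
  product of the polynomials of \<open>\<sigma>\<close> and \<open>\<rho>\<close>.

  The transition formula is an instance of a Monk formula for multiplication by \<open>1 - x\<^sub>k\<close>. Both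
  this formula and the factorization are proved by induction on the length: an isobaric divided
  difference either fixes the difference of the two sides or turns it into the difference for
  shorter permutations, that is \<open>0\<close>, and a polynomial without constant term that each isobaric
  divided difference either kills or fixes is zero.
\<close>

text \<open>The sign in the theorem involves the length of \<open>\<rho>\<close>, whereas the leaf
  sums are signed by the length of the root \<open>star n id \<alpha>\<close>. These lengths agree:
  a permutation with a nonempty leaf also has a leaf of its own length, and uniqueness identifies it
  with \<open>\<rho>\<close>. Lengths settle the cohomology case as well: a marching keeps the
  length and a K-marching along k rows raises it by k - 1, so a leaf as long as the root is reached
  by single marchings only. Marching is a game with boxes, transition a statement about Bruhat
  covers. They are joined by writing a permutation with last descent l as
  \<open>add_corner l u\<close>, a cover of \<open>u\<close>: the pivots are the rows i for which
  exchanging rows i and l of \<open>u\<close> is a cover, and marching towards i performs this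
  exchange. The polynomials are given by a description that allows every choice of descents from
  every longest element; commutation, the braid relation and stability show that the choice is
  immaterial.\<close>

abbreviation lookup :: "('a \<Rightarrow>\<^sub>0 'b::zero) \<Rightarrow> 'a \<Rightarrow> 'b" where "lookup \<equiv> Poly_Mapping.lookup"
abbreviation keys :: "('a \<Rightarrow>\<^sub>0 'b::zero) \<Rightarrow> 'a set" where "keys \<equiv> Poly_Mapping.keys"
abbreviation single :: "'a \<Rightarrow> 'b \<Rightarrow> 'a \<Rightarrow>\<^sub>0 'b::zero" where "single \<equiv> Poly_Mapping.single"

section \<open>Substitution homomorphisms\<close>

definition mon_ev :: "(nat \<Rightarrow> 'b::comm_ring_1) \<Rightarrow> (nat \<Rightarrow>\<^sub>0 nat) \<Rightarrow> 'b" where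
  "mon_ev \<phi> m = (\<Prod>i\<in>keys m. \<phi> i ^ lookup m i)"

text \<open>Values in an arbitrary commutative ring let one notion serve for exchanging variables,
  for truncation and for evaluation at a point.\<close>

definition ev :: "(nat \<Rightarrow> 'b::comm_ring_1) \<Rightarrow> int_mpoly \<Rightarrow> 'b" where
  "ev \<phi> f = (\<Sum>m\<in>keys f. of_int (lookup f m) * mon_ev \<phi> m)"

lemma mon_ev_superset:
  assumes "finite A" "keys m \<subseteq> A"
  shows "mon_ev \<phi> m = (\<Prod>i\<in>A. \<phi> i ^ lookup m i)"
  unfolding mon_ev_def
  by (rule prod.mono_neutral_left) (use assms in \<open>auto simp: in_keys_iff\<close>)

lemma mon_ev_add: "mon_ev \<phi> (m + n) = mon_ev \<phi> m * mon_ev \<phi> n"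
proof -
  let ?A = "keys m \<union> keys n"
  have "mon_ev \<phi> (m + n) = (\<Prod>i\<in>?A. \<phi> i ^ lookup (m + n) i)"
    by (rule mon_ev_superset) (auto dest: subsetD[OF keys_add])
  also have "\<dots> = mon_ev \<phi> m * mon_ev \<phi> n"
    using mon_ev_superset[of ?A m \<phi>] mon_ev_superset[of ?A n \<phi>]
    by (simp add: lookup_add power_add prod.distrib)
  finally show ?thesis .
qed

lemma ev_superset:
  assumes "finite A" "keys f \<subseteq> A"
  shows "ev \<phi> f = (\<Sum>m\<in>A. of_int (lookup f m) * mon_ev \<phi> m)"
  unfolding ev_def
  by (rule sum.mono_neutral_left) (use assms in \<open>auto simp: in_keys_iff\<close>)

lemma ev_single: "ev \<phi> (single m c) = of_int c * mon_ev \<phi> m"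
  by (subst ev_superset[of "{m}"]) auto

lemma ev_0 [simp]: "ev \<phi> 0 = 0"
  by (simp add: ev_def)

lemma ev_add [simp]: "ev \<phi> (f + g) = ev \<phi> f + ev \<phi> g"
proof -
  let ?A = "keys f \<union> keys g"
  have "ev \<phi> (f + g) = (\<Sum>m\<in>?A. of_int (lookup (f + g) m) * mon_ev \<phi> m)"
    by (rule ev_superset) (auto dest: subsetD[OF keys_add])
  also have "\<dots> = ev \<phi> f + ev \<phi> g"
    using ev_superset[of ?A f \<phi>] ev_superset[of ?A g \<phi>]
    by (simp add: lookup_add algebra_simps sum.distrib)
  finally show ?thesis .
qed

lemma mpoly_add_induct [case_names single add]:
  fixes f :: "'a \<Rightarrow>\<^sub>0 'b::comm_monoid_add"
  assumes "\<And>m c. P (single m c)" "\<And>f g. P f \<Longrightarrow> P g \<Longrightarrow> P (f + g)"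
  shows "P f"
proof (induct f rule: update_induct)
  case const
  then show ?case using assms(1)[of undefined 0] by simp
next
  case (update f a b)
  have "Poly_Mapping.update a b f = f + single a b"
    using update(1)
    by (intro poly_mapping_eqI) (auto simp: lookup_update lookup_add lookup_single in_keys_iff when_def)
  then show ?case using assms update by simp
qed

lemma ev_mult [simp]: "ev \<phi> (f * g) = ev \<phi> f * ev \<phi> g"
proof (induct f rule: mpoly_add_induct)
  case (single m c)
  show ?case
  proof (induct g rule: mpoly_add_induct)
    case (single n d)
    show ?case by (simp add: mult_single ev_single mon_ev_add algebra_simps)
  qed (simp add: algebra_simps)
qed (simp add: algebra_simps)

lemma ev_of_int [simp]: "ev \<phi> (of_int c) = of_int c"
proof -
  have "ev \<phi> (of_int c) = ev \<phi> (single 0 c)" by (metis of_int_eq_id id_apply single_of_int)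
  then show ?thesis by (simp add: ev_single mon_ev_def)
qed

lemma ev_1 [simp]: "ev \<phi> 1 = 1"
  using ev_of_int[of \<phi> 1] by simp

lemma ev_uminus [simp]: "ev \<phi> (- f) = - ev \<phi> f"
  using ev_add[of \<phi> f "- f"] by (simp add: eq_neg_iff_add_eq_0 add.commute)

lemma ev_diff [simp]: "ev \<phi> (f - g) = ev \<phi> f - ev \<phi> g"
  using ev_add[of \<phi> f "- g"] by simp

lemma ev_power [simp]: "ev \<phi> (f ^ n) = ev \<phi> f ^ n"
  by (induct n) auto

lemma ev_sum: "ev \<phi> (sum f A) = (\<Sum>a\<in>A. ev \<phi> (f a))"
  by (induct A rule: infinite_finite_induct) auto

lemma ev_prod: "ev \<phi> (prod f A) = (\<Prod>a\<in>A. ev \<phi> (f a))"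
  by (induct A rule: infinite_finite_induct) auto

lemma ev_X [simp]: "ev \<phi> (X i) = \<phi> i"
  by (simp add: X_def ev_single mon_ev_def)

lemma X_power: "X i ^ n = single (single i n) 1"
  by (induct n) (auto simp: X_def mult_single simp flip: single_add)

lemma single_eq_prod_X:
  "single m (c :: int) = of_int c * (\<Prod>i\<in>keys m. X i ^ lookup m i)"
proof -
  have "(\<Prod>i\<in>A. X i ^ lookup m i) = single (\<Sum>i\<in>A. single i (lookup m i)) 1" if "finite A" for A
    using that by induct (auto simp: X_power mult_single)
  moreover have "(\<Sum>i\<in>keys m. single i (lookup m i)) = m"
    by (rule poly_mapping_eqI)
       (auto simp: lookup_sum lookup_single when_def in_keys_iff)
  ultimately have "(\<Prod>i\<in>keys m. X i ^ lookup m i) = single m 1"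
    by simp
  moreover have "of_int c * single m (1 :: int) = single m c"
    using mult_single[of 0 c m 1] by (metis add_0 mult.right_neutral of_int_eq_id id_apply single_of_int)
  ultimately show ?thesis by simp
qed

lemma mpoly_induct [case_names of_int X add mult]:
  assumes of_int: "\<And>c. P (of_int c)" and X: "\<And>i. P (X i)"
    and add: "\<And>f g. P f \<Longrightarrow> P g \<Longrightarrow> P (f + g)" and mult: "\<And>f g. P f \<Longrightarrow> P g \<Longrightarrow> P (f * g)"
  shows "P f"
proof (induct f rule: mpoly_add_induct)
  case (single m c)
  have one: "P 1" using of_int[of 1] by simp
  have pow: "P (X i ^ n)" for i n
    by (induct n) (auto simp: one intro: mult X)
  have "P (\<Prod>i\<in>A. X i ^ lookup m i)" for A
    by (induct A rule: infinite_finite_induct) (auto simp: one intro: mult pow)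
  then show ?case
    unfolding single_eq_prod_X by (intro mult of_int)
qed (rule add)

lemma ev_ev: "ev \<phi> (ev \<psi> f) = ev (\<lambda>i. ev \<phi> (\<psi> i)) f"
  by (induct f rule: mpoly_induct) auto

lemma ev_id: "ev X f = f"
  by (induct f rule: mpoly_induct) auto

lemma map_key_transpose_invol:
  "Poly_Mapping.map_key (transpose i j) (Poly_Mapping.map_key (transpose i j) m) = m"
  by (simp add: map_key_compose comp_def map_key_id)

text \<open>\<open>map_key\<close> pulls back along a map of the keys. A transposition is its own
  inverse, so pulling back the exponent vectors amounts to substituting the exchanged variables. In
  this form \<open>swap_vars\<close> inherits the laws of a ring homomorphism from
  \<open>ev\<close>.\<close>

lemma swap_vars_ev: "swap_vars i f = ev (\<lambda>j. X (transpose i (i + 1) j)) f"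
proof (induct f rule: mpoly_add_induct)
  case (single m c)
  let ?\<tau> = "transpose i (i + 1)"
  let ?T = "Poly_Mapping.map_key ?\<tau> :: (nat \<Rightarrow>\<^sub>0 nat) \<Rightarrow> _"
  have inv: "?T (?T m) = m" for m by (rule map_key_transpose_invol)
  have injt: "inj (transpose i (Suc i))" by simp
  have inj: "inj ?T" by (rule inj_on_inverseI[of _ ?T]) (rule inv)
  have "swap_vars i (single m c) = single (?T m) c"
    using map_key_single[OF inj, of "?T m" c] unfolding swap_vars_def inv .
  also have "\<dots> = of_int c * (\<Prod>j\<in>keys (?T m). X j ^ lookup (?T m) j)"
    by (rule single_eq_prod_X)
  also have "keys (?T m) = ?\<tau> ` keys m"
  proof -
    have "keys (?T m) = ?\<tau> -` keys m" by (rule keys_map_key) simp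
    also have "\<dots> = ?\<tau> ` keys m"
      by (metis bij_transpose bij_vimage_eq_inv_image inv_transpose_eq)
    finally show ?thesis .
  qed
  also have "(\<Prod>j\<in>?\<tau> ` keys m. X j ^ lookup (?T m) j) = (\<Prod>j\<in>keys m. X (?\<tau> j) ^ lookup m j)"
    by (subst prod.reindex)
       (auto simp: map_key.rep_eq[OF injt] comp_def intro: inj_on_subset[OF injt])
  finally show ?case by (simp add: ev_single mon_ev_def)
next
  case (add f g)
  let ?T = "Poly_Mapping.map_key (transpose i (i + 1)) :: (nat \<Rightarrow>\<^sub>0 nat) \<Rightarrow> _"
  have inj: "inj ?T" by (rule inj_on_inverseI[of _ ?T]) (rule map_key_transpose_invol)
  show ?case using add unfolding swap_vars_def map_key_plus[OF inj] by simp
qed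

lemma swap_simps [simp]:
  "swap_vars i (f + g) = swap_vars i f + swap_vars i g"
  "swap_vars i (f - g) = swap_vars i f - swap_vars i g"
  "swap_vars i (- f) = - swap_vars i f"
  "swap_vars i (f * g) = swap_vars i f * swap_vars i g"
  "swap_vars i (of_int c) = of_int c"
  "swap_vars i 0 = 0" "swap_vars i 1 = 1"
  "swap_vars i (f ^ n) = swap_vars i f ^ n"
  "swap_vars i (X j) = X (transpose i (i + 1) j)"
  by (simp_all add: swap_vars_ev)

lemma swap_swap [simp]: "swap_vars i (swap_vars i f) = f"
  by (simp add: swap_vars_ev ev_ev ev_id)

lemma ev_swap: "ev \<phi> (swap_vars i f) = ev (\<phi> \<circ> transpose i (i + 1)) f"
  by (simp add: swap_vars_ev ev_ev comp_def)

lemma X_inj [simp]: "X i = X j \<longleftrightarrow> i = j"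
proof
  assume "X i = X j"
  then have "ev (\<lambda>k. if k = i then 1 else 0 :: int) (X i) = ev (\<lambda>k. if k = i then 1 else 0) (X j)" by simp
  then show "i = j" by (simp split: if_splits)
qed simp

lemma one_minus_X_nonzero [simp]: "1 - X i \<noteq> 0"
proof
  assume "1 - X i = 0"
  then have "ev (\<lambda>k. 0 :: int) (1 - X i) = ev (\<lambda>k. 0) 0" by (rule arg_cong)
  then show False by simp
qed

lemma X_neq_1 [simp]: "X i \<noteq> 1"
  using one_minus_X_nonzero[of i] by force

section \<open>Isobaric divided differences\<close>

text \<open>With s the exchange, divisibility of f - s f by \<open>X i - X (i + 1)\<close> holds for
  constants and variables and passes to products by f g - s(f g) = (f - s f) g + s f (g - s g). The
  numerator in question is h - s h for h = \<open>(1 - X (i + 1)) * f\<close>.\<close>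

lemma isobaric_exists:
  "\<exists>g. (X i - X (i + 1)) * g = (1 - X (i + 1)) * f - (1 - X i) * swap_vars i f"
proof -
  have "\<exists>g. (X i - X (i + 1)) * g = f - swap_vars i f" for f
  proof (induct f rule: mpoly_induct)
    case (of_int c)
    then show ?case by (intro exI[of _ 0]) simp
  next
    case (X j)
    consider "j = i" | "j = i + 1" | "j \<noteq> i" "j \<noteq> i + 1" by blast
    then show ?case
    proof cases
      case 1 then show ?thesis by (intro exI[of _ 1]) simp
    next
      case 2 then show ?thesis by (intro exI[of _ "-1"]) simp
    next
      case 3 then show ?thesis by (intro exI[of _ 0]) simp
    qed
  next
    case (add f g)
    then obtain a b where "(X i - X (i + 1)) * a = f - swap_vars i f"
      "(X i - X (i + 1)) * b = g - swap_vars i g" by blast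
    then show ?case by (intro exI[of _ "a + b"]) (simp add: distrib_left)
  next
    case (mult f g)
    then obtain a b where ab: "(X i - X (i + 1)) * a = f - swap_vars i f"
      "(X i - X (i + 1)) * b = g - swap_vars i g" by blast
    have "(X i - X (i + 1)) * (a * g + swap_vars i f * b)
      = ((X i - X (i + 1)) * a) * g + swap_vars i f * ((X i - X (i + 1)) * b)"
      by (simp only: algebra_simps)
    also have "\<dots> = f * g - swap_vars i (f * g)"
      unfolding ab by (simp add: algebra_simps)
    finally show ?case by blast
  qed
  from this[of "(1 - X (i + 1)) * f"] show ?thesis by (simp add: algebra_simps)
qed

lemma X_diff_nonzero [simp]: "X i - X (i + 1) \<noteq> 0" "X i - X (Suc i) \<noteq> 0"
  by simp_all

lemma isobaric_eqI:
  assumes "(X i - X (i + 1)) * g = (1 - X (i + 1)) * f - (1 - X i) * swap_vars i f"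
  shows "isobaric i f = g"
  unfolding isobaric_def
proof (rule the_equality)
  fix h assume "(X i - X (i + 1)) * h = (1 - X (i + 1)) * f - (1 - X i) * swap_vars i f"
  then have "(X i - X (i + 1)) * h = (X i - X (i + 1)) * g" using assms by simp
  then show "h = g" by simp
qed (rule assms)

lemma isobaric_eq:
  "(X i - X (i + 1)) * isobaric i f = (1 - X (i + 1)) * f - (1 - X i) * swap_vars i f"
  using isobaric_exists isobaric_eqI by metis

lemma isobaric_add [simp]: "isobaric i (f + g) = isobaric i f + isobaric i g"
  by (rule isobaric_eqI) (simp only: distrib_left isobaric_eq swap_simps, simp add: algebra_simps)

lemma isobaric_eq_self_iff: "isobaric i f = f \<longleftrightarrow> swap_vars i f = f"
proof
  assume "isobaric i f = f"
  then have "(X i - X (i + 1)) * f = (1 - X (i + 1)) * f - (1 - X i) * swap_vars i f"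
    using isobaric_eq[of i f] by simp
  then have "(1 - X i) * swap_vars i f = (1 - X i) * f" by (simp add: algebra_simps)
  then show "swap_vars i f = f" by simp
next
  assume "swap_vars i f = f"
  then show "isobaric i f = f" by (intro isobaric_eqI) (simp add: algebra_simps)
qed

text \<open>A twisted Leibniz rule. Since \<open>isobaric i g = g\<close> exactly for symmetric g,
  it lets symmetric factors be taken out.\<close>

lemma isobaric_mult:
  "isobaric i (f * g) = isobaric i f * g + swap_vars i f * (isobaric i g - g)"
proof (rule isobaric_eqI)
  have "(X i - X (i + 1)) * (isobaric i f * g + swap_vars i f * (isobaric i g - g))
    = ((X i - X (i + 1)) * isobaric i f) * g
      + swap_vars i f * ((X i - X (i + 1)) * isobaric i g - (X i - X (i + 1)) * g)"
    by (simp only: algebra_simps)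
  also have "\<dots> = (1 - X (i + 1)) * (f * g) - (1 - X i) * swap_vars i (f * g)"
    unfolding isobaric_eq by (simp add: algebra_simps)
  finally show "(X i - X (i + 1)) * (isobaric i f * g + swap_vars i f * (isobaric i g - g))
    = (1 - X (i + 1)) * (f * g) - (1 - X i) * swap_vars i (f * g)" .
qed

lemma isobaric_mult_sym:
  assumes "swap_vars i g = g"
  shows "isobaric i (g * f) = g * isobaric i f"
proof -
  have "isobaric i g = g" using assms by (simp add: isobaric_eq_self_iff)
  then show ?thesis unfolding isobaric_mult[of i g] assms by (simp add: algebra_simps)
qed

lemma isobaric_of_int_mult: "isobaric i (of_int c * f) = of_int c * isobaric i f"
  by (rule isobaric_mult_sym) simp

lemma isobaric_uminus [simp]: "isobaric i (- f) = - isobaric i f"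
  using isobaric_of_int_mult[of i "-1" f] by simp

lemma isobaric_0 [simp]: "isobaric i 0 = 0"
  using isobaric_of_int_mult[of i 0 0] by simp

lemma isobaric_diff [simp]: "isobaric i (f - g) = isobaric i f - isobaric i g"
  using isobaric_add[of i f "- g"] by simp

lemma isobaric_sum: "isobaric i (sum f A) = (\<Sum>a\<in>A. isobaric i (f a))"
  by (induct A rule: infinite_finite_induct) auto

lemma isobaric_eq_0D: "isobaric i f = 0 \<Longrightarrow> (1 - X i) * swap_vars i f = (1 - X (i + 1)) * f"
  using isobaric_eq[of i f] by simp

lemma swap_isobaric [simp]: "swap_vars i (isobaric i f) = isobaric i f"
proof -
  have "swap_vars i ((X i - X (i + 1)) * isobaric i f)
    = swap_vars i ((1 - X (i + 1)) * f - (1 - X i) * swap_vars i f)"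
    by (simp only: isobaric_eq)
  then have "(X (i + 1) - X i) * swap_vars i (isobaric i f)
    = (1 - X i) * swap_vars i f - (1 - X (i + 1)) * f" by simp
  also have "\<dots> = (X (i + 1) - X i) * isobaric i f"
    using isobaric_eq[of i f] by (simp add: algebra_simps)
  finally show ?thesis by simp
qed

lemma isobaric_idem [simp]: "isobaric i (isobaric i f) = isobaric i f"
  by (simp add: isobaric_eq_self_iff)

text \<open>One of the rules for moving a divided difference past a factor 1 - x_k. They trade the
  indices i and i + 1 and leave correction terms, which the Monk formula has to reproduce on the
  side of the permutations.\<close>

lemma isobaric_y: "isobaric i ((1 - X i) * f) = (1 - X (i + 1)) * (isobaric i f - f)"
proof -
  have "isobaric i (1 - X i) = 0" by (rule isobaric_eqI) (simp add: algebra_simps)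
  then show ?thesis unfolding isobaric_mult[of i "1 - X i"] by simp
qed

lemma isobaric_y_Suc:
  "isobaric i ((1 - X (i + 1)) * f) = (1 - X i) * isobaric i f + (1 - X (i + 1)) * f"
proof -
  have "isobaric i (1 - X (i + 1)) = (1 - X i) + (1 - X (i + 1))"
    by (rule isobaric_eqI) (simp add: algebra_simps)
  then show ?thesis
    by (simp only: isobaric_mult[of i "1 - X (i + 1)"]) (simp add: algebra_simps del: isobaric_diff)
qed

lemma isobaric_y_other:
  "k \<noteq> i \<Longrightarrow> k \<noteq> i + 1 \<Longrightarrow> isobaric i ((1 - X k) * f) = (1 - X k) * isobaric i f"
  by (rule isobaric_mult_sym) simp


lemma isobaric_commute:
  assumes "i + 1 < j"
  shows "isobaric i (isobaric j f) = isobaric j (isobaric i f)"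
proof -
  have sw: "swap_vars i (swap_vars j f) = swap_vars j (swap_vars i f)" for f
  proof -
    have "ev (\<lambda>k. X (transpose i (i + 1) (transpose j (j + 1) k))) f
      = ev (\<lambda>k. X (transpose j (j + 1) (transpose i (i + 1) k))) f"
      using assms by (intro arg_cong[where f = "\<lambda>\<phi>. ev \<phi> f"]) (auto simp: fun_eq_iff transpose_def)
    then show ?thesis by (simp add: swap_vars_ev ev_ev)
  qed
  have inv: "swap_vars i (X j) = X j" "swap_vars i (X (j + 1)) = X (j + 1)"
    using assms by (auto simp: transpose_def)
  have "isobaric j (swap_vars i f) = swap_vars i (isobaric j f)"
  proof (rule isobaric_eqI)
    have "(X j - X (j + 1)) * swap_vars i (isobaric j f) = swap_vars i ((X j - X (j + 1)) * isobaric j f)"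
      using inv by (simp only: swap_simps(2,4))
    also have "\<dots> = (1 - X (j + 1)) * swap_vars i f - (1 - X j) * swap_vars j (swap_vars i f)"
      unfolding isobaric_eq using inv by (simp only: swap_simps(2,4,7) sw)
    finally show "(X j - X (j + 1)) * swap_vars i (isobaric j f)
      = (1 - X (j + 1)) * swap_vars i f - (1 - X j) * swap_vars j (swap_vars i f)" .
  qed
  note comm = this
  show ?thesis
  proof (rule isobaric_eqI)
    have "swap_vars j (X i - X (i + 1)) = X i - X (i + 1)" "swap_vars j (1 - X i) = 1 - X i"
      "swap_vars j (1 - X (i + 1)) = 1 - X (i + 1)"
      using assms by (auto simp: transpose_def)
    note m = this[THEN isobaric_mult_sym]
    have "(X i - X (i + 1)) * isobaric j (isobaric i f) = isobaric j ((X i - X (i + 1)) * isobaric i f)"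
      by (simp only: m)
    also have "\<dots> = (1 - X (i + 1)) * isobaric j f - (1 - X i) * isobaric j (swap_vars i f)"
      unfolding isobaric_eq by (simp only: isobaric_diff m)
    finally show "(X i - X (i + 1)) * isobaric j (isobaric i f)
      = (1 - X (i + 1)) * isobaric j f - (1 - X i) * swap_vars i (isobaric j f)"
      by (simp only: comm)
  qed
qed

text \<open>Here a, b, c stand for x_i, x_(i+1), x_(i+2), the letters s and r for the two adjacent
  exchanges, and \<open>Fsr\<close> for the image s(r f), and so on. Both sides equal the
  antisymmetrization of (1-c)^2 (1-b) F over the six permutations of a, b, c, divided by the product
  of the three differences.\<close>

lemma braid_identity:
  fixes a b c F Fs Fr Fsr Frs Fsrs :: "'a::field"
  assumes "a - b \<noteq> 0" "b - c \<noteq> 0" "a - c \<noteq> 0"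
  defines "h \<equiv> ((1-b)*F-(1-a)*Fs)/(a-b)" and "k \<equiv> ((1-c)*F-(1-b)*Fr)/(b-c)"
  defines "rh \<equiv> ((1-c)*Fr-(1-a)*Frs)/(a-c)" and "sk \<equiv> ((1-c)*Fs-(1-a)*Fsr)/(a-c)"
  defines "srh \<equiv> ((1-c)*Fsr-(1-b)*Fsrs)/(b-c)" and "rsk \<equiv> ((1-b)*Frs-(1-a)*Fsrs)/(a-b)"
  shows "((1-b)*(((1-c)*h-(1-b)*rh)/(b-c))-(1-a)*(((1-c)*h-(1-a)*srh)/(a-c)))/(a-b)
    = ((1-c)*(((1-b)*k-(1-a)*sk)/(a-b))-(1-b)*(((1-c)*k-(1-a)*rsk)/(a-c)))/(b-c)"
proof -
  define p q r where pqr: "p = a - b" "q = b - c" "r = a - c"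
  have nz: "p \<noteq> 0" "q \<noteq> 0" "r \<noteq> 0" using assms(1-3) by (simp_all add: pqr)
  \<comment> \<open>The two coefficients of \<open>h\<close> have different denominators; by
    \<open>K1\<close> they add up to a multiple of p, which cancels the outer denominator.
    \<open>K2\<close> does the same for \<open>k\<close> and q.\<close>
  have K1: "(1-b)/q - (1-a)/r = p*(1-c)/(q*r)" and K2: "1/p - 1/r = q/(p*r)"
    using nz by (simp_all add: field_simps) (simp_all add: pqr algebra_simps)
  have "((1-b)*(((1-c)*h-(1-b)*rh)/q)-(1-a)*(((1-c)*h-(1-a)*srh)/r))/p
    = ((1-c)*h*((1-b)/q - (1-a)/r) - (1-b)^2*rh/q + (1-a)^2*srh/r)/p"
    by (simp add: diff_divide_distrib add_divide_distrib power2_eq_square algebra_simps)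
  also have "\<dots> = ((1-c)^2*(1-b)*F - (1-c)^2*(1-a)*Fs - (1-b)^2*(1-c)*Fr + (1-b)^2*(1-a)*Frs
      + (1-a)^2*(1-c)*Fsr - (1-a)^2*(1-b)*Fsrs)/(p*q*r)"
    unfolding K1 h_def rh_def srh_def pqr[symmetric]
    using nz by (simp add: divide_simps) (simp add: power2_eq_square algebra_simps)
  also have "\<dots> = ((1-c)*(1-b)*k*(1/p - 1/r) - (1-c)*(1-a)*sk/p + (1-b)*(1-a)*rsk/r)/q"
    unfolding K2 k_def sk_def rsk_def pqr[symmetric]
    using nz by (simp add: divide_simps) (simp add: power2_eq_square algebra_simps)
  also have "\<dots> = ((1-c)*(((1-b)*k-(1-a)*sk)/p)-(1-b)*(((1-c)*k-(1-a)*rsk)/r))/q"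
    by (simp add: diff_divide_distrib add_divide_distrib algebra_simps)
  finally show ?thesis by (simp only: pqr)
qed

lemma Fract_hom:
  fixes f g :: int_mpoly
  shows "Fract (f * g) 1 = Fract f 1 * Fract g 1" "Fract (f - g) 1 = Fract f 1 - Fract g 1"
    "Fract 1 (1 :: int_mpoly) = 1" "Fract f 1 = Fract g 1 \<longleftrightarrow> f = g" "Fract f 1 = 0 \<longleftrightarrow> f = 0"
  by (simp_all add: One_fract_def eq_fract Zero_fract_def)

text \<open>In the fraction field each divided difference is an explicit quotient, and both triple
  products become rational expressions in the six images of \<open>f\<close>. The relation
  \<open>srs\<close> identifies the image under the longest permutation on both sides.\<close>

lemma isobaric_braid:
  defines "j \<equiv> \<lambda>i::nat. i + 1"
  shows "isobaric i (isobaric (j i) (isobaric i f)) = isobaric (j i) (isobaric i (isobaric (j i) f))"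
proof -
  define e where "e = (\<lambda>f :: int_mpoly. Fract f 1)"
  define s r where "s = swap_vars i" and "r = swap_vars (i + 1)"
  define a b c where "a = X i" and "b = X (i + 1)" and "c = X (i + 2)"
  have sX: "s a = b" "s b = a" "s c = c" "r a = a" "r b = c" "r c = b"
    by (auto simp: s_def r_def a_def b_def c_def transpose_def)
  have srs: "s (r (s f)) = r (s (r f))"
    unfolding s_def r_def swap_vars_ev ev_ev
    by (intro arg_cong[where f = "\<lambda>\<phi>. ev \<phi> f"]) (auto simp: fun_eq_iff transpose_def)
  have e: "e (f * g) = e f * e g" "e (f - g) = e f - e g" "e 1 = 1" "e f = e g \<longleftrightarrow> f = g" for f g
    unfolding e_def by (rule Fract_hom)+
  have nz: "e a - e b \<noteq> 0" "e b - e c \<noteq> 0" "e a - e c \<noteq> 0"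
    by (auto simp: e a_def b_def c_def)
  have i0: "(a - b) * isobaric i g = (1 - b) * g - (1 - a) * s g"
    and j0: "(b - c) * isobaric (i + 1) g = (1 - c) * g - (1 - b) * r g" for g
    using isobaric_eq[of i g] isobaric_eq[of "i + 1" g]
    by (simp_all add: a_def b_def c_def s_def r_def numeral_2_eq_2)
  have sr: "s (f * g) = s f * s g" "s (f - g) = s f - s g" "s 1 = 1"
    "r (f * g) = r f * r g" "r (f - g) = r f - r g" "r 1 = 1" for f g
    by (simp_all add: s_def r_def)
  have quot: "e g = e k / (e p - e q)" if "(p - q) * g = k" "e p - e q \<noteq> 0" for p q g k
  proof -
    have "e k = (e p - e q) * e g" by (simp only: that(1)[symmetric] e)
    then show ?thesis using that(2) by simp
  qed
  have I: "e (isobaric i g) = ((1 - e b) * e g - (1 - e a) * e (s g)) / (e a - e b)" for g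
    using quot[OF i0[of g] nz(1)] unfolding e(1-3) .
  have J: "e (isobaric (i + 1) g) = ((1 - e c) * e g - (1 - e b) * e (r g)) / (e b - e c)" for g
    using quot[OF j0[of g] nz(2)] unfolding e(1-3) .
  have ri: "(a - c) * r (isobaric i g) = (1 - c) * r g - (1 - a) * r (s g)" for g
    using arg_cong[OF i0[of g], of r] by (simp only: sr sX)
  have rI: "e (r (isobaric i g)) = ((1 - e c) * e (r g) - (1 - e a) * e (r (s g))) / (e a - e c)" for g
    using quot[OF ri[of g] nz(3)] unfolding e(1-3) .
  have sj: "(a - c) * s (isobaric (i + 1) g) = (1 - c) * s g - (1 - a) * s (r g)" for g
    using arg_cong[OF j0[of g], of s] by (simp only: sr sX)
  have sJ: "e (s (isobaric (i + 1) g)) = ((1 - e c) * e (s g) - (1 - e a) * e (s (r g))) / (e a - e c)" for g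
    using quot[OF sj[of g] nz(3)] unfolding e(1-3) .
  have sri: "(b - c) * s (r (isobaric i g)) = (1 - c) * s (r g) - (1 - b) * s (r (s g))" for g
    using arg_cong[OF i0[of g], of "\<lambda>x. s (r x)"] by (simp only: sr sX)
  have srI: "e (s (r (isobaric i g))) = ((1 - e c) * e (s (r g)) - (1 - e b) * e (s (r (s g)))) / (e b - e c)" for g
    using quot[OF sri[of g] nz(2)] unfolding e(1-3) .
  have rsj: "(a - b) * r (s (isobaric (i + 1) g)) = (1 - b) * r (s g) - (1 - a) * r (s (r g))" for g
    using arg_cong[OF j0[of g], of "\<lambda>x. r (s x)"] by (simp only: sr sX)
  have rsJ: "e (r (s (isobaric (i + 1) g))) = ((1 - e b) * e (r (s g)) - (1 - e a) * e (r (s (r g)))) / (e a - e b)" for g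
    using quot[OF rsj[of g] nz(1)] unfolding e(1-3) .
  have sI: "s (isobaric i g) = isobaric i g" and rJ: "r (isobaric (i + 1) g) = isobaric (i + 1) g" for g
    by (simp_all add: s_def r_def)
  have L: "e (isobaric i (isobaric (i + 1) (isobaric i f)))
    = ((1-e b)*(((1-e c)*e (isobaric i f)-(1-e b)*e (r (isobaric i f)))/(e b-e c))
      -(1-e a)*(((1-e c)*e (isobaric i f)-(1-e a)*e (s (r (isobaric i f))))/(e a-e c)))/(e a-e b)"
    by (simp only: I[of "isobaric (i + 1) (isobaric i f)"] J[of "isobaric i f"] sJ[of "isobaric i f"] sI)
  have R: "e (isobaric (i + 1) (isobaric i (isobaric (i + 1) f)))
    = ((1-e c)*(((1-e b)*e (isobaric (i + 1) f)-(1-e a)*e (s (isobaric (i + 1) f)))/(e a-e b))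
      -(1-e b)*(((1-e c)*e (isobaric (i + 1) f)-(1-e a)*e (r (s (isobaric (i + 1) f))))/(e a-e c)))/(e b-e c)"
    by (simp only: J[of "isobaric i (isobaric (i + 1) f)"] I[of "isobaric (i + 1) f"] rI[of "isobaric (i + 1) f"] rJ)
  have "e (isobaric i (isobaric (i + 1) (isobaric i f)))
      = e (isobaric (i + 1) (isobaric i (isobaric (i + 1) f)))"
    unfolding L R I[of f] J[of f] rI[of f] sJ[of f] srI[of f] rsJ[of f] srs
    by (rule braid_identity[OF nz])
  then show ?thesis by (simp add: e j_def)
qed

section \<open>Truncation and dependence on variables\<close>

definition trunc :: "nat \<Rightarrow> int_mpoly \<Rightarrow> int_mpoly" where
  "trunc t = ev (\<lambda>i. if i \<le> t then X i else 0)"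

lemma trunc_simps [simp]:
  "trunc t (f + g) = trunc t f + trunc t g" "trunc t (f - g) = trunc t f - trunc t g"
  "trunc t (f * g) = trunc t f * trunc t g" "trunc t (of_int c) = of_int c" "trunc t 0 = 0" "trunc t 1 = 1"
  "trunc t (- f) = - trunc t f" "trunc t (X i) = (if i \<le> t then X i else 0)"
  by (simp_all add: trunc_def)

lemma trunc_sum: "trunc t (sum f A) = (\<Sum>a\<in>A. trunc t (f a))"
  by (simp add: trunc_def ev_sum)

lemma finitely_many_vars:
  "\<exists>N. \<forall>\<phi> \<psi> :: nat \<Rightarrow> int_mpoly. (\<forall>i\<le>N. \<phi> i = \<psi> i) \<longrightarrow> ev \<phi> f = ev \<psi> f"
proof (induct f rule: mpoly_induct)
  case (X i)
  then show ?case by auto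
next
  case (add f g)
  then obtain N M where
    "\<forall>\<phi> \<psi> :: nat \<Rightarrow> int_mpoly. (\<forall>i\<le>N. \<phi> i = \<psi> i) \<longrightarrow> ev \<phi> f = ev \<psi> f"
    "\<forall>\<phi> \<psi> :: nat \<Rightarrow> int_mpoly. (\<forall>i\<le>M. \<phi> i = \<psi> i) \<longrightarrow> ev \<phi> g = ev \<psi> g" by blast
  note NM = this
  show ?case
  proof (intro exI[of _ "max N M"] allI impI)
    fix \<phi> \<psi> :: "nat \<Rightarrow> int_mpoly" assume "\<forall>i\<le>max N M. \<phi> i = \<psi> i"
    then have "ev \<phi> f = ev \<psi> f" "ev \<phi> g = ev \<psi> g" using NM by auto
    then show "ev \<phi> (f + g) = ev \<psi> (f + g)" by simp
  qed
next
  case (mult f g)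
  then obtain N M where
    "\<forall>\<phi> \<psi> :: nat \<Rightarrow> int_mpoly. (\<forall>i\<le>N. \<phi> i = \<psi> i) \<longrightarrow> ev \<phi> f = ev \<psi> f"
    "\<forall>\<phi> \<psi> :: nat \<Rightarrow> int_mpoly. (\<forall>i\<le>M. \<phi> i = \<psi> i) \<longrightarrow> ev \<phi> g = ev \<psi> g" by blast
  note NM = this
  show ?case
  proof (intro exI[of _ "max N M"] allI impI)
    fix \<phi> \<psi> :: "nat \<Rightarrow> int_mpoly" assume "\<forall>i\<le>max N M. \<phi> i = \<psi> i"
    then have "ev \<phi> f = ev \<psi> f" "ev \<phi> g = ev \<psi> g" using NM by auto
    then show "ev \<phi> (f * g) = ev \<psi> (f * g)" by simp
  qed
qed simp

text \<open>Dependence is removed one coordinate at a time, from the top. If only coordinates up to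
  n > l matter, the value of \<open>\<psi>\<close> at n may be written into the unseen coordinate n
  + 1 of \<open>\<phi>\<close> and exchanged into place n. The set V restricts the values to points
  at which the exchange is known to be harmless.\<close>

lemma invariant_depends_on_initial:
  fixes Z :: "(nat \<Rightarrow> 'a) \<Rightarrow> 'b"
  assumes init: "\<And>\<phi> \<psi>. \<phi> \<in> UNIV \<rightarrow> V \<Longrightarrow> \<psi> \<in> UNIV \<rightarrow> V \<Longrightarrow> (\<forall>i\<le>N. \<phi> i = \<psi> i) \<Longrightarrow> Z \<phi> = Z \<psi>"
    and swap: "\<And>\<phi> i. \<phi> \<in> UNIV \<rightarrow> V \<Longrightarrow> l < i \<Longrightarrow> Z (\<phi> \<circ> transpose i (i + 1)) = Z \<phi>"
  assumes "\<phi> \<in> UNIV \<rightarrow> V" "\<psi> \<in> UNIV \<rightarrow> V" "\<forall>i\<le>l. \<phi> i = \<psi> i"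
  shows "Z \<phi> = Z \<psi>"
proof -
  define Q where "Q n \<longleftrightarrow> (\<forall>\<phi> \<psi>. \<phi> \<in> UNIV \<rightarrow> V \<longrightarrow> \<psi> \<in> UNIV \<rightarrow> V \<longrightarrow> (\<forall>i\<le>n. \<phi> i = \<psi> i) \<longrightarrow> Z \<phi> = Z \<psi>)" for n
  have step: "Q (l + d)" if "Q (l + Suc d)" for d
  proof -
    let ?n = "l + Suc d"
    have IH: "Z \<phi> = Z \<psi>" if "\<phi> \<in> UNIV \<rightarrow> V" "\<psi> \<in> UNIV \<rightarrow> V" "\<forall>i\<le>?n. \<phi> i = \<psi> i" for \<phi> \<psi>
      using \<open>Q ?n\<close> that unfolding Q_def by blast
    have "Z \<phi> = Z \<psi>" if a: "\<phi> \<in> UNIV \<rightarrow> V" "\<psi> \<in> UNIV \<rightarrow> V" "\<forall>i\<le>l+d. \<phi> i = \<psi> i" for \<phi> \<psi>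
    proof -
      let ?\<phi> = "\<phi>(?n + 1 := \<psi> ?n)"
      have V: "?\<phi> \<in> UNIV \<rightarrow> V" "?\<phi> \<circ> transpose ?n (?n + 1) \<in> UNIV \<rightarrow> V"
        using a(1,2) by (auto simp: Pi_iff)
      have "Z \<phi> = Z ?\<phi>" using a V by (intro IH) auto
      also have "\<dots> = Z (?\<phi> \<circ> transpose ?n (?n + 1))" using swap[OF V(1), of ?n] by simp
      also have "\<dots> = Z \<psi>" using a V by (intro IH) (auto simp: transpose_def le_Suc_eq)
      finally show ?thesis .
    qed
    then show ?thesis unfolding Q_def by blast
  qed
  have "Q (l + N)"
    unfolding Q_def by (intro allI impI init) (auto intro: trans_le_add2)
  moreover have "Q (l + d) \<Longrightarrow> Q l" for d
    by (induct d) (use step in auto)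
  ultimately have "Q l" by blast
  then show ?thesis using assms(3-) unfolding Q_def by blast
qed

text \<open>Being fixed by \<open>isobaric i\<close> means symmetry in x_i and x_(i+1). A polynomial
  symmetric in all variables beyond l, of which only finitely many can occur, involves none of
  them.\<close>

lemma trunc_eq_self:
  assumes "\<And>i. l < i \<Longrightarrow> isobaric i f = f"
  shows "trunc l f = f"
proof -
  obtain N where N: "\<And>\<phi> \<psi> :: nat \<Rightarrow> int_mpoly. (\<forall>i\<le>N. \<phi> i = \<psi> i) \<Longrightarrow> ev \<phi> f = ev \<psi> f"
    using finitely_many_vars by blast
  have "ev (\<lambda>i. if i \<le> l then X i else 0) f = ev X f"
  proof (rule invariant_depends_on_initial[where Z = "\<lambda>\<phi>. ev \<phi> f" and V = UNIV and l = l])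
    fix \<phi> :: "nat \<Rightarrow> int_mpoly" and i :: nat assume "l < i"
    then show "ev (\<phi> \<circ> transpose i (i + 1)) f = ev \<phi> f"
      using assms[of i] ev_swap[of \<phi> i f] by (simp add: isobaric_eq_self_iff)
  qed (auto intro: N)
  then show ?thesis by (simp add: trunc_def ev_id)
qed

text \<open>Under each adjacent transposition such an \<open>F\<close> is either invariant or multiplied by
  \<open>(1 - x\<^sub>i\<^sub>+\<^sub>1)/(1 - x\<^sub>i)\<close>. So whether \<open>F\<close> vanishes at a point without coordinate \<open>1\<close> does not change when
  the coordinates are permuted; as \<open>F\<close> involves only finitely many variables, it does not
  depend on the point.\<close>

lemma isobaric_eigen_eq_0:
  assumes eig: "\<And>i. 1 \<le> i \<Longrightarrow> isobaric i F = 0 \<or> isobaric i F = F" and "trunc 0 F = 0"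
  shows "F = 0"
proof -
  obtain N where N: "\<And>\<phi> \<psi> :: nat \<Rightarrow> int_mpoly. (\<forall>i\<le>N. \<phi> i = \<psi> i) \<Longrightarrow> ev \<phi> F = ev \<psi> F"
    using finitely_many_vars by blast
  \<comment> \<open>The points compared are the generic one, where vanishing means F = 0, and the
    one with x_i = 0 for all i \<ge> 1, where it is the assumption on \<open>trunc 0 F\<close>.
    Neither has a coordinate 1.\<close>
  have "(ev X F = 0) = (ev (\<lambda>i. if i \<le> 0 then X i else 0) F = 0)"
  proof (rule invariant_depends_on_initial[where Z = "\<lambda>\<phi>. ev \<phi> F = 0" and V = "- {1}" and l = 0])
    fix \<phi> :: "nat \<Rightarrow> int_mpoly" and i :: nat assume \<phi>: "\<phi> \<in> UNIV \<rightarrow> - {1}" and i: "0 < i"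
    have nz: "1 - \<phi> j \<noteq> 0" for j using \<phi> by (auto simp: Pi_iff)
    from i have "isobaric i F = F \<or> isobaric i F = 0" using eig[of i] by auto
    then show "(ev (\<phi> \<circ> transpose i (i + 1)) F = 0) = (ev \<phi> F = 0)"
    proof
      assume "isobaric i F = F"
      then show ?thesis using ev_swap[of \<phi> i F] by (simp add: isobaric_eq_self_iff)
    next
      assume "isobaric i F = 0"
      from isobaric_eq_0D[OF this] have "ev \<phi> ((1 - X i) * swap_vars i F) = ev \<phi> ((1 - X (i + 1)) * F)"
        by (rule arg_cong)
      then have "(1 - \<phi> i) * ev (\<phi> \<circ> transpose i (i + 1)) F = (1 - \<phi> (i + 1)) * ev \<phi> F"
        by (simp only: ev_mult ev_diff ev_1 ev_X ev_swap)
      then show ?thesis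
        using nz[of i] nz[of "i + 1"] mult_eq_0_iff[of "1 - \<phi> i" "ev (\<phi> \<circ> transpose i (i + 1)) F"]
          mult_eq_0_iff[of "1 - \<phi> (i + 1)" "ev \<phi> F"] by argo
    qed
  qed (auto dest: N)
  then show ?thesis using assms(2) by (simp add: trunc_def ev_id)
qed

section \<open>Powers of the ideal generated by x_1, x_2, ..\<close>

inductive ord_ge :: "nat \<Rightarrow> int_mpoly \<Rightarrow> bool" where
  any: "ord_ge 0 f"
| zero: "ord_ge d 0"
| X: "ord_ge d f \<Longrightarrow> 1 \<le> j \<Longrightarrow> ord_ge (Suc d) (X j * f)"
| add: "ord_ge d f \<Longrightarrow> ord_ge d g \<Longrightarrow> ord_ge d (f + g)"

lemma ord_ge_mult: "ord_ge d f \<Longrightarrow> ord_ge d (g * f)"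
proof (induct rule: ord_ge.induct)
  case (X d f j)
  then show ?case using ord_ge.X[of d "g * f" j] by (simp add: mult.left_commute)
next
  case (add d f h)
  then show ?case unfolding distrib_left by (intro ord_ge.add)
qed (auto intro: ord_ge.intros)

lemma ord_ge_Suc: "ord_ge (Suc d) f \<Longrightarrow> ord_ge d f"
proof (induct "Suc d" f arbitrary: d rule: ord_ge.induct)
  case (X d f j)
  then show ?case by (intro ord_ge_mult)
qed (auto intro: ord_ge.intros)

lemma ord_ge_diff: "ord_ge d f \<Longrightarrow> ord_ge d g \<Longrightarrow> ord_ge d (f - g)"
  using ord_ge.add[of d f "- g"] ord_ge_mult[of d g "-1"] by simp

text \<open>Induction through the Leibniz rule, one variable at a time. The exchange keeps the index
  of a variable positive because i \<ge> 1; for d = 0 the truncated subtraction makes the claim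
  trivial.\<close>

lemma isobaric_ord_ge: "ord_ge d f \<Longrightarrow> 1 \<le> i \<Longrightarrow> ord_ge (d - 1) (isobaric i f)"
proof (induct rule: ord_ge.induct)
  case (X d f j)
  have "ord_ge d (X (transpose i (i + 1) j) * isobaric i f)"
  proof (cases d)
    case (Suc d')
    then show ?thesis using X ord_ge.X[of d' "isobaric i f" "transpose i (i + 1) j"]
      by (auto simp: transpose_def)
  qed (auto intro: ord_ge.any)
  then have "ord_ge d (isobaric i (X j) * f
      + (X (transpose i (i + 1) j) * isobaric i f - X (transpose i (i + 1) j) * f))"
    by (intro ord_ge.add ord_ge_diff) (auto intro: ord_ge_mult X)
  then show ?case by (simp add: isobaric_mult right_diff_distrib)
qed (auto intro: ord_ge.intros)

text \<open>\<open>trunc 0\<close> keeps the variable with index 0, which is why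
  \<open>ord_ge\<close> counts only factors \<open>X j\<close> with j \<ge> 1.\<close>

lemma trunc_0_ord_ge: "ord_ge d f \<Longrightarrow> 1 \<le> d \<Longrightarrow> trunc 0 f = 0"
  by (induct rule: ord_ge.induct) auto

lemma ord_ge_mult_add: "ord_ge d f \<Longrightarrow> ord_ge e g \<Longrightarrow> ord_ge (d + e) (f * g)"
proof (induct rule: ord_ge.induct)
  case (X d f j)
  then show ?case using ord_ge.X[of "d + e" "f * g" j] by (simp add: mult.assoc)
next
  case (add d f h)
  then show ?case unfolding distrib_right by (intro ord_ge.add) auto
qed (auto intro: ord_ge.intros ord_ge_mult)

lemma ord_ge_X_power: "1 \<le> i \<Longrightarrow> ord_ge n (X i ^ n)"
  by (induct n) (auto intro: ord_ge.intros)

section \<open>Bruhat covers\<close>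

definition cov :: "(nat \<Rightarrow> nat) \<Rightarrow> nat \<Rightarrow> nat \<Rightarrow> bool" where
  "cov w a b \<longleftrightarrow> 1 \<le> a \<and> a < b \<and> w a < w b \<and> (\<forall>c. a < c \<and> c < b \<longrightarrow> \<not> (w a < w c \<and> w c < w b))"

text \<open>The entry at \<open>w b\<close> of the Lehmer code of the inverse of \<open>w\<close>: the number of boxes in column
  \<open>w b\<close> of the diagram.\<close>

definition cc :: "(nat \<Rightarrow> nat) \<Rightarrow> nat \<Rightarrow> nat" where
  "cc w b = card {x. 1 \<le> x \<and> x < b \<and> w b < w x}"

lemma S_infI: "w permutes {1..n} \<Longrightarrow> w \<in> S_inf"
  by (auto simp: S_inf_def)

lemma S_infE:
  assumes "w \<in> S_inf"
  obtains n where "w permutes {1..n}" "m \<le> n"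
proof -
  from assms obtain k where "w permutes {1..k}" by (auto simp: S_inf_def)
  then have "w permutes {1..max k m}" by (rule permutes_subset) auto
  then show ?thesis using that[of "max k m"] by simp
qed

lemma S_inf_inj: "w \<in> S_inf \<Longrightarrow> w x = w y \<longleftrightarrow> x = y"
  by (auto simp: S_inf_def dest: permutes_inj injD)

lemma S_inf_0: "w \<in> S_inf \<Longrightarrow> w 0 = 0"
  by (auto simp: S_inf_def permutes_def)

lemma S_inf_pos: "w \<in> S_inf \<Longrightarrow> 1 \<le> w x \<longleftrightarrow> 1 \<le> x"
  using S_inf_inj[of w x 0] S_inf_0[of w] by (cases "x = 0") auto

lemma id_S_inf [simp]: "id \<in> S_inf"
  by (rule S_infI[of _ 0]) (simp add: permutes_id)

lemma permutes_swap:
  fixes w :: "nat \<Rightarrow> nat"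
  shows "w permutes {1..n} \<Longrightarrow> 1 \<le> a \<Longrightarrow> a \<le> n \<Longrightarrow> 1 \<le> b \<Longrightarrow> b \<le> n \<Longrightarrow> w \<circ> transpose a b permutes {1..n}"
  by (intro permutes_compose[OF permutes_swap_id]) auto

lemma S_inf_swap:
  assumes "w \<in> S_inf" "1 \<le> a" "1 \<le> b"
  shows "w \<circ> transpose a b \<in> S_inf"
proof -
  obtain n where "w permutes {1..n}" "max a b \<le> n" using S_infE[OF assms(1)] .
  then show ?thesis using assms by (intro S_infI[of _ n] permutes_swap) auto
qed

lemma permutes_less_outside:
  fixes w :: "nat \<Rightarrow> nat"
  assumes "w permutes {1..n}" "n < j" "i < j"
  shows "w i < w j"
proof -
  have "w j = j" using assms by (intro permutes_not_in[OF assms(1)]) auto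
  moreover have "w i < j"
  proof (cases "i \<in> {1..n}")
    case True
    then show ?thesis using assms permutes_in_image[OF assms(1), of i] by auto
  next
    case False
    then show ?thesis using assms(3) permutes_not_in[OF assms(1)] by simp
  qed
  ultimately show ?thesis by simp
qed

lemma len_eq_sum_cc:
  assumes "w permutes {1..n}"
  shows "len w = (\<Sum>b\<in>{1..n}. cc w b)"
proof -
  have "{(i, j). 1 \<le> i \<and> i < j \<and> w j < w i}
    = prod.swap ` (SIGMA b:{1..n}. {x. 1 \<le> x \<and> x < b \<and> w b < w x})"
  proof (intro equalityI subsetI)
    fix p assume "p \<in> {(i, j). 1 \<le> i \<and> i < j \<and> w j < w i}"
    then obtain i j where p: "p = (i, j)" "1 \<le> i" "i < j" "w j < w i" by blast
    then have "j \<le> n" using permutes_less_outside[OF assms, of j i] by linarith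
    then show "p \<in> prod.swap ` (SIGMA b:{1..n}. {x. 1 \<le> x \<and> x < b \<and> w b < w x})"
      using p by (intro image_eqI[of _ _ "(j, i)"]) auto
  qed auto
  then have "len w = card (SIGMA b:{1..n}. {x. 1 \<le> x \<and> x < b \<and> w b < w x})"
    by (simp add: len_def card_image)
  also have "\<dots> = (\<Sum>b\<in>{1..n}. cc w b)"
    by (subst card_SigmaI) (auto simp: cc_def intro: finite_subset[of _ "{1..n}"])
  finally show ?thesis .
qed

lemma len_le: assumes "w permutes {1..n}" shows "len w \<le> n * n"
proof -
  have "cc w b \<le> n" if "b \<in> {1..n}" for b
  proof -
    have "cc w b \<le> card {1..n}" unfolding cc_def using that by (intro card_mono) auto
    then show ?thesis by simp
  qed
  then have "(\<Sum>b\<in>{1..n}. cc w b) \<le> (\<Sum>b\<in>{1..n}. n)" by (rule sum_mono)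
  then show ?thesis using len_eq_sum_cc[OF assms] by simp
qed

text \<open>For c beyond b the exchange only permutes the positions before c. For c between a and b,
  the value \<open>w c\<close> is not between \<open>w a\<close> and \<open>w b\<close>, so the
  count does not notice which of the two stands at a.\<close>

lemma cc_cover_other:
  assumes w: "w \<in> S_inf" and cov: "cov w a b" and c: "c \<noteq> a" "c \<noteq> b"
  shows "cc (w \<circ> transpose a b) c = cc w c"
proof -
  let ?t = "transpose a b"
  have ab: "1 \<le> a" "a < b" "w a < w b" using cov by (auto simp: cov_def)
  have "{x. 1 \<le> x \<and> x < c \<and> (w \<circ> ?t) c < (w \<circ> ?t) x}
      = (if b < c then ?t ` {x. 1 \<le> x \<and> x < c \<and> w c < w x} else {x. 1 \<le> x \<and> x < c \<and> w c < w x})"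
  proof (cases "b < c")
    case True
    have "x \<in> ?t ` A \<longleftrightarrow> ?t x \<in> A" for x A
      by (metis (no_types, lifting) image_iff transpose_involutory)
    then show ?thesis using True c ab by (auto simp: transpose_def)
  next
    case False
    have "\<not> (w a < w c \<and> w c < w b)" if "a < c"
      using cov False c that by (auto simp: cov_def)
    then have "a < c \<Longrightarrow> w c < w b \<longleftrightarrow> w c < w a"
      using ab S_inf_inj[OF w, of a c] c by fastforce
    then show ?thesis using False c ab by (auto simp: transpose_def)
  qed
  then show ?thesis by (auto simp: cc_def card_image)
qed

text \<open>At positions between a and b no value lies between \<open>w a\<close> and
  \<open>w b\<close>, so e counts the values above either of them; the rest of each count comes from
  positions up to a. Added up, the counts make the length grow by one; separately they serve again
  for the column bound.\<close>

lemma cc_cover: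
  assumes w: "w \<in> S_inf" and cov: "cov w a b"
  defines "e \<equiv> card {x. a < x \<and> x < b \<and> w b < w x}"
  shows "cc (w \<circ> transpose a b) b = cc w a + e + 1" "cc w b = cc (w \<circ> transpose a b) a + e"
proof -
  let ?t = "transpose a b"
  have ab: "1 \<le> a" "a < b" "w a < w b" using cov by (auto simp: cov_def)
  have btw: "w a < w x \<longleftrightarrow> w b < w x" if "a < x" "x < b" for x
    using cov that ab S_inf_inj[OF w, of b x] by (auto simp: cov_def)
  have fin: "finite {x. a < x \<and> x < b \<and> w b < w x}"
    by (rule finite_subset[of _ "{..b}"]) auto
  have fin1: "finite {x. 1 \<le> x \<and> x < a \<and> w c < w x}" for c
    by (rule finite_subset[of _ "{..a}"]) auto
  have fin2: "finite ({a} \<union> {x. a < x \<and> x < b \<and> w b < w x})"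
    by (intro finite_UnI fin) simp
  have A: "{x. 1 \<le> x \<and> x < b \<and> (w \<circ> ?t) b < (w \<circ> ?t) x}
    = {x. 1 \<le> x \<and> x < a \<and> w a < w x} \<union> ({a} \<union> {x. a < x \<and> x < b \<and> w b < w x})"
    (is "?A = ?B")
  proof (rule set_eqI)
    fix x show "x \<in> ?A \<longleftrightarrow> x \<in> ?B"
      using ab btw[of x] less_linear[of x a] by (auto simp: transpose_def)
  qed
  have "card ({a} \<union> {x. a < x \<and> x < b \<and> w b < w x}) = e + 1"
    unfolding e_def by (subst card_Un_disjoint[OF _ fin]) auto
  then show "cc (w \<circ> ?t) b = cc w a + e + 1"
    unfolding cc_def A by (subst card_Un_disjoint[OF fin1 fin2]) auto
  have B: "{x. 1 \<le> x \<and> x < b \<and> w b < w x}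
    = {x. 1 \<le> x \<and> x < a \<and> w b < w x} \<union> {x. a < x \<and> x < b \<and> w b < w x}"
    (is "?A = ?B")
  proof (rule set_eqI)
    fix x show "x \<in> ?A \<longleftrightarrow> x \<in> ?B"
      using ab less_linear[of x a] by auto
  qed
  have C: "{x. 1 \<le> x \<and> x < a \<and> (w \<circ> ?t) a < (w \<circ> ?t) x} = {x. 1 \<le> x \<and> x < a \<and> w b < w x}"
    using ab by (auto simp: transpose_def)
  show "cc w b = cc (w \<circ> ?t) a + e"
    unfolding cc_def B C e_def by (rule card_Un_disjoint[OF fin1 fin]) auto
qed

lemma len_cover:
  assumes w: "w \<in> S_inf" and cov: "cov w a b"
  shows "len (w \<circ> transpose a b) = len w + 1"
proof -
  have ab: "1 \<le> a" "a < b" using cov by (auto simp: cov_def)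
  obtain n where n: "w permutes {1..n}" "b \<le> n" using S_infE[OF w] .
  have w': "w \<circ> transpose a b permutes {1..n}" using n ab by (intro permutes_swap) auto
  have "(\<Sum>c\<in>{1..n} - {a,b}. cc (w \<circ> transpose a b) c) = (\<Sum>c\<in>{1..n} - {a,b}. cc w c)"
    by (rule sum.cong) (auto simp: cc_cover_other[OF w cov])
  moreover have "sum f {1..n} = f a + f b + sum f ({1..n} - {a,b})" for f :: "nat \<Rightarrow> nat"
  proof -
    have "sum f {1..n} = sum f {a,b} + sum f ({1..n} - {a,b})"
      by (subst sum.subset_diff[of "{a,b}" "{1..n}"]) (use ab n in auto)
    then show ?thesis using ab by simp
  qed
  ultimately show ?thesis
    unfolding len_eq_sum_cc[OF n(1)] len_eq_sum_cc[OF w'] using cc_cover[OF w cov] by simp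
qed

definition sw :: "(nat \<Rightarrow> nat) \<Rightarrow> nat \<Rightarrow> nat \<Rightarrow> nat" where
  "sw w i = w \<circ> transpose i (i + 1)"

lemma sw_apply: "sw w i j = (if j = i then w (i + 1) else if j = i + 1 then w i else w j)"
  by (simp add: sw_def transpose_def)

lemma sw_sw [simp]: "sw (sw w i) i = w"
  by (simp add: sw_def comp_assoc)

lemma sw_permutes: "w permutes {1..n} \<Longrightarrow> 1 \<le> i \<Longrightarrow> i < n \<Longrightarrow> sw w i permutes {1..n}"
  unfolding sw_def by (intro permutes_swap) auto

lemma sw_S_inf: "w \<in> S_inf \<Longrightarrow> 1 \<le> i \<Longrightarrow> sw w i \<in> S_inf"
  unfolding sw_def by (intro S_inf_swap) auto

lemma len_sw:
  assumes "w \<in> S_inf" "1 \<le> i"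
  shows "w i < w (i + 1) \<Longrightarrow> len (sw w i) = len w + 1"
    "w (i + 1) < w i \<Longrightarrow> len w = len (sw w i) + 1"
proof -
  show up: "w i < w (i + 1) \<Longrightarrow> len (sw w i) = len w + 1"
    unfolding sw_def using assms by (intro len_cover) (auto simp: cov_def)
  have "len (sw (sw w i) i) = len (sw w i) + 1" if "w (i + 1) < w i"
    unfolding sw_def[of "sw w i"]
    using assms that by (intro len_cover sw_S_inf) (auto simp: cov_def sw_apply)
  then show "w (i + 1) < w i \<Longrightarrow> len w = len (sw w i) + 1" by simp
qed

lemma asc_or_desc: "w \<in> S_inf \<Longrightarrow> w i < w (i + 1) \<or> w (i + 1) < w i"
  using S_inf_inj[of w i "i + 1"] by (auto simp: neq_iff)

lemma len_sw_less_iff: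
  "w \<in> S_inf \<Longrightarrow> 1 \<le> i \<Longrightarrow> len (sw w i) < len w \<longleftrightarrow> w (i + 1) < w i"
  using len_sw[of w i] asc_or_desc[of w i] by auto

section \<open>Descents\<close>

definition inc_after :: "nat \<Rightarrow> (nat \<Rightarrow> nat) \<Rightarrow> bool" where
  "inc_after l w \<longleftrightarrow> (\<forall>i>l. w i < w (i + 1))"

lemma inc_after_less: "inc_after l w \<Longrightarrow> l < i \<Longrightarrow> i < j \<Longrightarrow> w i < w j"
proof (induct j)
  case (Suc j)
  then have "w j < w (Suc j)" if "l < j" using that by (auto simp: inc_after_def)
  then show ?case using Suc by (cases "i = j") (auto simp: less_Suc_eq)
qed simp

text \<open>An increasing \<open>w\<close> satisfies \<open>i \<le> w i\<close>, and a single strict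
  inequality would persist at all later positions, against finite support.\<close>

lemma inc_after_0_id:
  assumes w: "w \<in> S_inf" and inc: "inc_after 0 w"
  shows "w = id"
proof
  fix i
  obtain n where n: "w permutes {1..n}" "0 \<le> n" using S_infE[OF w] .
  have step: "w i < w (i + 1)" for i
    using inc S_inf_0[OF w] S_inf_pos[OF w, of 1] by (cases "i = 0") (auto simp: inc_after_def)
  have ge: "i \<le> w i" for i
    by (induct i) (use step in \<open>auto intro: order.strict_trans1 simp: Suc_le_eq\<close>)
  have "w i = i"
  proof (rule ccontr)
    assume "w i \<noteq> i"
    then have "i < w i" using ge[of i] by simp
    then have "i + k < w (i + k)" for k
    proof (induct k)
      case (Suc k)
      then show ?case using step[of "i + k"] by simp
    qed simp
    from this[of "n + 1"] show False using n by (auto simp: permutes_def)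
  qed
  then show "w i = id i" by simp
qed

lemma descents_finite: assumes "w \<in> S_inf" shows "finite {l. 1 \<le> l \<and> w l > w (l + 1)}"
proof -
  obtain n where n: "w permutes {1..n}" "0 \<le> n" using S_infE[OF assms] .
  have "{l. 1 \<le> l \<and> w l > w (l + 1)} \<subseteq> {..n}"
  proof
    fix l assume "l \<in> {l. 1 \<le> l \<and> w l > w (l + 1)}"
    then show "l \<in> {..n}" using permutes_less_outside[OF n(1), of "l + 1" l] by fastforce
  qed
  then show ?thesis using finite_subset by blast
qed

lemma last_descent_le_iff:
  assumes w: "w \<in> S_inf"
  shows "last_descent w \<le> l \<longleftrightarrow> inc_after l w"
proof (cases "w = id")
  case True
  then show ?thesis by (auto simp: last_descent_def inc_after_def)
next
  case False
  let ?D = "{l. 1 \<le> l \<and> w l > w (l + 1)}"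
  have "?D \<noteq> {}"
  proof
    assume "?D = {}"
    then have "inc_after 0 w" using asc_or_desc[OF w] by (force simp: inc_after_def)
    then show False using inc_after_0_id[OF w] False by blast
  qed
  then have "last_descent w \<le> l \<longleftrightarrow> (\<forall>d\<in>?D. d \<le> l)"
    using False descents_finite[OF w] by (simp add: last_descent_def)
  also have "\<dots> \<longleftrightarrow> inc_after l w"
  proof
    assume "inc_after l w"
    then show "\<forall>d\<in>?D. d \<le> l"
      unfolding inc_after_def by (metis (mono_tags, lifting) mem_Collect_eq not_le_imp_less order_less_asym)
  next
    assume D: "\<forall>d\<in>?D. d \<le> l"
    show "inc_after l w" unfolding inc_after_def
    proof (intro allI impI)
      fix i assume i: "l < i"
      then have "\<not> w (i + 1) < w i" using D[rule_format, of i] by auto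
      then show "w i < w (i + 1)" using asc_or_desc[OF w, of i] by blast
    qed
  qed
  finally show ?thesis .
qed

lemma last_descent_descent:
  assumes w: "w \<in> S_inf" and l: "1 \<le> last_descent w"
  shows "w (last_descent w + 1) < w (last_descent w)"
proof (rule ccontr)
  assume "\<not> ?thesis"
  then have "w (last_descent w) < w (last_descent w + 1)" using asc_or_desc[OF w] by blast
  moreover have "inc_after (last_descent w) w" using last_descent_le_iff[OF w] by blast
  ultimately have "inc_after (last_descent w - 1) w"
    unfolding inc_after_def by (metis Suc_pred' Suc_lessI l less_eq_Suc_le One_nat_def)
  then show False using last_descent_le_iff[OF w] l by (metis One_nat_def diff_less le_less_linear less_le_not_le zero_less_one less_eq_Suc_le)
qed

lemma len_0_iff: assumes w: "w \<in> S_inf" shows "len w = 0 \<longleftrightarrow> w = id"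
proof
  assume "len w = 0"
  then have "inc_after 0 w"
    unfolding inc_after_def using len_sw(2)[OF w] asc_or_desc[OF w] by fastforce
  then show "w = id" by (rule inc_after_0_id[OF w])
next
  assume "w = id"
  then have "{(i, j). 1 \<le> i \<and> i < j \<and> w j < w i} = {}" by auto
  then show "len w = 0" unfolding len_def by (simp only: card.empty)
qed

lemma exists_descent:
  assumes w: "w \<in> S_inf" and "w \<noteq> id"
  obtains i where "1 \<le> i" "w (i + 1) < w i"
  using inc_after_0_id[OF w] assms(2) asc_or_desc[OF w] by (force simp: inc_after_def)

lemma longestI:
  fixes w :: "nat \<Rightarrow> nat"
  assumes w: "w permutes {1..n}" and dec: "\<And>i. 1 \<le> i \<Longrightarrow> i < n \<Longrightarrow> w (i + 1) < w i"
  shows "w = longest n"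
proof
  fix i
  have d: "w j + (j - i) \<le> w i" if "1 \<le> i" "i \<le> j" "j \<le> n" for i j
    using that(2,3)
  proof (induct j rule: dec_induct)
    case (step j)
    then show ?case using dec[of j] that(1) by simp
  qed simp
  show "w i = longest n i"
  proof (cases "1 \<le> i \<and> i \<le> n")
    case True
    have "w 1 \<in> {1..n}" "w n \<in> {1..n}" using True permutes_in_image[OF w] by auto
    then show ?thesis using True d[of 1 i] d[of i n] by (auto simp: longest_def)
  next
    case False
    then show ?thesis using w by (auto simp: longest_def permutes_def)
  qed
qed

lemma longest_permutes: "longest n permutes {1..n}"
proof -
  have "bij_betw (longest n) {1..n} {1..n}"
    by (rule bij_betw_byWitness[where f' = "longest n"]) (auto simp: longest_def)
  then show ?thesis by (rule bij_imp_permutes) (auto simp: longest_def)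
qed

section \<open>Grothendieck polynomials\<close>

definition staircase :: "nat \<Rightarrow> int_mpoly" where
  "staircase N = (\<Prod>i\<in>{1..<N}. X i ^ (N - i))"

text \<open>The second argument is the number of steps left up to the longest element. Taking the
  least ascent makes the recursion deterministic before the independence of this choice is
  known.\<close>

primrec groth_aux :: "nat \<Rightarrow> nat \<Rightarrow> (nat \<Rightarrow> nat) \<Rightarrow> int_mpoly" where
  "groth_aux N 0 w = staircase N"
| "groth_aux N (Suc d) w =
     (let i = (LEAST i. 1 \<le> i \<and> i < N \<and> w i < w (i + 1)) in isobaric i (groth_aux N d (sw w i)))"

lemma ascent_induct [consumes 1, case_names longest ascent]:
  assumes "w permutes {1..N}" and "P (longest N)"
    and "\<And>w i. w permutes {1..N} \<Longrightarrow> 1 \<le> i \<Longrightarrow> i < N \<Longrightarrow> w i < w (i + 1) \<Longrightarrow> P (sw w i) \<Longrightarrow> P w"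
  shows "P w"
  using assms(1)
proof (induct "N * N - len w" arbitrary: w rule: less_induct)
  case less
  show ?case
  proof (cases "\<exists>i. 1 \<le> i \<and> i < N \<and> w i < w (i + 1)")
    case True
    then obtain i where i: "1 \<le> i" "i < N" "w i < w (i + 1)" by blast
    have p: "sw w i permutes {1..N}" using less i by (intro sw_permutes) auto
    have "len (sw w i) = len w + 1" using len_sw(1)[OF S_infI[OF less(2)] i(1,3)] .
    then have "N * N - len (sw w i) < N * N - len w" using len_le[OF p] by simp
    then show ?thesis using less(1) p assms(3) less(2) i by blast
  next
    case False
    then have "w = longest N"
      using asc_or_desc[OF S_infI[OF less(2)]] by (intro longestI[OF less(2)]) blast
    then show ?thesis using assms(2) by simp
  qed
qed

lemma len_le_longest: "w permutes {1..N} \<Longrightarrow> len w \<le> len (longest N)"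
proof (induct rule: ascent_induct)
  case (ascent w i)
  then show ?case using len_sw(1)[OF S_infI[OF ascent(1)], of i] by simp
qed simp

text \<open>Confluence: two ascents i < j lead to a common permutation, after one further step each
  if they are not adjacent and after two if they are, where commutation or the braid relation
  applies. The bound d \<ge> 1 holds because a permutation with an ascent is not of maximal
  length.\<close>

lemma groth_aux_ascent:
  assumes "w permutes {1..N}" "len w + d = len (longest N)" "1 \<le> i" "i < N" "w i < w (i + 1)"
  shows "d \<ge> 1 \<and> groth_aux N d w = isobaric i (groth_aux N (d - 1) (sw w i))"
  using assms
proof (induct d arbitrary: w i rule: less_induct)
  case (less d)
  have d: "1 \<le> d \<and> len (sw w i) + (d - 1) = len (longest N) \<and> sw w i permutes {1..N}"
    if "w permutes {1..N}" "len w + d = len (longest N)" "1 \<le> i" "i < N" "w i < w (i + 1)" for w i d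
  proof -
    have "len (sw w i) = len w + 1" using len_sw(1)[OF S_infI[OF that(1)] that(3,5)] .
    moreover have p: "sw w i permutes {1..N}" using that by (intro sw_permutes) auto
    ultimately show ?thesis using len_le_longest[OF p] that(2) by auto
  qed
  have step: "groth_aux N (d - 1) (sw w i) = isobaric j (groth_aux N (d - 1 - 1) (sw (sw w i) j))"
    if "1 \<le> i" "i < N" "w i < w (i + 1)" "1 \<le> j" "j < N" "sw w i j < sw w i (j + 1)" for i j
  proof -
    have d1: "1 \<le> d" "len (sw w i) + (d - 1) = len (longest N)" "sw w i permutes {1..N}"
      using d[OF less(2,3) that(1-3)] by auto
    then have "d - 1 < d" by simp
    from less(1)[OF this d1(3,2) that(4-6)] show ?thesis by blast
  qed
  have eq: "isobaric i (groth_aux N (d - 1) (sw w i)) = isobaric j (groth_aux N (d - 1) (sw w j))"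
    if i: "1 \<le> i" "i < N" "w i < w (i + 1)" and j: "1 \<le> j" "j < N" "w j < w (j + 1)" and ij: "i < j" for i j
  proof (cases "j = i + 1")
    case False
    have "sw (sw w i) j = sw (sw w j) i"
      using False ij by (auto simp: fun_eq_iff sw_apply)
    then show ?thesis
      using step[of i j] step[of j i] i j ij False isobaric_commute[of i j]
      by (simp add: sw_apply)
  next
    case True
    have j': "sw w i j < sw w i (j + 1)" "sw w j i < sw w j (i + 1)"
      using i j True by (auto simp: sw_apply)
    have d1: "len (sw w i) + (d - 1) = len (longest N)" "sw w i permutes {1..N}"
      "len (sw w j) + (d - 1) = len (longest N)" "sw w j permutes {1..N}" "1 \<le> d"
      using d[OF less(2,3) i] d[OF less(2,3) j] by auto
    have d2: "1 \<le> d - 1" "len (sw (sw w i) j) + (d - 1 - 1) = len (longest N)"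
      "sw (sw w i) j permutes {1..N}"
      "len (sw (sw w j) i) + (d - 1 - 1) = len (longest N)" "sw (sw w j) i permutes {1..N}"
      using d[OF d1(2,1) j(1,2) j'(1)] d[OF d1(4,3) i(1,2) j'(2)] by auto
    have lt: "d - 1 - 1 < d" using d1(5) d2(1) by simp
    have j'': "sw (sw w i) j i < sw (sw w i) j (i + 1)" "sw (sw w j) i j < sw (sw w j) i (j + 1)"
      using i j True by (auto simp: sw_apply)
    have "groth_aux N (d - 1 - 1) (sw (sw w i) j) = isobaric i (groth_aux N (d - 1 - 1 - 1) (sw (sw (sw w i) j) i))"
      using less(1)[OF lt d2(3,2) i(1,2) j''(1)] by blast
    moreover have "groth_aux N (d - 1 - 1) (sw (sw w j) i) = isobaric j (groth_aux N (d - 1 - 1 - 1) (sw (sw (sw w j) i) j))"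
      using less(1)[OF lt d2(5,4) j(1,2) j''(2)] by blast
    moreover have "sw (sw (sw w i) j) i = sw (sw (sw w j) i) j"
      using True by (auto simp: fun_eq_iff sw_apply)
    ultimately show ?thesis
      using step[OF i j(1,2) j'(1)] step[OF j i(1,2) j'(2)] isobaric_braid[of i] True by simp
  qed
  let ?P = "\<lambda>i. 1 \<le> i \<and> i < N \<and> w i < w (i + 1)"
  define k where "k = (LEAST i. ?P i)"
  have k: "?P k" unfolding k_def by (rule LeastI[of ?P i]) (use less in auto)
  have ki: "k \<le> i" unfolding k_def by (rule Least_le) (use less in auto)
  have "1 \<le> d" using d[OF less(2-)] by simp
  then obtain d' where d': "d = Suc d'" by (cases d) auto
  then have "groth_aux N d w = isobaric k (groth_aux N (d - 1) (sw w k))"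
    by (simp add: k_def Let_def)
  also have "\<dots> = isobaric i (groth_aux N (d - 1) (sw w i))"
    using eq[of k i] k ki less by (cases "k = i") auto
  finally show ?case using \<open>1 \<le> d\<close> by blast
qed

definition grothN :: "nat \<Rightarrow> (nat \<Rightarrow> nat) \<Rightarrow> int_mpoly" where
  "grothN N w = groth_aux N (len (longest N) - len w) w"

lemma grothN_longest: "grothN N (longest N) = staircase N"
  by (simp add: grothN_def)

lemma grothN_ascent:
  assumes "w permutes {1..N}" "1 \<le> i" "i < N" "w i < w (i + 1)"
  shows "grothN N w = isobaric i (grothN N (sw w i))"
proof -
  let ?d = "len (longest N) - len w"
  have "groth_aux N ?d w = isobaric i (groth_aux N (?d - 1) (sw w i))"
    using groth_aux_ascent[OF assms(1) _ assms(2-), of ?d] len_le_longest[OF assms(1)] by simp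
  then show ?thesis using len_sw(1)[OF S_infI[OF assms(1)] assms(2,4)] by (simp add: grothN_def)
qed

lemma grothN_descent:
  assumes "w permutes {1..N}" "1 \<le> i" "i < N" "w (i + 1) < w i"
  shows "isobaric i (grothN N w) = grothN N (sw w i)"
  using grothN_ascent[of "sw w i" N i] assms sw_permutes[of w N i] by (simp add: sw_apply)

lemma swap_prod: "swap_vars k (prod f A) = (\<Prod>a\<in>A. swap_vars k (f a))"
  by (simp add: swap_vars_ev ev_prod)

lemma isobaric_X_times:
  assumes "swap_vars k f = f"
  shows "isobaric k (X k * f) = f"
proof -
  have "isobaric k (X k) = 1" by (rule isobaric_eqI) (simp add: algebra_simps)
  then show ?thesis using isobaric_mult_sym[OF assms, of "X k"] by (simp add: mult.commute)
qed

text \<open>\<open>v k\<close> is the word N, ..., N+1-k, N+1, N-k, ..., 1: the largest value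
  wanders from the first place to the last. At each step \<open>isobaric (k + 1)\<close> meets
  x_(k+1) times a polynomial symmetric in x_(k+1) and x_(k+2) and just drops the factor x_(k+1);
  hence the exponents \<open>e k\<close>.\<close>

lemma grothN_Suc_longest: "grothN (N + 1) (longest N) = staircase N"
proof -
  define v where "v k i = (if 1 \<le> i \<and> i \<le> k then N + 1 - i else if i = k + 1 then N + 1
    else if 1 \<le> i \<and> i \<le> N + 1 then N + 2 - i else i)" for k i
  define e where "e k i = (if i \<le> k then N - i else N + 1 - i)" for k i
  have "v k permutes {1..N+1} \<and> grothN (N + 1) (v k) = (\<Prod>i\<in>{1..N+1}. X i ^ e k i)" if "k \<le> N" for k
    using that
  proof (induct k)
    case 0
    have "v 0 = longest (N + 1)" by (auto simp: v_def longest_def fun_eq_iff)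
    moreover have "staircase (N + 1) = (\<Prod>i\<in>{1..N+1}. X i ^ e 0 i)"
      unfolding staircase_def by (rule prod.mono_neutral_cong_left) (auto simp: e_def)
    ultimately show ?case using longest_permutes grothN_longest by metis
  next
    case (Suc k)
    then have k: "v k permutes {1..N+1}" "grothN (N + 1) (v k) = (\<Prod>i\<in>{1..N+1}. X i ^ e k i)" by auto
    have vS: "sw (v k) (Suc k) = v (Suc k)"
      using Suc by (auto simp: fun_eq_iff v_def sw_apply)
    have "isobaric (Suc k) (grothN (N + 1) (v k)) = grothN (N + 1) (v (Suc k))"
      using grothN_descent[OF k(1), of "Suc k"] vS Suc by (auto simp: v_def)
    moreover
    let ?R = "\<lambda>k. \<Prod>i\<in>{1..N+1} - {Suc k, Suc (Suc k)}. X i ^ e (Suc k) i"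
    have split: "(\<Prod>i\<in>{1..N+1}. f i) = f (Suc k) * f (Suc (Suc k)) * prod f ({1..N+1} - {Suc k, Suc (Suc k)})"
      for f :: "nat \<Rightarrow> int_mpoly"
      using Suc prod.subset_diff[of "{Suc k, Suc (Suc k)}" "{1..N+1}" f] by (simp add: mult.commute)
    have sym: "swap_vars (Suc k) (\<Prod>i\<in>{1..N+1}. X i ^ e (Suc k) i) = (\<Prod>i\<in>{1..N+1}. X i ^ e (Suc k) i)"
    proof -
      have "swap_vars (Suc k) (?R k) = ?R k"
        unfolding swap_prod by (rule prod.cong) (auto simp: transpose_def)
      then show ?thesis unfolding split by (simp add: e_def mult_ac)
    qed
    have "(\<Prod>i\<in>{1..N+1}. X i ^ e k i) = X (Suc k) * (\<Prod>i\<in>{1..N+1}. X i ^ e (Suc k) i)"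
    proof -
      have "(\<Prod>i\<in>{1..N+1} - {Suc k, Suc (Suc k)}. X i ^ e k i) = ?R k"
        by (rule prod.cong) (auto simp: e_def)
      moreover have "X (Suc k) ^ e k (Suc k) = X (Suc k) * X (Suc k) ^ e (Suc k) (Suc k)"
      proof -
        have "N - k = Suc (N - Suc k)" using Suc by simp
        then show ?thesis by (simp add: e_def)
      qed
      ultimately show ?thesis unfolding split by (simp add: e_def mult_ac)
    qed
    ultimately have "grothN (N + 1) (v (Suc k)) = (\<Prod>i\<in>{1..N+1}. X i ^ e (Suc k) i)"
      using k(2) isobaric_X_times[OF sym] by metis
    moreover have "v (Suc k) permutes {1..N+1}"
      using sw_permutes[OF k(1), of "Suc k"] vS Suc by simp
    ultimately show ?case by blast
  qed
  from this[of N] have "grothN (N + 1) (v N) = (\<Prod>i\<in>{1..N+1}. X i ^ e N i)" by simp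
  also have "v N = longest N" by (auto simp: v_def longest_def fun_eq_iff)
  also have "(\<Prod>i\<in>{1..N+1}. X i ^ e N i) = staircase N"
    unfolding staircase_def by (rule prod.mono_neutral_cong_right) (auto simp: e_def)
  finally show ?thesis .
qed

lemma grothN_Suc: "w permutes {1..N} \<Longrightarrow> grothN (N + 1) w = grothN N w"
proof (induct rule: ascent_induct)
  case longest
  show ?case by (simp only: grothN_Suc_longest grothN_longest)
next
  case (ascent w i)
  have "w permutes {1..N+1}" using ascent(1) by (rule permutes_subset) auto
  then show ?case using grothN_ascent[of w N i] grothN_ascent[of w "N + 1" i] ascent by simp
qed

definition Gr :: "(nat \<Rightarrow> nat) \<Rightarrow> int_mpoly" where
  "Gr w = grothN (LEAST N. w permutes {1..N}) w"

lemma Gr_eq: assumes "w permutes {1..N}" shows "Gr w = grothN N w"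
proof -
  define M where "M = (LEAST N. w permutes {1..N})"
  have M: "w permutes {1..M}" unfolding M_def by (rule LeastI[of _ N]) (rule assms)
  have "M \<le> N" unfolding M_def by (rule Least_le) (rule assms)
  have "grothN (M + d) w = grothN M w" for d
  proof (induct d)
    case (Suc d)
    have "w permutes {1..M + d}" using M by (rule permutes_subset) auto
    from grothN_Suc[OF this] Suc show ?case by simp
  qed simp
  from this[of "N - M"] \<open>M \<le> N\<close> show ?thesis by (simp add: Gr_def M_def)
qed

lemma Gr_longest: "Gr (longest N) = staircase N"
  by (simp add: Gr_eq[OF longest_permutes] grothN_longest)

lemma Gr_id [simp]: "Gr id = 1"
proof -
  have "longest 0 = id" by (auto simp: longest_def)
  then show ?thesis using Gr_longest[of 0] by (simp add: staircase_def)
qed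

lemma isobaric_Gr_descent:
  assumes "w \<in> S_inf" "1 \<le> i" "w (i + 1) < w i"
  shows "isobaric i (Gr w) = Gr (sw w i)"
proof -
  obtain n where n: "w permutes {1..n}" "i + 2 \<le> n" using S_infE[OF assms(1)] .
  moreover have "sw w i permutes {1..n}" using n assms by (intro sw_permutes) auto
  ultimately show ?thesis using grothN_descent[OF n(1) assms(2) _ assms(3)] by (simp add: Gr_eq)
qed

lemma isobaric_Gr_ascent:
  assumes "w \<in> S_inf" "1 \<le> i" "w i < w (i + 1)"
  shows "isobaric i (Gr w) = Gr w"
proof -
  have "Gr w = isobaric i (Gr (sw w i))"
    using isobaric_Gr_descent[of "sw w i" i] sw_S_inf[of w i] assms by (simp add: sw_apply)
  then show ?thesis using isobaric_idem by metis
qed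

lemma is_groth_Gr: "w permutes {1..N} \<Longrightarrow> is_groth w (Gr w)"
proof (induct rule: ascent_induct)
  case longest
  then show ?case unfolding Gr_longest staircase_def by (rule is_groth.longest)
next
  case (ascent w i)
  have w: "w \<in> S_inf" by (rule S_infI[OF ascent(1)])
  have w': "sw w i \<in> S_inf" using ascent by (intro sw_S_inf[OF w]) auto
  have "len (sw (sw w i) i) < len (sw w i)" using len_sw(1)[OF w ascent(2,4)] by simp
  from is_groth.step[OF ascent(5,2) this[unfolded sw_def[of "sw w i"]], folded sw_def]
  have "is_groth (sw (sw w i) i) (isobaric i (Gr (sw w i)))" .
  then show ?case using isobaric_Gr_descent[OF w' ascent(2)] ascent by (simp add: sw_apply)
qed

text \<open>A derivation may start at any \<open>longest N\<close> and follow any descents;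
  stability settles the start, \<open>isobaric_Gr_descent\<close> each step. Together with
  \<open>is_groth_Gr\<close> this makes the description in \<open>groth\<close> proper.\<close>

lemma is_groth_unique: "is_groth w f \<Longrightarrow> w \<in> S_inf \<and> f = Gr w"
proof (induct rule: is_groth.induct)
  case (longest N)
  then show ?case using Gr_longest[of N] S_infI[OF longest_permutes] by (simp add: staircase_def)
next
  case (step w f i)
  then have "w \<in> S_inf" "f = Gr w" "1 \<le> i" "len (sw w i) < len w" by (simp_all add: sw_def)
  then have "sw w i \<in> S_inf \<and> isobaric i f = Gr (sw w i)"
    using isobaric_Gr_descent[of w i] len_sw_less_iff[of w i] sw_S_inf[of w i] by auto
  then show ?case unfolding sw_def .
qed

lemma groth_eq_Gr: assumes "w \<in> S_inf" shows "groth w = Gr w"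
proof -
  obtain n where "w permutes {1..n}" "0 \<le> n" using S_infE[OF assms] .
  then show ?thesis unfolding groth_def using is_groth_Gr is_groth_unique by blast
qed

lemma ord_ge_antimono: "ord_ge d f \<Longrightarrow> e \<le> d \<Longrightarrow> ord_ge e f"
  by (induct d) (auto simp: le_Suc_eq dest: ord_ge_Suc)

lemma ord_ge_staircase: "ord_ge (len (longest N)) (staircase N)"
proof -
  have "ord_ge (\<Sum>i\<in>A. N - i) (\<Prod>i\<in>A. X i ^ (N - i))" if "finite A" "A \<subseteq> {1..}" for A
    using that by induct (auto intro!: ord_ge.any ord_ge_mult_add ord_ge_X_power)
  from this[of "{1..<N}"] have "ord_ge (\<Sum>i\<in>{1..<N}. N - i) (staircase N)"
    unfolding staircase_def by fastforce
  moreover have "len (longest N) \<le> (\<Sum>i\<in>{1..<N}. N - i)"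
  proof -
    have "cc (longest N) b \<le> b - 1" for b
    proof -
      have "cc (longest N) b \<le> card {1..<b}"
        unfolding cc_def by (intro card_mono) auto
      then show ?thesis by simp
    qed
    then have "len (longest N) \<le> (\<Sum>b\<in>{1..N}. b - 1)"
      unfolding len_eq_sum_cc[OF longest_permutes] by (intro sum_mono)
    also have "\<dots> = (\<Sum>i\<in>{1..N}. N - i)"
      by (rule sum.reindex_bij_witness[of _ "\<lambda>i. N + 1 - i" "\<lambda>i. N + 1 - i"]) auto
    also have "\<dots> = (\<Sum>i\<in>{1..<N}. N - i)"
      by (rule sum.mono_neutral_right) auto
    finally show ?thesis .
  qed
  ultimately show ?thesis by (rule ord_ge_antimono)
qed

text \<open>On the way down from the longest element each step lowers the length by one and the
  order by at most one. Hence the constant term vanishes unless the permutation is the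
  identity.\<close>

lemma ord_ge_Gr: "w permutes {1..N} \<Longrightarrow> ord_ge (len w) (Gr w)"
proof (induct rule: ascent_induct)
  case longest
  then show ?case by (simp add: Gr_longest ord_ge_staircase)
next
  case (ascent w i)
  have w: "w \<in> S_inf" by (rule S_infI[OF ascent(1)])
  have w': "sw w i \<in> S_inf" using ascent by (intro sw_S_inf[OF w]) auto
  have "Gr w = isobaric i (Gr (sw w i))" using isobaric_Gr_descent[OF w' ascent(2)] ascent by (simp add: sw_apply)
  then show ?case using isobaric_ord_ge[OF ascent(5,2)] len_sw(1)[OF w ascent(2,4)] by simp
qed

lemma trunc_0_Gr: assumes "w \<in> S_inf" shows "trunc 0 (Gr w) = (if w = id then 1 else 0)"
proof (cases "w = id")
  case False
  obtain n where "w permutes {1..n}" "0 \<le> n" using S_infE[OF assms] .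
  then have "trunc 0 (Gr w) = 0"
    using trunc_0_ord_ge[OF ord_ge_Gr] len_0_iff[OF assms] False by (simp add: Suc_le_eq)
  then show ?thesis using False by simp
qed simp

lemma trunc_Gr:
  assumes "w \<in> S_inf" "inc_after l w" "l \<le> t"
  shows "trunc t (Gr w) = Gr w"
  using assms by (intro trunc_eq_self isobaric_Gr_ascent) (auto simp: inc_after_def)

section \<open>A Monk formula\<close>

type_synonym pfun = "(nat \<Rightarrow> nat) \<Rightarrow> int_mpoly"

text \<open>These operators act on functions of permutations; an operator written on the outside acts
  first on the permutation. They are made trivial outside \<^const>\<open>S_inf\<close>, so that the
  relations between them hold as equations of functions.\<close>

definition covop :: "nat \<Rightarrow> nat \<Rightarrow> pfun \<Rightarrow> pfun" where
  "covop a b \<Phi> w = (if w \<in> S_inf \<and> cov w a b then \<Phi> (w \<circ> transpose a b) else 0)"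

definition ecov :: "nat \<Rightarrow> nat \<Rightarrow> pfun \<Rightarrow> pfun" where
  "ecov a b \<Phi> w = \<Phi> w - covop a b \<Phi> w"

definition dem :: "nat \<Rightarrow> pfun \<Rightarrow> pfun" where
  "dem i \<Phi> w = (if w \<in> S_inf \<and> w (i + 1) < w i then \<Phi> (sw w i) else \<Phi> w)"

text \<open>The counterpart of \<open>dem\<close> that discards ascents. A value
  \<open>desc i F w\<close> involves \<open>F\<close> only at a permutation shorter than
  \<open>w\<close>, so it is within reach of an induction on the length.\<close>

definition desc :: "nat \<Rightarrow> pfun \<Rightarrow> pfun" where
  "desc i \<Phi> w = (if w \<in> S_inf \<and> w (i + 1) < w i then \<Phi> (sw w i) else 0)"

lemma desc_diff: "desc i (\<lambda>w. \<Phi> w - \<Psi> w) w = desc i \<Phi> w - desc i \<Psi> w"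
  by (simp add: desc_def)

section \<open>Relations between cover operators and descents\<close>

lemma ecov_descI:
  assumes ab: "1 \<le> a" "a < b" "1 \<le> i"
    and perm: "\<And>w. sw (w \<circ> transpose a b) i = sw w i \<circ> transpose a' b'"
    and cov: "\<And>w. w \<in> S_inf \<Longrightarrow> cov w a b \<and> (w \<circ> transpose a b) (i + 1) < (w \<circ> transpose a b) i
      \<longleftrightarrow> w (i + 1) < w i \<and> cov (sw w i) a' b'"
  shows "ecov a b (desc i \<Phi>) = desc i (ecov a' b' \<Phi>)"
proof
  fix w show "ecov a b (desc i \<Phi>) w = desc i (ecov a' b' \<Phi>) w"
  proof (cases "w \<in> S_inf")
    case True
    have "w \<circ> transpose a b \<in> S_inf" "sw w i \<in> S_inf"
      using ab by (auto intro!: S_inf_swap sw_S_inf True)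
    then have "covop a b (desc i \<Phi>) w = desc i (covop a' b' \<Phi>) w"
      using True perm[of w] cov[OF True] by (auto simp: covop_def desc_def simp del: comp_apply)
    then show ?thesis by (simp add: ecov_def[abs_def] desc_diff)
  qed (simp add: ecov_def covop_def desc_def)
qed

lemma cov_first:
  assumes "1 \<le> k" "k + 1 < b"
  shows "cov w k b \<longleftrightarrow> w k < w b \<and> \<not> (w k < w (k + 1) \<and> w (k + 1) < w b) \<and>
    (\<forall>c. k + 1 < c \<and> c < b \<longrightarrow> \<not> (w k < w c \<and> w c < w b))"
proof -
  have split: "k < c \<longleftrightarrow> c = k + 1 \<or> k + 1 < c" for c by auto
  have "(\<forall>c. k < c \<and> c < b \<longrightarrow> P c) \<longleftrightarrow> P (k + 1) \<and> (\<forall>c. k + 1 < c \<and> c < b \<longrightarrow> P c)" for P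
    by (simp only: split) (use assms in auto)
  then show ?thesis using assms unfolding cov_def by auto
qed

lemma cov_last:
  assumes "1 \<le> a" "a < k"
  shows "cov w a (k + 1) \<longleftrightarrow> w a < w (k + 1) \<and> \<not> (w a < w k \<and> w k < w (k + 1)) \<and>
    (\<forall>c. a < c \<and> c < k \<longrightarrow> \<not> (w a < w c \<and> w c < w (k + 1)))"
proof -
  have split: "c < k + 1 \<longleftrightarrow> c = k \<or> c < k" for c by auto
  have "(\<forall>c. a < c \<and> c < k + 1 \<longrightarrow> P c) \<longleftrightarrow> P k \<and> (\<forall>c. a < c \<and> c < k \<longrightarrow> P c)" for P
    by (simp only: split) (use assms in auto)
  then show ?thesis using assms unfolding cov_def by auto
qed

text \<open>Conjugation by the exchange at k turns the transposition of a and k into that of a and k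
  + 1. The two cover conditions differ in one additional position in between, and the descent
  conditions make up for it. The three variants below place k differently.\<close>

lemma ecov_desc_1:
  assumes "1 \<le> a" "a < k"
  shows "ecov a k (desc k \<Phi>) = desc k (ecov a (k + 1) \<Phi>)"
proof (rule ecov_descI)
  show "sw (w \<circ> transpose a k) k = sw w k \<circ> transpose a (k + 1)" for w
    using assms by (auto simp: fun_eq_iff sw_apply transpose_def)
  show "cov w a k \<and> (w \<circ> transpose a k) (k + 1) < (w \<circ> transpose a k) k
    \<longleftrightarrow> w (k + 1) < w k \<and> cov (sw w k) a (k + 1)" if "w \<in> S_inf" for w
    using assms S_inf_inj[OF that, of a "k + 1"]
    unfolding cov_last[OF assms] unfolding cov_def by (auto simp: sw_apply)
qed (use assms in auto)

lemma ecov_desc_2: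
  assumes "1 \<le> k" "k + 1 < b"
  shows "ecov k b (desc k \<Phi>) = desc k (ecov (k + 1) b \<Phi>)"
proof (rule ecov_descI)
  show "sw (w \<circ> transpose k b) k = sw w k \<circ> transpose (k + 1) b" for w
    using assms by (auto simp: fun_eq_iff sw_apply transpose_def)
  show "cov w k b \<and> (w \<circ> transpose k b) (k + 1) < (w \<circ> transpose k b) k
    \<longleftrightarrow> w (k + 1) < w k \<and> cov (sw w k) (k + 1) b" if "w \<in> S_inf" for w
    using assms S_inf_inj[OF that, of k "k + 1"]
    unfolding cov_first[OF assms] unfolding cov_def by (auto simp: sw_apply)
qed (use assms in auto)

lemma ecov_desc_3:
  assumes "1 \<le> a" "a < k"
  shows "ecov a (k + 1) (desc k \<Phi>) = desc k (ecov a k \<Phi>)"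
proof (rule ecov_descI)
  show "sw (w \<circ> transpose a (k + 1)) k = sw w k \<circ> transpose a k" for w
    using assms by (auto simp: fun_eq_iff sw_apply transpose_def)
  show "cov w a (k + 1) \<and> (w \<circ> transpose a (k + 1)) (k + 1) < (w \<circ> transpose a (k + 1)) k
    \<longleftrightarrow> w (k + 1) < w k \<and> cov (sw w k) a k" if "w \<in> S_inf" for w
    using assms S_inf_inj[OF that, of k "k + 1"]
    unfolding cov_last[OF assms] unfolding cov_def by (auto simp: sw_apply)
qed (use assms in auto)

lemma ecov_desc_4:
  assumes "1 \<le> k" "k + 1 < b"
  shows "ecov (k + 1) b (desc k \<Phi>) = desc k (ecov k b \<Phi>)"
proof (rule ecov_descI)
  show "sw (w \<circ> transpose (k + 1) b) k = sw w k \<circ> transpose k b" for w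
    using assms by (auto simp: fun_eq_iff sw_apply transpose_def)
  show "cov w (k + 1) b \<and> (w \<circ> transpose (k + 1) b) (k + 1) < (w \<circ> transpose (k + 1) b) k
    \<longleftrightarrow> w (k + 1) < w k \<and> cov (sw w k) k b" if "w \<in> S_inf" for w
    using assms S_inf_inj[OF that, of k b]
    unfolding cov_first[OF assms] unfolding cov_def by (auto simp: sw_apply)
qed (use assms in auto)

lemma cov_Suc: "1 \<le> k \<Longrightarrow> cov w k (k + 1) \<longleftrightarrow> w k < w (k + 1)"
  by (auto simp: cov_def)

text \<open>At an ascent the cover takes \<open>w\<close> to \<open>sw w k\<close> and
  \<open>dem k\<close> brings it back, so the two terms cancel; at a descent there is no cover.
  Outside \<open>S_inf\<close> the left side is \<open>\<Phi> w\<close>, hence the assumption that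
  it vanishes there.\<close>

lemma ecov_dem:
  assumes "1 \<le> k" "\<And>w. w \<notin> S_inf \<Longrightarrow> \<Phi> w = 0"
  shows "ecov k (k + 1) (dem k \<Phi>) = desc k \<Phi>"
proof
  fix w
  show "ecov k (k + 1) (dem k \<Phi>) w = desc k \<Phi> w"
    using asc_or_desc[of w k] sw_S_inf[of w k] assms
    by (auto simp: ecov_def covop_def cov_Suc dem_def desc_def sw_apply simp flip: sw_def
      simp del: Suc_eq_plus1_left One_nat_def add_Suc_right)
qed

lemma dem_minus_id:
  assumes "1 \<le> k"
  shows "(\<lambda>w. dem k \<Phi> w - \<Phi> w) = desc k (ecov k (k + 1) \<Phi>)"
proof
  fix w
  show "dem k \<Phi> w - \<Phi> w = desc k (ecov k (k + 1) \<Phi>) w"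
    using asc_or_desc[of w k] sw_S_inf[of w k] assms
    by (auto simp: ecov_def covop_def cov_Suc dem_def desc_def sw_apply simp flip: sw_def
      simp del: Suc_eq_plus1_left One_nat_def add_Suc_right)
qed

lemma ecov_dem_commute:
  assumes "1 \<le> i" "1 \<le> a" "a < b" "{i, i + 1} \<inter> {a, b} = {}"
  shows "ecov a b (dem i \<Phi>) = dem i (ecov a b \<Phi>)"
proof
  fix w
  show "ecov a b (dem i \<Phi>) w = dem i (ecov a b \<Phi>) w"
  proof (cases "w \<in> S_inf")
    case True
    have in_S: "w \<circ> transpose a b \<in> S_inf" "sw w i \<in> S_inf"
      using assms by (auto intro!: S_inf_swap sw_S_inf True)
    have perm: "sw (w \<circ> transpose a b) i = sw w i \<circ> transpose a b"
      using assms by (auto simp: fun_eq_iff sw_apply transpose_def)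
    have d: "(w \<circ> transpose a b) (i + 1) < (w \<circ> transpose a b) i \<longleftrightarrow> w (i + 1) < w i"
      using assms by (auto simp: transpose_def)
    have ab: "a \<noteq> i" "a \<noteq> i + 1" "b \<noteq> i" "b \<noteq> i + 1" using assms by auto
    have "(a < i \<and> i < b) \<longleftrightarrow> (a < i + 1 \<and> i + 1 < b)" using ab by auto
    then have P: "a < transpose i (i + 1) c \<and> transpose i (i + 1) c < b \<longleftrightarrow> a < c \<and> c < b" for c
      by (auto simp: transpose_def)
    have "(\<forall>c. a < c \<and> c < b \<longrightarrow> Q (sw w i c)) \<longleftrightarrow> (\<forall>c. a < c \<and> c < b \<longrightarrow> Q (w c))" for Q
    proof (intro iffI allI impI)
      fix c assume "\<forall>c. a < c \<and> c < b \<longrightarrow> Q (sw w i c)" "a < c \<and> c < b"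
      then have "Q (sw w i (transpose i (i + 1) c))" using P by blast
      then show "Q (w c)" by (simp add: sw_def)
    next
      fix c assume "\<forall>c. a < c \<and> c < b \<longrightarrow> Q (w c)" "a < c \<and> c < b"
      then have "Q (w (transpose i (i + 1) c))" using P by blast
      then show "Q (sw w i c)" by (simp add: sw_def)
    qed
    from this[of "\<lambda>x. \<not> (w a < x \<and> x < w b)"]
    have c: "cov (sw w i) a b \<longleftrightarrow> cov w a b"
      unfolding cov_def using ab by (simp add: sw_apply[of _ _ a] sw_apply[of _ _ b])
    show ?thesis
      using True in_S perm d c by (auto simp: ecov_def covop_def dem_def simp del: comp_apply)
  qed (simp add: ecov_def covop_def dem_def)
qed

text \<open>\<open>ecov_dem_commute\<close> says nothing about the factors with index i or i + 1;
  here their product is treated as a whole. All that enters is the order of the values p, q, r at i,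
  i + 1, k and which intervals between them are free of values at positions between i + 1 and k, so
  six cases remain.\<close>

lemma ecov_pair_dem_commute_left:
  assumes i: "1 \<le> i" and k: "i + 1 < k"
  shows "ecov i k (ecov (i + 1) k (dem i \<Phi>)) = dem i (ecov i k (ecov (i + 1) k \<Phi>))"
proof
  fix w
  show "ecov i k (ecov (i + 1) k (dem i \<Phi>)) w = dem i (ecov i k (ecov (i + 1) k \<Phi>)) w"
  proof (cases "w \<in> S_inf")
    case True
    define U where "U x y z = w(i := x, i + 1 := y, k := z)" for x y z
    define C where "C x y \<longleftrightarrow> (\<forall>c. i + 1 < c \<and> c < k \<longrightarrow> \<not> (x < w c \<and> w c < y))" for x y
    define p q r where "p = w i" and "q = w (i + 1)" and "r = w k"
    have ne: "p \<noteq> q" "p \<noteq> r" "q \<noteq> r"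
      using k by (auto simp: p_def q_def r_def S_inf_inj[OF True])
    have w: "w = U p q r" by (auto simp: U_def p_def q_def r_def fun_eq_iff)
    have tr: "U x y z \<circ> transpose i k = U z y x" "U x y z \<circ> transpose (i + 1) k = U x z y"
      "sw (U x y z) i = U y x z" for x y z
      using k by (auto simp: U_def fun_eq_iff transpose_def sw_apply)
    have val: "U x y z i = x" "U x y z (i + 1) = y" "U x y z k = z"
      "i + 1 < c \<Longrightarrow> c < k \<Longrightarrow> U x y z c = w c" for x y z c
      using k by (auto simp: U_def)
    have cov: "cov (U x y z) i k \<longleftrightarrow> x < z \<and> \<not> (x < y \<and> y < z) \<and> C x z"
      "cov (U x y z) (i + 1) k \<longleftrightarrow> y < z \<and> C y z" for x y z
      unfolding cov_first[OF i k] C_def by (simp only: val cong: conj_cong imp_cong)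
        (use i k in \<open>simp add: cov_def val(2)[simplified] val(3,4) cong: conj_cong imp_cong\<close>)
    have S: "U p q r \<in> S_inf" using True w by simp
    have S3: "U r q p \<in> S_inf" "U p r q \<in> S_inf" "U q p r \<in> S_inf"
      using S_inf_swap[OF S, of i k] S_inf_swap[OF S, of "i + 1" k] sw_S_inf[OF S, of i] i k
      unfolding tr by auto
    have S2: "U r p q \<in> S_inf" "U q r p \<in> S_inf"
      using S_inf_swap[OF S3(1), of "i + 1" k] S_inf_swap[OF S3(3), of "i + 1" k] i k
      unfolding tr by auto
    \<comment> \<open>In the order q < p < r a permutation is reached once by a cover across q < r
      and once by two covers across q < p and p < r, with opposite signs. The terms cancel because
      the free interval splits at p.\<close>
    have C1: "C q r \<longleftrightarrow> C q p \<and> C p r" if "q < p" "p < r"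
    proof -
      have "w c \<noteq> p" if "i + 1 < c" for c using that by (auto simp: p_def S_inf_inj[OF True])
      then have "q < w c \<and> w c < r \<longleftrightarrow> q < w c \<and> w c < p \<or> p < w c \<and> w c < r" if "i + 1 < c" for c
        using that \<open>q < p\<close> \<open>p < r\<close> by (meson less_trans linorder_neqE_nat)
      then show ?thesis unfolding C_def by blast
    qed
    consider "p < q" "q < r" | "p < r" "r < q" | "r < p" "p < q" | "r < q" "q < p" | "q < p" "p < r" | "q < r" "r < p"
      using ne by linarith
    then show ?thesis
      unfolding w
      by cases (simp_all add: ecov_def covop_def dem_def tr val cov S S3 S2 C1
          del: Suc_eq_plus1_left One_nat_def add_Suc_right comp_apply)
  qed (simp add: ecov_def covop_def dem_def)
qed

lemma ecov_pair_dem_commute_right: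
  assumes k: "1 \<le> k" and i: "k < i"
  shows "ecov k (i + 1) (ecov k i (dem i \<Phi>)) = dem i (ecov k (i + 1) (ecov k i \<Phi>))"
proof
  fix w
  show "ecov k (i + 1) (ecov k i (dem i \<Phi>)) w = dem i (ecov k (i + 1) (ecov k i \<Phi>)) w"
  proof (cases "w \<in> S_inf")
    case True
    define U where "U x y z = w(k := x, i := y, i + 1 := z)" for x y z
    define C where "C x y \<longleftrightarrow> (\<forall>c. k < c \<and> c < i \<longrightarrow> \<not> (x < w c \<and> w c < y))" for x y
    define p q r where "p = w k" and "q = w i" and "r = w (i + 1)"
    have ne: "p \<noteq> q" "p \<noteq> r" "q \<noteq> r"
      using i by (auto simp: p_def q_def r_def S_inf_inj[OF True])
    have w: "w = U p q r" by (auto simp: U_def p_def q_def r_def fun_eq_iff)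
    have tr: "U x y z \<circ> transpose k i = U y x z" "U x y z \<circ> transpose k (i + 1) = U z y x"
      "sw (U x y z) i = U x z y" for x y z
      using i by (auto simp: U_def fun_eq_iff transpose_def sw_apply)
    have val: "U x y z k = x" "U x y z i = y" "U x y z (i + 1) = z"
      "k < c \<Longrightarrow> c < i \<Longrightarrow> U x y z c = w c" for x y z c
      using i by (auto simp: U_def)
    have cov: "cov (U x y z) k (i + 1) \<longleftrightarrow> x < z \<and> \<not> (x < y \<and> y < z) \<and> C x z"
      "cov (U x y z) k i \<longleftrightarrow> x < y \<and> C x y" for x y z
      unfolding cov_last[OF k i] C_def by (simp only: val cong: conj_cong imp_cong)
        (use i k in \<open>simp add: cov_def val cong: conj_cong imp_cong\<close>)
    have S: "U p q r \<in> S_inf" using True w by simp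
    have S3: "U q p r \<in> S_inf" "U r q p \<in> S_inf" "U p r q \<in> S_inf"
      using S_inf_swap[OF S, of k i] S_inf_swap[OF S, of k "i + 1"] sw_S_inf[OF S, of i] i k
      unfolding tr by auto
    have S2: "U q r p \<in> S_inf" "U r p q \<in> S_inf"
      using S_inf_swap[OF S3(2), of k i] S_inf_swap[OF S3(3), of k i] i k
      unfolding tr by auto
    have C1: "C p q \<longleftrightarrow> C p r \<and> C r q" if "p < r" "r < q"
    proof -
      have "w c \<noteq> r" if "c < i" for c using that by (auto simp: r_def S_inf_inj[OF True])
      then have "p < w c \<and> w c < q \<longleftrightarrow> p < w c \<and> w c < r \<or> r < w c \<and> w c < q" if "c < i" for c
        using that \<open>p < r\<close> \<open>r < q\<close> by (meson less_trans linorder_neqE_nat)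
      then show ?thesis unfolding C_def by blast
    qed
    consider "p < q" "q < r" | "p < r" "r < q" | "r < p" "p < q" | "r < q" "q < p" | "q < p" "p < r" | "q < r" "r < p"
      using ne by linarith
    then show ?thesis
      unfolding w
      by cases (simp_all add: ecov_def covop_def dem_def tr val cov S S3 S2 C1
          del: Suc_eq_plus1_left One_nat_def add_Suc_right comp_apply)
  qed (simp add: ecov_def covop_def dem_def)
qed

section \<open>The two products in the Monk formula\<close>

definition lprod :: "nat \<Rightarrow> pfun \<Rightarrow> pfun" where
  "lprod k = foldr (\<lambda>a. ecov a k) [1..<k]"

text \<open>The cutoff M stands for an infinite product: if \<open>w\<close> fixes every position
  from M on and k < M, no b > M gives a cover, because \<open>w M = M\<close> lies between. The
  factor with the largest b acts first.\<close>

definition rprod :: "nat \<Rightarrow> nat \<Rightarrow> pfun \<Rightarrow> pfun" where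
  "rprod M k = foldr (\<lambda>b. ecov k b) (rev [k + 1..<M + 1])"

lemma foldr_ecov_hom:
  assumes "h 0 = 0" "\<And>x y. h (x - y) = h x - h y"
  shows "h (foldr (\<lambda>x. ecov (f x) (g x)) xs \<Phi> w) = foldr (\<lambda>x. ecov (f x) (g x)) xs (\<lambda>w. h (\<Phi> w)) w"
proof -
  have "h (ecov a b \<Psi> w) = ecov a b (\<lambda>w. h (\<Psi> w)) w" for \<Psi> w a b
    by (simp add: ecov_def covop_def assms)
  then have "(\<lambda>w. h (foldr (\<lambda>x. ecov (f x) (g x)) xs \<Phi> w)) = foldr (\<lambda>x. ecov (f x) (g x)) xs (\<lambda>w. h (\<Phi> w))"
    by (induct xs) (simp_all only: foldr.simps comp_apply id_apply)
  then show ?thesis by (rule fun_cong)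
qed

lemma foldr_ecov_diff:
  "foldr (\<lambda>x. ecov (f x) (g x)) xs (\<lambda>w. \<Phi> w - \<Psi> w) w
    = foldr (\<lambda>x. ecov (f x) (g x)) xs \<Phi> w - foldr (\<lambda>x. ecov (f x) (g x)) xs \<Psi> w"
proof -
  have "ecov a b (\<lambda>w. \<Phi> w - \<Psi> w) = (\<lambda>w. ecov a b \<Phi> w - ecov a b \<Psi> w)" for \<Phi> \<Psi> a b
    by (simp add: ecov_def covop_def fun_eq_iff)
  then have "foldr (\<lambda>x. ecov (f x) (g x)) xs (\<lambda>w. \<Phi> w - \<Psi> w)
    = (\<lambda>w. foldr (\<lambda>x. ecov (f x) (g x)) xs \<Phi> w - foldr (\<lambda>x. ecov (f x) (g x)) xs \<Psi> w)"
    by (induct xs) (simp_all only: foldr.simps comp_apply id_apply)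
  then show ?thesis by (rule fun_cong)
qed

lemma foldr_commute:
  assumes "\<And>x \<Phi>. x \<in> set xs \<Longrightarrow> f x (d \<Phi>) = d (g x \<Phi>)"
  shows "foldr f xs (d \<Phi>) = d (foldr g xs \<Phi>)"
  using assms by (induct xs) auto

lemma foldr_ecov_cong:
  assumes "\<And>x. x \<in> set xs \<Longrightarrow> 1 \<le> f x \<and> f x \<le> M \<and> 1 \<le> g x \<and> g x \<le> M"
    and "\<And>w. w permutes {1..M} \<Longrightarrow> \<Phi> w = \<Psi> w" and "w permutes {1..M}"
  shows "foldr (\<lambda>x. ecov (f x) (g x)) xs \<Phi> w = foldr (\<lambda>x. ecov (f x) (g x)) xs \<Psi> w"
  using assms(1,3)
proof (induct xs arbitrary: w)
  case (Cons x xs)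
  have "w \<circ> transpose (f x) (g x) permutes {1..M}"
    using Cons(2)[of x] Cons(3) by (intro permutes_swap) auto
  from Cons(1)[OF _ this] Cons(1)[OF _ Cons(3)] Cons(2) show ?case
    unfolding foldr.simps comp_apply ecov_def[of "f x"] covop_def[of "f x"]
    by (simp only: list.set_intros)
qed (simp add: assms(2))

lemma lprod_Suc: "1 \<le> k \<Longrightarrow> lprod (k + 1) \<Phi> = foldr (\<lambda>a. ecov a (k + 1)) [1..<k] (ecov k (k + 1) \<Phi>)"
  by (simp add: lprod_def)

lemma rprod_first:
  assumes "k + 1 \<le> M"
  shows "rprod M k \<Phi> = foldr (\<lambda>b. ecov k b) (rev [k + 2..<M + 1]) (ecov k (k + 1) \<Phi>)"
proof -
  have "[k + 1..<M + 1] = (k + 1) # [k + 2..<M + 1]" using assms by (simp add: upt_conv_Cons)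
  then show ?thesis by (simp add: rprod_def)
qed

text \<open>This and the next three identities trade the index k for k + 1 under
  \<open>desc k\<close> in the two products, matching the rules \<open>isobaric_y\<close> and
  \<open>isobaric_y_Suc\<close> for the factor 1 - x_k.\<close>

lemma lprod_desc: "1 \<le> k \<Longrightarrow> lprod k (desc k (ecov k (k + 1) \<Phi>)) = desc k (lprod (k + 1) \<Phi>)"
  unfolding lprod_Suc unfolding lprod_def
  by (rule foldr_commute[where d = "desc k"]) (use ecov_desc_1 in auto)

lemma lprod_Suc_dem:
  assumes "1 \<le> k" "\<And>w. w \<notin> S_inf \<Longrightarrow> \<Phi> w = 0"
  shows "lprod (k + 1) (dem k \<Phi>) = desc k (lprod k \<Phi>)"
proof -
  have "ecov k (k + 1) (dem k \<Phi>) = desc k \<Phi>" by (rule ecov_dem) (use assms in auto)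
  moreover have "foldr (\<lambda>a. ecov a (k + 1)) [1..<k] (desc k \<Phi>)
    = desc k (foldr (\<lambda>a. ecov a k) [1..<k] \<Phi>)"
    by (rule foldr_commute[where d = "desc k"]) (use ecov_desc_3 in auto)
  ultimately show ?thesis
    unfolding lprod_Suc[OF assms(1)] by (simp only: lprod_def)
qed

lemma rprod_dem:
  assumes "1 \<le> k" "k + 1 \<le> M" "\<And>w. w \<notin> S_inf \<Longrightarrow> \<Phi> w = 0"
  shows "rprod M k (dem k \<Phi>) = desc k (rprod M (k + 1) \<Phi>)"
proof -
  have "ecov k (k + 1) (dem k \<Phi>) = desc k \<Phi>" by (rule ecov_dem) (use assms in auto)
  moreover have "foldr (\<lambda>b. ecov k b) (rev [k + 2..<M + 1]) (desc k \<Phi>)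
    = desc k (foldr (\<lambda>b. ecov (k + 1) b) (rev [k + 2..<M + 1]) \<Phi>)"
    by (rule foldr_commute[where d = "desc k"]) (use assms ecov_desc_2 in auto)
  moreover have "k + 1 + 1 = k + 2" by simp
  ultimately show ?thesis unfolding rprod_first[OF assms(2)] by (simp only: rprod_def)
qed

lemma rprod_Suc_desc:
  assumes "1 \<le> k" "k + 1 \<le> M"
  shows "rprod M (k + 1) (desc k (ecov k (k + 1) \<Phi>)) = desc k (rprod M k \<Phi>)"
proof -
  have "foldr (\<lambda>b. ecov (k + 1) b) (rev [k + 2..<M + 1]) (desc k \<Psi>)
    = desc k (foldr (\<lambda>b. ecov k b) (rev [k + 2..<M + 1]) \<Psi>)" for \<Psi>
    by (rule foldr_commute[where d = "desc k"]) (use assms ecov_desc_4 in auto)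
  moreover have "k + 1 + 1 = k + 2" by simp
  ultimately show ?thesis unfolding rprod_first[OF assms(2)] by (simp only: rprod_def)
qed

text \<open>The factors i and i + 1 are neighbours in the product, which is therefore cut around
  this pair: the pair commutes as a whole, every other factor alone.\<close>

lemma lprod_dem_commute:
  assumes i: "1 \<le> i" "i \<noteq> k" "i + 1 \<noteq> k"
  shows "lprod k (dem i \<Phi>) = dem i (lprod k \<Phi>)"
proof (cases "i + 1 < k")
  case True
  have xs: "[1..<k] = [1..<i] @ [i, i + 1] @ [i + 2..<k]"
  proof -
    have "[1..<k] = [1..<i] @ [i..<k]" using True i upt_add_eq_append[of 1 i "k - i"] by simp
    then show ?thesis using True by (simp add: upt_conv_Cons)
  qed
  have "foldr (\<lambda>a. ecov a k) [i + 2..<k] (dem i \<Phi>) = dem i (foldr (\<lambda>a. ecov a k) [i + 2..<k] \<Phi>)" for \<Phi>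
    by (rule foldr_commute[where d = "dem i"]) (use i True in \<open>auto intro!: ecov_dem_commute\<close>)
  moreover have "foldr (\<lambda>a. ecov a k) [1..<i] (dem i \<Phi>) = dem i (foldr (\<lambda>a. ecov a k) [1..<i] \<Phi>)" for \<Phi>
    by (rule foldr_commute[where d = "dem i"]) (use i True in \<open>auto intro!: ecov_dem_commute\<close>)
  ultimately show ?thesis
    unfolding lprod_def xs using ecov_pair_dem_commute_left[OF i(1) True]
    by (simp only: foldr_append foldr.simps comp_apply id_apply)
next
  case False
  show ?thesis
    unfolding lprod_def by (rule foldr_commute[where d = "dem i"]) (use i False in \<open>auto intro!: ecov_dem_commute\<close>)
qed

lemma rprod_dem_commute:
  assumes i: "1 \<le> i" "i \<noteq> k" "i + 1 \<noteq> k" "i < M" and k: "1 \<le> k"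
  shows "rprod M k (dem i \<Phi>) = dem i (rprod M k \<Phi>)"
proof (cases "k < i")
  case True
  have xs: "rev [k + 1..<M + 1] = rev [i + 2..<M + 1] @ [i + 1, i] @ rev [k + 1..<i]"
  proof -
    have "[k + 1..<M + 1] = [k + 1..<i] @ [i..<M + 1]"
      using True i upt_add_eq_append[of "k + 1" i "M + 1 - i"] by simp
    also have "[i..<M + 1] = [i, i + 1] @ [i + 2..<M + 1]" using i by (simp add: upt_conv_Cons)
    finally show ?thesis by simp
  qed
  have "foldr (\<lambda>b. ecov k b) (rev [i + 2..<M + 1]) (dem i \<Phi>) = dem i (foldr (\<lambda>b. ecov k b) (rev [i + 2..<M + 1]) \<Phi>)" for \<Phi>
    by (rule foldr_commute[where d = "dem i"]) (use i k True in \<open>auto intro!: ecov_dem_commute\<close>)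
  moreover have "foldr (\<lambda>b. ecov k b) (rev [k + 1..<i]) (dem i \<Phi>) = dem i (foldr (\<lambda>b. ecov k b) (rev [k + 1..<i]) \<Phi>)" for \<Phi>
    by (rule foldr_commute[where d = "dem i"]) (use i k True in \<open>auto intro!: ecov_dem_commute\<close>)
  ultimately show ?thesis
    unfolding rprod_def xs using ecov_pair_dem_commute_right[OF k True]
    by (simp only: foldr_append foldr.simps comp_apply id_apply)
next
  case False
  show ?thesis
    unfolding rprod_def by (rule foldr_commute[where d = "dem i"]) (use i k False in \<open>auto intro!: ecov_dem_commute\<close>)
qed

definition Gr0 :: pfun where
  "Gr0 w = (if w \<in> S_inf then Gr w else 0)"

text \<open>Moves a divided difference from the polynomials to their index, where the relations
  above apply. \<open>Gr\<close> is extended by zero since \<open>ecov_dem\<close> asks for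
  functions vanishing outside \<open>S_inf\<close>.\<close>

lemma isobaric_Gr0:
  assumes i: "1 \<le> i"
  shows "(\<lambda>w. isobaric i (Gr0 w)) = dem i Gr0"
proof
  fix w show "isobaric i (Gr0 w) = dem i Gr0 w"
  proof (cases "w \<in> S_inf")
    case True
    then show ?thesis
      using isobaric_Gr_descent[OF True i] isobaric_Gr_ascent[OF True i] asc_or_desc[OF True, of i]
        sw_S_inf[OF True i] by (auto simp: Gr0_def dem_def)
  qed (simp add: Gr0_def dem_def)
qed

lemma isobaric_lprod: "1 \<le> i \<Longrightarrow> isobaric i (lprod k Gr0 w) = lprod k (dem i Gr0) w"
  using foldr_ecov_hom[of "isobaric i" "\<lambda>a. a" "\<lambda>a. k" "[1..<k]" Gr0 w]
  by (simp add: lprod_def isobaric_Gr0)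

lemma isobaric_rprod: "1 \<le> i \<Longrightarrow> isobaric i (rprod M k Gr0 w) = rprod M k (dem i Gr0) w"
  using foldr_ecov_hom[of "isobaric i" "\<lambda>a. k" "\<lambda>a. a" "rev [k + 1..<M + 1]" Gr0 w]
  by (simp add: rprod_def isobaric_Gr0)

text \<open>The upper end of a cover is never the identity, so after truncation only the leading 1
  of each \<open>ecov\<close> survives. Both sides of the Monk formula thus have the same constant
  term.\<close>

lemma trunc_0_foldr_ecov:
  "trunc 0 (foldr (\<lambda>x. ecov (f x) (g x)) xs Gr0 w) = (if w = id then 1 else 0)"
proof -
  have "trunc 0 (foldr (\<lambda>x. ecov (f x) (g x)) xs Gr0 w)
    = foldr (\<lambda>x. ecov (f x) (g x)) xs (\<lambda>w. trunc 0 (Gr0 w)) w"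
    by (rule foldr_ecov_hom[where h = "trunc 0"]) auto
  also have "(\<lambda>w. trunc 0 (Gr0 w)) = (\<lambda>w. if w = id then 1 else 0)"
    by (rule ext) (auto simp: Gr0_def trunc_0_Gr)
  also have "foldr (\<lambda>x. ecov (f x) (g x)) xs (\<lambda>w. if w = id then 1 else 0) w = (if w = id then 1 else 0)"
  proof (induct xs arbitrary: w)
    case (Cons x xs)
    have "w \<circ> transpose (f x) (g x) \<noteq> id" if "cov w (f x) (g x)"
    proof
      assume "w \<circ> transpose (f x) (g x) = id"
      then have "(w \<circ> transpose (f x) (g x)) (f x) = f x" "(w \<circ> transpose (f x) (g x)) (g x) = g x"
        by simp_all
      then show False using that by (auto simp: cov_def)
    qed
    then show ?case
      unfolding foldr.simps comp_apply ecov_def[of "f x"] covop_def[of "f x"] Cons by auto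
  qed simp
  finally show ?thesis .
qed

text \<open>For the difference F of the sides, \<open>isobaric i\<close> yields
  \<open>desc k (F (k + 1))\<close> if i = k, F plus \<open>desc i (F i)\<close> if i + 1 = k, and
  \<open>dem i (F k)\<close> or F otherwise. As the index of F moves, the induction runs over all k
  at once; it makes the \<open>desc\<close> terms vanish.\<close>

theorem monk:
  assumes "w permutes {1..M - 1}" "1 \<le> k" "k < M"
  shows "(1 - X k) * lprod k Gr0 w = rprod M k Gr0 w"
proof -
  define F where "F k w = (1 - X k) * lprod k Gr0 w - rprod M k Gr0 w" for k w
  have Gr0: "\<And>w. w \<notin> S_inf \<Longrightarrow> Gr0 w = 0" by (simp add: Gr0_def)
  have "F k w = 0"
    using assms
  proof (induct "len w" arbitrary: k w rule: less_induct)
    case less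
    have w: "w \<in> S_inf" by (rule S_infI[OF less(2)])
    have IH: "desc i (F j) w = 0" if "1 \<le> i" "i < M" "1 \<le> j" "j < M \<or> i + 1 = j" for i j
    proof (cases "w (i + 1) < w i")
      case True
      have "i + 1 < M"
      proof (rule ccontr)
        assume "\<not> i + 1 < M"
        then show False using permutes_less_outside[OF less(2), of "i + 1" i] True that by linarith
      qed
      then have "sw w i permutes {1..M - 1}" using less that by (intro sw_permutes) auto
      then show ?thesis using less(1)[of "sw w i" j] len_sw(2)[OF w that(1) True] \<open>i + 1 < M\<close> that
        by (auto simp: desc_def)
    qed (simp add: desc_def)
    show ?case
    proof (rule isobaric_eigen_eq_0)
      show "trunc 0 (F k w) = 0"
        using less trunc_0_foldr_ecov[of "\<lambda>a. a" "\<lambda>a. k" "[1..<k]" w]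
          trunc_0_foldr_ecov[of "\<lambda>a. k" "\<lambda>a. a" "rev [k + 1..<M + 1]" w]
        by (simp add: F_def lprod_def rprod_def)
    next
      fix i :: nat assume i: "1 \<le> i"
      consider "i = k" | "i + 1 = k" | "i \<noteq> k" "i + 1 \<noteq> k" "i < M" | "M \<le> i" "i \<noteq> k" "i + 1 \<noteq> k"
        using less by linarith
      then show "isobaric i (F k w) = 0 \<or> isobaric i (F k w) = F k w"
      proof cases
        case 1
        have "isobaric k (F k w) = (1 - X (k + 1)) * (lprod k (dem k Gr0) w - lprod k Gr0 w)
            - rprod M k (dem k Gr0) w"
          using i 1 by (simp only: F_def isobaric_diff isobaric_y isobaric_lprod isobaric_rprod)
        also have "lprod k (dem k Gr0) w - lprod k Gr0 w = lprod k (\<lambda>w. dem k Gr0 w - Gr0 w) w"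
          unfolding lprod_def by (rule foldr_ecov_diff[of "\<lambda>a. a" "\<lambda>a. k", symmetric])
        also have "\<dots> = desc k (lprod (k + 1) Gr0) w"
          using less by (simp only: dem_minus_id lprod_desc)
        also have "rprod M k (dem k Gr0) w = desc k (rprod M (k + 1) Gr0) w"
          using less Gr0 by (subst rprod_dem) auto
        also have "(1 - X (k + 1)) * desc k (lprod (k + 1) Gr0) w - desc k (rprod M (k + 1) Gr0) w
          = desc k (F (k + 1)) w"
          by (simp add: desc_def F_def)
        also have "\<dots> = 0" using less by (intro IH) auto
        finally show ?thesis using 1 by simp
      next
        case 2
        have "isobaric i (F k w) - F k w = (1 - X i) * lprod k (dem i Gr0) w
            - (rprod M k (dem i Gr0) w - rprod M k Gr0 w)"
          using i 2[symmetric] by (simp only: F_def isobaric_diff isobaric_y_Suc isobaric_lprod isobaric_rprod) simp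
        also have "rprod M k (dem i Gr0) w - rprod M k Gr0 w = rprod M k (\<lambda>w. dem i Gr0 w - Gr0 w) w"
          unfolding rprod_def by (rule foldr_ecov_diff[of "\<lambda>a. k" "\<lambda>a. a", symmetric])
        also have "\<dots> = desc i (rprod M i Gr0) w"
          using less i 2[symmetric] by (simp only: dem_minus_id rprod_Suc_desc)
        also have "lprod k (dem i Gr0) w = desc i (lprod i Gr0) w"
          using lprod_Suc_dem[OF i Gr0] 2 by simp
        also have "(1 - X i) * desc i (lprod i Gr0) w - desc i (rprod M i Gr0) w = desc i (F i) w"
          by (simp add: desc_def F_def)
        also have "\<dots> = 0" using less i 2 by (intro IH) auto
        finally show ?thesis by simp
      next
        case 3
        have "isobaric i (F k w) = (1 - X k) * lprod k (dem i Gr0) w - rprod M k (dem i Gr0) w"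
          using i 3 by (simp only: F_def isobaric_diff isobaric_y_other isobaric_lprod isobaric_rprod)
        also have "\<dots> = dem i (F k) w"
          unfolding lprod_dem_commute[OF i 3(1,2)] rprod_dem_commute[OF i 3 less(3)]
          by (simp add: dem_def F_def)
        finally show ?thesis
          using IH[of i k] i 3 less by (auto simp: dem_def desc_def)
      next
        \<comment> \<open>All permutations met stay in the symmetric group on 1..M, so they ascend
          at i \<ge> M, where \<open>dem i\<close> does nothing.\<close>
        case 4
        have "isobaric i (F k w) = (1 - X k) * lprod k (dem i Gr0) w - rprod M k (dem i Gr0) w"
          using i 4 by (simp only: F_def isobaric_diff isobaric_y_other isobaric_lprod isobaric_rprod)
        moreover have dem: "dem i Gr0 v = Gr0 v" if "v permutes {1..M}" for v
          using permutes_less_outside[OF that, of "i + 1" i] 4 by (simp add: dem_def)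
        have w': "w permutes {1..M}" using less(2) by (rule permutes_subset) auto
        have "lprod k (dem i Gr0) w = lprod k Gr0 w"
          unfolding lprod_def by (rule foldr_ecov_cong[OF _ dem w']) (use less in auto)
        moreover have "rprod M k (dem i Gr0) w = rprod M k Gr0 w"
          unfolding rprod_def by (rule foldr_ecov_cong[OF _ dem w']) (use less in auto)
        ultimately have "isobaric i (F k w) = F k w" by (simp add: F_def)
        then show ?thesis by blast
      qed
    qed
  qed
  then show ?thesis by (simp add: F_def)
qed

section \<open>Transition\<close>

text \<open>These turn out to be the pivot rows of \<open>add_corner l u\<close>; phrased by covers,
  they index the terms of the transition formula.\<close>

definition covered_rows :: "nat \<Rightarrow> (nat \<Rightarrow> nat) \<Rightarrow> nat set" where
  "covered_rows l u = {i. cov u i l}"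

definition swap_fold :: "nat \<Rightarrow> (nat \<Rightarrow> nat) \<Rightarrow> nat list \<Rightarrow> nat \<Rightarrow> nat" where
  "swap_fold l = foldl (\<lambda>v i. v \<circ> transpose i l)"

lemma swap_fold_simps [simp]:
  "swap_fold l u [] = u" "swap_fold l u (i # is) = swap_fold l (u \<circ> transpose i l) is"
  by (simp_all add: swap_fold_def)

text \<open>At positions between s and l no value lies between \<open>u s\<close> and
  \<open>u l\<close>, so a row i in between cannot tell which of these two values stands at
  l.\<close>

lemma cov_after_swap:
  assumes u: "u \<in> S_inf" and s: "cov u s l" and i: "s < i" "i < l"
  shows "cov (u \<circ> transpose s l) i l \<longleftrightarrow> cov u i l"
proof -
  have s': "1 \<le> s" "u s < u l" "\<And>c. s < c \<Longrightarrow> c < l \<Longrightarrow> \<not> (u s < u c \<and> u c < u l)"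
    using s by (auto simp: cov_def)
  have ne: "u c \<noteq> u s" if "s < c" for c using that by (auto simp: S_inf_inj[OF u])
  have v: "(u \<circ> transpose s l) c = u c" if "s < c" "c < l" for c using that by auto
  have vl: "(u \<circ> transpose s l) l = u s" by simp
  have iff: "x < u s \<longleftrightarrow> x < u l" if "x = u c" "s < c" "c < l" for x c
    using s'(2) s'(3)[OF that(2,3)] ne[OF that(2)] that(1) by linarith
  have "(\<forall>c. i < c \<and> c < l \<longrightarrow> \<not> (u i < u c \<and> u c < u s)) \<longleftrightarrow> (\<forall>c. i < c \<and> c < l \<longrightarrow> \<not> (u i < u c \<and> u c < u l))"
    using i iff[OF refl] by (meson less_trans)
  moreover have "(\<forall>c. i < c \<and> c < l \<longrightarrow> \<not> (u i < (u \<circ> transpose s l) c \<and> (u \<circ> transpose s l) c < u s))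
    \<longleftrightarrow> (\<forall>c. i < c \<and> c < l \<longrightarrow> \<not> (u i < u c \<and> u c < u s))"
    by (intro iff_allI imp_cong refl) (use i v in \<open>simp del: comp_apply\<close>)
  ultimately show ?thesis
    unfolding cov_def vl v[OF i] using iff[OF refl i] by blast
qed

lemma covered_rows_swap:
  assumes u: "u \<in> S_inf" and "sorted_wrt (<) (i # is)" "set (i # is) \<subseteq> covered_rows l u"
  shows "set is \<subseteq> covered_rows l (u \<circ> transpose i l)"
proof
  fix x assume "x \<in> set is"
  then have "cov u i l" "i < x" "cov u x l" using assms(2,3) by (auto simp: covered_rows_def)
  moreover from this have "x < l" by (simp add: cov_def)
  ultimately show "x \<in> covered_rows l (u \<circ> transpose i l)"
    using cov_after_swap[OF u] by (simp add: covered_rows_def)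
qed

lemma sorted_list_of_set_insert_min:
  assumes "finite I" "\<And>x. x \<in> I \<Longrightarrow> s < (x::nat)"
  shows "sorted_list_of_set (insert s I) = s # sorted_list_of_set I"
proof -
  have "s \<notin> I" using assms(2) by blast
  then have "sorted_list_of_set (insert s I) = insort s (sorted_list_of_set I)"
    using assms(1) by simp
  also have "\<dots> = s # sorted_list_of_set I"
    using assms by (intro insort_is_Cons) (auto intro: less_imp_le)
  finally show ?thesis .
qed

text \<open>Each factor contributes 1 or minus a cover. A chosen cover leaves the covers from later
  rows intact, so the choices are independent and run through all sets of covered rows.\<close>

lemma foldr_ecov_expand:
  assumes "u \<in> S_inf" "s \<le> l" "1 \<le> s"
  shows "foldr (\<lambda>a. ecov a l) [s..<l] \<Phi> u
    = (\<Sum>I\<in>Pow (covered_rows l u \<inter> {s..<l}). (-1) ^ card I * \<Phi> (swap_fold l u (sorted_list_of_set I)))"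
  using assms
proof (induct "l - s" arbitrary: s u)
  case 0
  then have "{s..<l} = {}" "[s..<l] = []" by simp_all
  then show ?case by simp
next
  case (Suc d)
  then have sl: "s < l" by simp
  let ?S = "\<lambda>u. \<Sum>I\<in>Pow (covered_rows l u \<inter> {Suc s..<l}). (-1) ^ card I * \<Phi> (swap_fold l u (sorted_list_of_set I))"
  have IH: "foldr (\<lambda>a. ecov a l) [Suc s..<l] \<Phi> u = ?S u" if "u \<in> S_inf" for u
    using Suc(1)[of "Suc s" u] Suc(2) that sl by simp
  have up: "[s..<l] = s # [Suc s..<l]" using sl by (simp add: upt_conv_Cons)
  have L: "foldr (\<lambda>a. ecov a l) [s..<l] \<Phi> u
    = ?S u - (if cov u s l then ?S (u \<circ> transpose s l) else 0)"
  proof -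
    have "u \<circ> transpose s l \<in> S_inf" using Suc sl by (intro S_inf_swap) auto
    then show ?thesis
      unfolding up foldr.simps comp_apply ecov_def[of s] covop_def[of s]
      using IH Suc(3) by (simp only: HOL.simp_thms)
  qed
  show ?case
  proof (cases "cov u s l")
    case False
    then have "covered_rows l u \<inter> {s..<l} = covered_rows l u \<inter> {Suc s..<l}"
      by (force simp: covered_rows_def Suc_le_eq le_less)
    then show ?thesis unfolding L using False by simp
  next
    case True
    let ?Q = "covered_rows l u \<inter> {Suc s..<l}"
    have Q: "covered_rows l (u \<circ> transpose s l) \<inter> {Suc s..<l} = ?Q"
      using cov_after_swap[OF Suc(3) True] by (auto simp: covered_rows_def Suc_le_eq simp del: comp_apply)
    have ins: "covered_rows l u \<inter> {s..<l} = insert s ?Q"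
      using True sl by (auto simp: covered_rows_def)
    have sQ: "s \<notin> ?Q" by auto
    have fin: "finite ?Q" by simp
    have "(\<Sum>I\<in>Pow (insert s ?Q). (-1) ^ card I * \<Phi> (swap_fold l u (sorted_list_of_set I)))
      = ?S u + (\<Sum>I\<in>insert s ` Pow ?Q. (-1) ^ card I * \<Phi> (swap_fold l u (sorted_list_of_set I)))"
      unfolding Pow_insert by (rule sum.union_disjoint) (use fin sQ in auto)
    also have "(\<Sum>I\<in>insert s ` Pow ?Q. (-1) ^ card I * \<Phi> (swap_fold l u (sorted_list_of_set I)))
      = (\<Sum>I\<in>Pow ?Q. (-1) ^ card (insert s I) * \<Phi> (swap_fold l u (sorted_list_of_set (insert s I))))"
    proof (rule sum.reindex_cong[OF _ refl refl])
      show "inj_on (insert s) (Pow ?Q)"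
        using sQ unfolding inj_on_def by (metis PowD in_mono insert_ident)
    qed
    also have "\<dots> = (\<Sum>I\<in>Pow ?Q. - ((-1) ^ card I * \<Phi> (swap_fold l (u \<circ> transpose s l) (sorted_list_of_set I))))"
    proof (rule sum.cong[OF refl])
      fix I assume I: "I \<in> Pow ?Q"
      then have "finite I" "s \<notin> I" using fin finite_subset by auto
      then have "card (insert s I) = Suc (card I)" by (rule card_insert_disjoint)
      moreover have "sorted_list_of_set (insert s I) = s # sorted_list_of_set I"
        using I \<open>finite I\<close> by (intro sorted_list_of_set_insert_min) auto
      ultimately show "(-1) ^ card (insert s I) * \<Phi> (swap_fold l u (sorted_list_of_set (insert s I)))
        = - ((-1) ^ card I * \<Phi> (swap_fold l (u \<circ> transpose s l) (sorted_list_of_set I)))"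
        by (simp only: swap_fold_simps power_Suc mult_minus_left mult_1)
    qed
    also have "\<dots> = - ?S (u \<circ> transpose s l)" unfolding Q by (simp only: sum_negf)
    finally show ?thesis unfolding L ins using True by (simp only: if_True diff_conv_add_uminus)
  qed
qed

text \<open>The position of the dot that row \<open>l\<close> is swapped with when the box \<open>(l, u l)\<close> is added.\<close>

definition next_pos :: "nat \<Rightarrow> (nat \<Rightarrow> nat) \<Rightarrow> nat" where
  "next_pos l u = (LEAST k. l < k \<and> u l < u k)"

lemma next_pos:
  assumes u: "u \<in> S_inf"
  shows "l < next_pos l u" "u l < u (next_pos l u)"
    "\<And>c. l < c \<Longrightarrow> c < next_pos l u \<Longrightarrow> u c < u l"
proof -
  obtain n where n: "u permutes {1..n}" "l \<le> n" using S_infE[OF u] .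
  have "l < next_pos l u \<and> u l < u (next_pos l u)"
    unfolding next_pos_def
    by (rule LeastI[of _ "n + 1"]) (use n permutes_less_outside[OF n(1), of "n + 1" l] in auto)
  then show "l < next_pos l u" "u l < u (next_pos l u)" by auto
  fix c assume c: "l < c" "c < next_pos l u"
  then have "\<not> u l < u c" using not_less_Least[of c "\<lambda>k. l < k \<and> u l < u k"] by (simp add: next_pos_def)
  then show "u c < u l" using c S_inf_inj[OF u, of c l] by simp
qed

definition add_corner :: "nat \<Rightarrow> (nat \<Rightarrow> nat) \<Rightarrow> nat \<Rightarrow> nat" where
  "add_corner l u = u \<circ> transpose l (next_pos l u)"

lemma cov_next_pos: "u \<in> S_inf \<Longrightarrow> 1 \<le> l \<Longrightarrow> cov u l (next_pos l u)"
  using next_pos[of u l] unfolding cov_def by (meson less_asym)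

lemma add_corner_S_inf: "u \<in> S_inf \<Longrightarrow> 1 \<le> l \<Longrightarrow> add_corner l u \<in> S_inf"
  unfolding add_corner_def using next_pos(1)[of u l] by (intro S_inf_swap) auto

lemma foldr_ecov_trivial:
  assumes "\<And>b. b \<in> set bs \<Longrightarrow> \<not> cov v l b"
  shows "foldr (\<lambda>b. ecov l b) bs \<Phi> v = \<Phi> v"
  using assms
proof (induct bs)
  case (Cons b bs)
  then show ?case unfolding foldr.simps comp_apply ecov_def[of l] covop_def[of l] by simp
qed simp

text \<open>The Monk formula at l, where the product on the right collapses: \<open>u\<close>
  increases beyond l, so the only cover exchanges l with k = \<open>next_pos l u\<close>. A later b
  is screened by k, an earlier b has \<open>u b < u l\<close>, and after the exchange at k no
  further factor applies.\<close>

lemma transition_lprod: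
  assumes u: "u \<in> S_inf" and l: "1 \<le> l" and inc: "inc_after l u"
  shows "Gr (add_corner l u) = Gr u - (1 - X l) * lprod l Gr0 u"
proof -
  define k where "k = next_pos l u"
  note k = next_pos[OF u, of l, folded k_def]
  obtain n where n: "u permutes {1..n}" "l + k \<le> n" using S_infE[OF u] .
  define M where "M = n + 1"
  have xs: "rev [l + 1..<M + 1] = rev [k + 1..<M + 1] @ [k] @ rev [l + 1..<k]"
  proof -
    have "[l + 1..<M + 1] = [l + 1..<k] @ [k..<M + 1]"
      using k n upt_add_eq_append[of "l + 1" k "M + 1 - k"] by (simp add: M_def)
    also have "[k..<M + 1] = [k] @ [k + 1..<M + 1]" using n by (simp add: upt_conv_Cons M_def)
    finally show ?thesis by simp
  qed
  have w: "u \<circ> transpose l k \<in> S_inf" using add_corner_S_inf[OF u l] by (simp add: add_corner_def k_def)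
  have 1: "foldr (\<lambda>b. ecov l b) (rev [k + 1..<M + 1]) \<Phi> u = \<Phi> u" for \<Phi>
  proof (rule foldr_ecov_trivial)
    fix b assume "b \<in> set (rev [k + 1..<M + 1])"
    then have "l < k" "k < b" "u k < u b" using k inc_after_less[OF inc] by auto
    then show "\<not> cov u l b" using k by (auto simp: cov_def)
  qed
  have 2: "foldr (\<lambda>b. ecov l b) (rev [l + 1..<k]) \<Phi> u = \<Phi> u" for \<Phi>
  proof (rule foldr_ecov_trivial)
    fix b assume "b \<in> set (rev [l + 1..<k])"
    then show "\<not> cov u l b" using k(3)[of b] by (auto simp: cov_def)
  qed
  have 3: "foldr (\<lambda>b. ecov l b) (rev [l + 1..<k]) \<Phi> (u \<circ> transpose l k) = \<Phi> (u \<circ> transpose l k)" for \<Phi>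
  proof (rule foldr_ecov_trivial)
    fix b assume "b \<in> set (rev [l + 1..<k])"
    then show "\<not> cov (u \<circ> transpose l k) l b" using k(3)[of b] k(2) by (auto simp: cov_def)
  qed
  have "rprod M l Gr0 u = ecov l k (foldr (\<lambda>b. ecov l b) (rev [l + 1..<k]) Gr0) u"
    unfolding rprod_def xs foldr_append 1 by simp
  also have "\<dots> = Gr0 u - Gr0 (u \<circ> transpose l k)"
    unfolding ecov_def[of l k] covop_def[of l k] 2 3
    using cov_next_pos[OF u l] u by (simp add: k_def)
  also have "\<dots> = Gr u - Gr (add_corner l u)"
    using u w by (simp add: Gr0_def add_corner_def k_def)
  finally show ?thesis using monk[of u M l] n l k by (simp add: M_def)
qed

lemma swap_fold_S_inf:
  "u \<in> S_inf \<Longrightarrow> 1 \<le> l \<Longrightarrow> (\<And>i. i \<in> set is \<Longrightarrow> 1 \<le> i) \<Longrightarrow> swap_fold l u is \<in> S_inf"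
proof (induct "is" arbitrary: u)
  case (Cons i "is")
  have "u \<circ> transpose i l \<in> S_inf" using Cons by (intro S_inf_swap) auto
  then show ?case using Cons(1)[of "u \<circ> transpose i l"] Cons(3,4) by (simp del: comp_apply)
qed simp

lemma covered_rows_finite [simp]: "finite (covered_rows l u)"
  by (rule finite_subset[of _ "{..l}"]) (auto simp: covered_rows_def cov_def)

text \<open>As l > t, truncation turns 1 - x_l into 1, and then the term of the empty set in the
  expansion cancels \<open>Gr u\<close>.\<close>

theorem transition:
  assumes u: "u \<in> S_inf" and l: "1 \<le> l" "t < l" and inc: "inc_after l u"
  shows "trunc t (Gr (add_corner l u))
    = (\<Sum>I | I \<noteq> {} \<and> I \<subseteq> covered_rows l u.
        (-1) ^ (card I + 1) * trunc t (Gr (swap_fold l u (sorted_list_of_set I))))"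
proof -
  let ?P = "covered_rows l u"
  let ?f = "\<lambda>I. (-1) ^ card I * trunc t (Gr (swap_fold l u (sorted_list_of_set I)))"
  have "?P \<inter> {1..<l} = ?P" by (auto simp: covered_rows_def cov_def)
  then have "lprod l Gr0 u = (\<Sum>I\<in>Pow ?P. (-1) ^ card I * Gr0 (swap_fold l u (sorted_list_of_set I)))"
    using foldr_ecov_expand[OF u, of 1 l Gr0] l by (simp add: lprod_def)
  also have "\<dots> = (\<Sum>I\<in>Pow ?P. (-1) ^ card I * Gr (swap_fold l u (sorted_list_of_set I)))"
  proof (rule sum.cong[OF refl])
    fix I assume "I \<in> Pow ?P"
    then have "I \<subseteq> ?P" "finite I" using finite_subset[OF _ covered_rows_finite] by auto
    then have "swap_fold l u (sorted_list_of_set I) \<in> S_inf"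
      using l by (intro swap_fold_S_inf[OF u]) (auto simp: covered_rows_def cov_def)
    then show "(-1) ^ card I * Gr0 (swap_fold l u (sorted_list_of_set I))
      = (-1) ^ card I * Gr (swap_fold l u (sorted_list_of_set I))" by (simp add: Gr0_def)
  qed
  finally have lp: "trunc t (lprod l Gr0 u) = (\<Sum>I\<in>Pow ?P. ?f I)"
    by (simp add: trunc_sum) (simp add: trunc_def)
  have "(\<Sum>I\<in>Pow ?P. ?f I) = ?f {} + (\<Sum>I\<in>Pow ?P - {{}}. ?f I)"
    by (rule sum.remove) auto
  moreover have "Pow ?P - {{}} = {I. I \<noteq> {} \<and> I \<subseteq> ?P}" by auto
  ultimately have "trunc t (Gr (add_corner l u)) = - (\<Sum>I | I \<noteq> {} \<and> I \<subseteq> ?P. ?f I)"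
    using l unfolding transition_lprod[OF u l(1) inc] by (simp add: lp)
  then show ?thesis by (simp add: sum_negf)
qed

section \<open>Factorization and linear independence\<close>

lemma star_permutes:
  assumes "\<sigma> permutes {1..n}" "\<alpha> permutes {1..n}"
  shows "star n \<sigma> \<alpha> permutes {1..2 * n}"
proof -
  \<comment> \<open>\<open>s\<close> is \<open>star n id \<alpha>\<close>, and
    \<open>star n \<sigma> \<alpha>\<close> is \<open>s \<circ> \<sigma>\<close>.\<close>
  define s where "s i = (if i \<le> n then i else n + \<alpha> (i - n))" for i
  have in_i: "\<alpha> x \<in> {1..n}" "inv \<alpha> x \<in> {1..n}" if "x \<in> {1..n}" for x
    using that permutes_in_image[OF assms(2)] permutes_in_image[OF permutes_inv[OF assms(2)]] by auto
  have "bij_betw s {n + 1..2 * n} {n + 1..2 * n}"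
  proof (rule bij_betw_byWitness[where f' = "\<lambda>i. n + inv \<alpha> (i - n)"])
    show "\<forall>a\<in>{n + 1..2 * n}. n + inv \<alpha> (s a - n) = a"
      using permutes_inverses[OF assms(2)] by (auto simp: s_def)
    have pos: "inv \<alpha> (a - n) > 0" if "a \<in> {n + 1..2 * n}" for a 
    proof -
      have "a - n \<in> {1..n}" using that by auto
      from in_i(2)[OF this] show ?thesis by simp
    qed
    show "\<forall>a\<in>{n + 1..2 * n}. s (n + inv \<alpha> (a - n)) = a"
      using permutes_inverses[OF assms(2)] pos by (fastforce simp: s_def)
    show "s ` {n + 1..2 * n} \<subseteq> {n + 1..2 * n}"
    proof
      fix y assume "y \<in> s ` {n + 1..2 * n}"
      then obtain x where "x \<in> {n + 1..2 * n}" "y = s x" by blast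
      moreover from this have "x - n \<in> {1..n}" by auto
      ultimately show "y \<in> {n + 1..2 * n}" using in_i(1)[of "x - n"] by (auto simp: s_def)
    qed
    show "(\<lambda>i. n + inv \<alpha> (i - n)) ` {n + 1..2 * n} \<subseteq> {n + 1..2 * n}"
    proof
      fix y assume "y \<in> (\<lambda>i. n + inv \<alpha> (i - n)) ` {n + 1..2 * n}"
      then obtain x where "x \<in> {n + 1..2 * n}" "y = n + inv \<alpha> (x - n)" by blast
      moreover from this have "x - n \<in> {1..n}" by auto
      ultimately show "y \<in> {n + 1..2 * n}" using in_i(2)[of "x - n"] by auto
    qed
  qed
  moreover have "s x = x" if "x \<notin> {n + 1..2 * n}" for x
  proof (cases "x \<le> n")
    case False
    then have "x - n \<notin> {1..n}" using that by auto
    then show ?thesis using False permutes_not_in[OF assms(2), of "x - n"] by (simp add: s_def)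
  qed (simp add: s_def)
  ultimately have "s permutes {n + 1..2 * n}" by (rule bij_imp_permutes)
  then have "s permutes {1..2 * n}" by (rule permutes_subset) auto
  moreover have "\<sigma> permutes {1..2 * n}" using assms(1) by (rule permutes_subset) auto
  ultimately have "s \<circ> \<sigma> permutes {1..2 * n}" by (rule permutes_compose[rotated])
  moreover have "s \<circ> \<sigma> = star n \<sigma> \<alpha>"
  proof
    fix i
    show "(s \<circ> \<sigma>) i = star n \<sigma> \<alpha> i"
    proof (cases "i \<in> {1..n}")
      case True
      then show ?thesis using permutes_in_image[OF assms(1), of i] by (auto simp: star_def s_def)
    next
      case False
      then show ?thesis using permutes_not_in[OF assms(1), of i] by (auto simp: star_def s_def)
    qed
  qed
  ultimately show ?thesis by simp
qed

lemma len_star: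
  assumes "\<sigma> permutes {1..n}" "\<alpha> permutes {1..n}"
  shows "len (star n \<sigma> \<alpha>) = len \<sigma> + len (star n id \<alpha>)"
proof -
  have id: "id permutes {1..n}" by (rule permutes_id)
  have lo: "\<sigma> x \<le> n" if "x \<le> n" for x
    using that permutes_in_image[OF assms(1), of x] permutes_not_in[OF assms(1), of x]
    by (cases "x \<in> {1..n}") auto
  have cc1: "cc (star n \<sigma> \<alpha>) b = cc \<sigma> b" "cc (star n id \<alpha>) b = 0" if "b \<le> n" for b
    using that unfolding cc_def by (auto simp: star_def intro!: arg_cong[where f = card])
  have cc2: "cc (star n \<sigma> \<alpha>) b = cc (star n id \<alpha>) b" if "n < b" for b
  proof -
    have "{x. 1 \<le> x \<and> x < b \<and> star n \<sigma> \<alpha> b < star n \<sigma> \<alpha> x} = {x. 1 \<le> x \<and> x < b \<and> star n id \<alpha> b < star n id \<alpha> x}"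
      using that by (auto simp: star_def split: if_splits dest: lo)
    then show ?thesis by (simp only: cc_def)
  qed
  have split: "sum f {1..2 * n} = sum f {1..n} + sum f {n + 1..2 * n}" for f :: "nat \<Rightarrow> nat"
  proof -
    have "{1..2 * n} = {1..n} \<union> {n + 1..2 * n}" by auto
    then show ?thesis by (simp add: sum.union_disjoint)
  qed
  have "len (star n \<sigma> \<alpha>) = (\<Sum>b\<in>{1..n}. cc (star n \<sigma> \<alpha>) b) + (\<Sum>b\<in>{n + 1..2 * n}. cc (star n \<sigma> \<alpha>) b)"
    using len_eq_sum_cc[OF star_permutes[OF assms]] split by simp
  also have "(\<Sum>b\<in>{1..n}. cc (star n \<sigma> \<alpha>) b) = len \<sigma>"
    unfolding len_eq_sum_cc[OF assms(1)] by (rule sum.cong) (auto simp: cc1)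
  also have "(\<Sum>b\<in>{n + 1..2 * n}. cc (star n \<sigma> \<alpha>) b) = (\<Sum>b\<in>{n + 1..2 * n}. cc (star n id \<alpha>) b)"
    by (rule sum.cong) (auto simp: cc2)
  also have "\<dots> = len (star n id \<alpha>)"
    unfolding len_eq_sum_cc[OF star_permutes[OF id assms(2)]] split by (simp add: cc1)
  finally show ?thesis .
qed

lemma isobaric_mult_fixed:
  "isobaric i f = f \<Longrightarrow> isobaric i (f * g) = f * isobaric i g"
  "isobaric i g = g \<Longrightarrow> isobaric i (f * g) = isobaric i f * g"
  using isobaric_mult_sym[of i f g] isobaric_mult_sym[of i g f]
  by (simp_all add: isobaric_eq_self_iff mult.commute)

text \<open>At every i at most one of the two factors has a descent, and
  \<open>star n \<sigma> \<alpha>\<close> descends exactly then; the ascending factor is symmetric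
  and can be taken out. At i = n, between the blocks, all of them ascend.\<close>

theorem Gr_star:
  assumes "\<sigma> permutes {1..n}" "\<alpha> permutes {1..n}"
  shows "Gr (star n \<sigma> \<alpha>) = Gr \<sigma> * Gr (star n id \<alpha>)"
  using assms
proof (induct "len (star n \<sigma> \<alpha>)" arbitrary: \<sigma> \<alpha> rule: less_induct)
  case less
  note s = less(2) and a = less(3)
  have id: "id permutes {1..n}" by (rule permutes_id)
  let ?w = "star n \<sigma> \<alpha>" and ?v = "star n id \<alpha>"
  have S: "?w \<in> S_inf" "?v \<in> S_inf" "\<sigma> \<in> S_inf" "\<alpha> \<in> S_inf"
    using S_infI star_permutes[OF s a] star_permutes[OF id a] s a by auto
  define F where "F = Gr ?w - Gr \<sigma> * Gr ?v"
  have "F = 0"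
  proof (rule isobaric_eigen_eq_0)
    have "?w = id \<longleftrightarrow> \<sigma> = id \<and> ?v = id"
    proof
      assume w: "?w = id"
      have "len \<sigma> = 0" "len ?v = 0" using len_star[OF s a] w len_0_iff[of id] by auto
      then show "\<sigma> = id \<and> ?v = id" using S len_0_iff by auto
    qed auto
    then show "trunc 0 F = 0" using S by (auto simp: F_def trunc_0_Gr)
  next
    fix i :: nat assume i: "1 \<le> i"
    have pos: "\<alpha> 1 \<ge> 1" using S_inf_pos[OF S(4)] by simp
    have le: "\<sigma> n \<le> n" if "i = n" using permutes_in_image[OF s, of n] i that by auto
    have out: "\<sigma> i < \<sigma> (i + 1)" if "n \<le> i" using permutes_less_outside[OF s, of "i + 1" i] that by simp
    consider (left) "i < n" "\<sigma> (i + 1) < \<sigma> i" | (right) "n < i" "\<alpha> (i - n + 1) < \<alpha> (i - n)"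
      | (ascent) "?w i < ?w (i + 1)" "?v i < ?v (i + 1)" "\<sigma> i < \<sigma> (i + 1)"
      using asc_or_desc[OF S(3), of i] asc_or_desc[OF S(4), of "i - n"] pos le out
      by (cases i n rule: linorder_cases) (auto simp: star_def Suc_diff_le)
    then show "isobaric i F = 0 \<or> isobaric i F = F"
    proof cases
      case left
      have sw: "sw ?w i = star n (sw \<sigma> i) \<alpha>" using left by (auto simp: fun_eq_iff star_def sw_apply)
      have d: "?w (i + 1) < ?w i" "?v i < ?v (i + 1)" using left by (auto simp: star_def)
      have "isobaric i (Gr \<sigma> * Gr ?v) = Gr (sw \<sigma> i) * Gr ?v"
        by (simp only: isobaric_mult_fixed(2)[OF isobaric_Gr_ascent[OF S(2) i d(2)]]
            isobaric_Gr_descent[OF S(3) i left(2)])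
      moreover have "Gr (star n (sw \<sigma> i) \<alpha>) = Gr (sw \<sigma> i) * Gr ?v"
        using less(1)[of "sw \<sigma> i" \<alpha>] len_sw(2)[OF S(1) i d(1)] sw sw_permutes[OF s i left(1)] a by simp
      ultimately show ?thesis
        using isobaric_Gr_descent[OF S(1) i d(1)] sw by (simp add: F_def)
    next
      case right
      have n: "i - n < n"
      proof (rule ccontr)
        assume "\<not> i - n < n"
        then show False using permutes_less_outside[OF a, of "i - n + 1" "i - n"] right by simp
      qed
      have sw: "sw ?w i = star n \<sigma> (sw \<alpha> (i - n))" "sw ?v i = star n id (sw \<alpha> (i - n))"
        using right by (auto simp: fun_eq_iff star_def sw_apply Suc_diff_le)
      have d: "?w (i + 1) < ?w i" "?v (i + 1) < ?v i" using right by (auto simp: star_def Suc_diff_le)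
      have "isobaric i (Gr \<sigma> * Gr ?v) = Gr \<sigma> * Gr (star n id (sw \<alpha> (i - n)))"
        using out right
        by (simp only: isobaric_mult_fixed(1)[OF isobaric_Gr_ascent[OF S(3) i]]
            isobaric_Gr_descent[OF S(2) i d(2)] sw less_imp_le)
      moreover have "sw \<alpha> (i - n) permutes {1..n}" using sw_permutes[OF a, of "i - n"] right n by simp
      then have "Gr (star n \<sigma> (sw \<alpha> (i - n))) = Gr \<sigma> * Gr (star n id (sw \<alpha> (i - n)))"
        using less(1)[of \<sigma> "sw \<alpha> (i - n)"] len_sw(2)[OF S(1) i d(1)] sw s by simp
      ultimately show ?thesis
        using isobaric_Gr_descent[OF S(1) i d(1)] sw by (simp add: F_def)
    next
      case ascent
      have "isobaric i (Gr \<sigma> * Gr ?v) = Gr \<sigma> * Gr ?v"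
        by (simp only: isobaric_mult_fixed(2)[OF isobaric_Gr_ascent[OF S(2) i ascent(2)]]
            isobaric_Gr_ascent[OF S(3) i ascent(3)])
      then show ?thesis
        using isobaric_Gr_ascent[OF S(1) i ascent(1)] by (simp add: F_def)
    qed
  qed
  then show ?case by (simp add: F_def)
qed

text \<open>Stated for a family because a divided difference may send different members to the same
  permutation. The one at a descent i of \<open>w\<close> leads a member to \<open>sw w i\<close>
  only if it was \<open>w\<close>: the other candidate, \<open>sw w i\<close> itself, is too short
  to be in the family.\<close>

lemma Gr_relation_lowest:
  assumes "finite J" "\<And>j. j \<in> J \<Longrightarrow> f j \<in> S_inf \<and> r \<le> len (f j)"
    and "(\<Sum>j\<in>J. of_int (c j) * Gr (f j)) = 0" and "w \<in> S_inf" "len w = r"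
  shows "(\<Sum>j | j \<in> J \<and> f j = w. c j) = 0"
  using assms(2-)
proof (induct r arbitrary: f w)
  case 0
  then have w: "w = id" using len_0_iff by blast
  have "(0::int_mpoly) = trunc 0 (\<Sum>j\<in>J. of_int (c j) * Gr (f j))" by (simp only: 0 trunc_simps)
  also have "\<dots> = (\<Sum>j\<in>J. if f j = w then of_int (c j) else 0)"
    unfolding trunc_sum by (rule sum.cong) (use 0 in \<open>auto simp: trunc_0_Gr w\<close>)
  also have "\<dots> = of_int (\<Sum>j | j \<in> J \<and> f j = w. c j)"
    unfolding sum.inter_filter[OF assms(1)] of_int_sum by (rule sum.cong) auto
  finally show ?case by (metis of_int_eq_0_iff)
next
  case (Suc r)
  have "w \<noteq> id" using Suc(5) len_0_iff[OF Suc(4)] by auto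
  then obtain i where i: "1 \<le> i" "w (i + 1) < w i" using exists_descent[OF Suc(4)] by blast
  define g where "g j = (if f j (i + 1) < f j i then sw (f j) i else f j)" for j
  have g: "isobaric i (Gr (f j)) = Gr (g j)" "g j \<in> S_inf" "r \<le> len (g j)" if "j \<in> J" for j
  proof -
    have fj: "f j \<in> S_inf" "Suc r \<le> len (f j)" using Suc(2)[OF that] by auto
    then show "isobaric i (Gr (f j)) = Gr (g j)" "g j \<in> S_inf" "r \<le> len (g j)"
      using isobaric_Gr_descent[OF fj(1) i(1)] isobaric_Gr_ascent[OF fj(1) i(1)] asc_or_desc[OF fj(1), of i]
        sw_S_inf[OF fj(1) i(1)] len_sw(2)[OF fj(1) i(1)] by (auto simp: g_def)
  qed
  have "(\<Sum>j\<in>J. of_int (c j) * Gr (g j)) = isobaric i (\<Sum>j\<in>J. of_int (c j) * Gr (f j))"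
    unfolding isobaric_sum isobaric_of_int_mult by (rule sum.cong) (simp_all add: g)
  also have "\<dots> = 0" using Suc(3) by simp
  finally have "(\<Sum>j | j \<in> J \<and> g j = sw w i. c j) = 0"
    using Suc(1)[of g "sw w i"] g sw_S_inf[OF Suc(4) i(1)] len_sw(2)[OF Suc(4) i] Suc(5) by simp
  moreover have "g j = sw w i \<longleftrightarrow> f j = w" if "j \<in> J" for j
  proof
    assume gj: "g j = sw w i"
    show "f j = w"
    proof (cases "f j (i + 1) < f j i")
      case True
      then have "sw (sw (f j) i) i = sw (sw w i) i" using gj by (simp add: g_def)
      then show ?thesis by simp
    next
      case False
      then have "f j = sw w i" using gj by (simp add: g_def)
      then have "len (f j) = r" using len_sw(2)[OF Suc(4) i] Suc(5) by simp
      then show ?thesis using Suc(2)[OF that] by simp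
    qed
  qed (use i in \<open>simp add: g_def\<close>)
  then have "{j \<in> J. g j = sw w i} = {j \<in> J. f j = w}" by blast
  ultimately show ?case by simp
qed

lemma Gr_linear_independent:
  assumes "finite A" "A \<subseteq> S_inf" "(\<Sum>w\<in>A. of_int (c w) * Gr w) = 0" "w \<in> A"
  shows "c w = 0"
proof (rule ccontr)
  assume "c w \<noteq> 0"
  define J where "J = {w \<in> A. c w \<noteq> 0}"
  have J: "finite J" "J \<noteq> {}" "J \<subseteq> S_inf" using assms \<open>c w \<noteq> 0\<close> by (auto simp: J_def)
  obtain v where v: "v \<in> J" "\<And>u. u \<in> J \<Longrightarrow> len v \<le> len u"
    using arg_min_if_finite[OF J(1,2), of len] by (metis linorder_not_less)
  have "(\<Sum>w\<in>J. of_int (c w) * Gr w) = 0"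
    using assms(3) sum.mono_neutral_left[OF assms(1), of J "\<lambda>w. of_int (c w) * Gr w"] by (auto simp: J_def)
  then have "(\<Sum>j | j \<in> J \<and> j = v. c j) = 0"
    using J v by (intro Gr_relation_lowest[where r = "len v" and f = "\<lambda>w. w"]) auto
  moreover have "{j. j \<in> J \<and> j = v} = {v}" using v by auto
  ultimately show False using v by (simp add: J_def)
qed

lemma struct_const_eqI:
  assumes "finite {\<pi>. c \<pi> \<noteq> 0}" "{\<pi>. c \<pi> \<noteq> 0} \<subseteq> S_inf" "\<sigma> \<in> S_inf" "\<rho> \<in> S_inf"
    and "Gr \<sigma> * Gr \<rho> = (\<Sum>\<pi> | c \<pi> \<noteq> 0. of_int (c \<pi>) * Gr \<pi>)"
  shows "struct_const \<sigma> \<rho> = c"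
  unfolding struct_const_def
proof (rule the_equality)
  have "(\<Sum>\<pi> | c \<pi> \<noteq> 0. of_int (c \<pi>) * groth \<pi>) = (\<Sum>\<pi> | c \<pi> \<noteq> 0. of_int (c \<pi>) * Gr \<pi>)"
    by (rule sum.cong) (use assms(2) groth_eq_Gr in auto)
  then show "finite {\<pi>. c \<pi> \<noteq> 0} \<and> {\<pi>. c \<pi> \<noteq> 0} \<subseteq> S_inf \<and>
    groth \<sigma> * groth \<rho> = (\<Sum>\<pi> | c \<pi> \<noteq> 0. of_int (c \<pi>) * groth \<pi>)"
    using assms groth_eq_Gr by simp
next
  fix d assume d: "finite {\<pi>. d \<pi> \<noteq> 0} \<and> {\<pi>. d \<pi> \<noteq> 0} \<subseteq> S_inf \<and>
    groth \<sigma> * groth \<rho> = (\<Sum>\<pi> | d \<pi> \<noteq> 0. of_int (d \<pi>) * groth \<pi>)"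
  let ?A = "{\<pi>. c \<pi> \<noteq> 0} \<union> {\<pi>. d \<pi> \<noteq> 0}"
  have A: "finite ?A" "?A \<subseteq> S_inf" using assms d by auto
  have ext: "(\<Sum>\<pi> | e \<pi> \<noteq> 0. of_int (e \<pi>) * Gr \<pi>) = (\<Sum>\<pi>\<in>?A. of_int (e \<pi>) * Gr \<pi>)"
    if "{\<pi>. e \<pi> \<noteq> 0} \<subseteq> ?A" for e :: "(nat \<Rightarrow> nat) \<Rightarrow> int"
    by (rule sum.mono_neutral_left) (use A that in auto)
  have "(\<Sum>\<pi> | d \<pi> \<noteq> 0. of_int (d \<pi>) * groth \<pi>) = (\<Sum>\<pi> | d \<pi> \<noteq> 0. of_int (d \<pi>) * Gr \<pi>)"
    by (rule sum.cong) (use d groth_eq_Gr in auto)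
  then have "(\<Sum>\<pi>\<in>?A. of_int (c \<pi>) * Gr \<pi>) = (\<Sum>\<pi>\<in>?A. of_int (d \<pi>) * Gr \<pi>)"
    using d assms groth_eq_Gr ext[of c] ext[of d] by auto
  then have "(\<Sum>\<pi>\<in>?A. of_int (d \<pi> - c \<pi>) * Gr \<pi>) = 0"
    by (simp add: left_diff_distrib sum_subtractf)
  from Gr_linear_independent[OF A this] have "d \<pi> = c \<pi>" if "\<pi> \<in> ?A" for \<pi> using that by auto
  note eq = this
  show "d = c"
  proof
    fix \<pi> show "d \<pi> = c \<pi>" using eq[of \<pi>] by (cases "\<pi> \<in> ?A") auto
  qed
qed

section \<open>Diagrams\<close>

lemma S_inf_bij: "w \<in> S_inf \<Longrightarrow> bij w"
  by (auto simp: S_inf_def intro: permutes_bij)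

lemma S_inf_surjE:
  assumes "w \<in> S_inf"
  obtains x where "q = w x"
  using bij_is_surj[OF S_inf_bij[OF assms]] by (metis surjD)

lemma diagram_iff:
  assumes "w \<in> S_inf"
  shows "(p, w x) \<in> diagram w \<longleftrightarrow> 1 \<le> p \<and> p < x \<and> w x < w p"
  using S_inf_pos[OF assms, of x] inv_f_f[OF bij_is_inj[OF S_inf_bij[OF assms]], of x]
  by (auto simp: diagram_def)

text \<open>In the first row p that differs, say with \<open>w p < v p\<close>, the permutation
  \<open>v\<close> attains the value \<open>w p\<close> only later, so (p, \<open>w p\<close>) is a
  box of its diagram; but this is the place of a dot of \<open>w\<close>, never a box of the diagram
  of \<open>w\<close>.\<close>

lemma diagram_inj:
  assumes w: "w \<in> S_inf" and v: "v \<in> S_inf" and eq: "diagram w = diagram v"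
  shows "w = v"
proof
  have key: False if w: "w \<in> S_inf" and v: "v \<in> S_inf" and eq: "diagram w = diagram v"
    and IH: "\<And>a. a < p \<Longrightarrow> w a = v a" and lt: "w p < v p" for w v p
  proof -
    obtain x where x: "w p = v x" using S_inf_surjE[OF v] .
    have "1 \<le> p" using lt S_inf_0[OF w] S_inf_0[OF v] by (cases p) auto
    have "p < x"
    proof (rule ccontr)
      assume "\<not> p < x"
      then consider "x = p" | "x < p" by linarith
      then show False
      proof cases
        case 2
        then have "w p = w x" using x IH by simp
        then show False using S_inf_inj[OF w] 2 by auto
      qed (use x lt in auto)
    qed
    then have "(p, v x) \<in> diagram v" using diagram_iff[OF v] x lt \<open>1 \<le> p\<close> by auto
    then have "(p, w p) \<in> diagram w" using eq x by simp
    then show False using diagram_iff[OF w] by auto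
  qed
  fix p show "w p = v p"
  proof (induct p rule: less_induct)
    case (less p)
    then show ?case using key[OF w v eq, of p] key[OF v w eq[symmetric], of p] by (metis linorder_neqE_nat)
  qed
qed

lemma perm_of_diagram_diagram: "w \<in> S_inf \<Longrightarrow> perm_of_diagram (diagram w) = w"
  unfolding perm_of_diagram_def by (rule the_equality) (auto intro: diagram_inj)

lemma diagram_eqI:
  assumes v: "v \<in> S_inf" and B: "\<And>p x. 1 \<le> x \<Longrightarrow> (p, v x) \<in> B \<longleftrightarrow> 1 \<le> p \<and> p < x \<and> v x < v p"
    and pos: "\<And>p. (p, 0) \<notin> B"
  shows "B = diagram v"
proof (rule set_eqI, clarify)
  fix p q
  obtain x where q: "q = v x" using S_inf_surjE[OF v] .
  show "(p, q) \<in> B \<longleftrightarrow> (p, q) \<in> diagram v"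
    unfolding q diagram_iff[OF v] using B[of x p] pos[of p] S_inf_0[OF v] by (cases "x = 0") auto
qed

section \<open>Adding and removing the maximal corner\<close>

lemma add_corner_apply:
  assumes "u \<in> S_inf"
  shows "add_corner l u l = u (next_pos l u)" "add_corner l u (next_pos l u) = u l"
    "l \<noteq> x \<Longrightarrow> next_pos l u \<noteq> x \<Longrightarrow> add_corner l u x = u x"
  using next_pos(1)[OF assms] by (auto simp: add_corner_def)

lemma add_corner_inc_after:
  assumes u: "u \<in> S_inf" and l: "1 \<le> l" and inc: "inc_after l u"
  shows "inc_after l (add_corner l u)" "last_descent (add_corner l u) = l"
proof -
  define k where "k = next_pos l u"
  note k = next_pos[OF u, of l, folded k_def] and w = add_corner_apply[OF u, of l, folded k_def]
  let ?w = "add_corner l u"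
  note S = add_corner_S_inf[OF u l]
  show inc': "inc_after l ?w"
    unfolding inc_after_def
  proof (intro allI impI)
    fix c assume c: "l < c"
    consider "c = k" | "c + 1 = k" | "c \<noteq> k" "c + 1 \<noteq> k" by blast
    then show "?w c < ?w (c + 1)"
    proof cases
      case 1
      then show ?thesis using w(2) w(3)[of "c + 1"] c k inc_after_less[OF inc, of k "k + 1"] by auto
    next
      case 2
      then show ?thesis using w(2) w(3)[of c] c k(3)[of c] by auto
    next
      case 3
      then show ?thesis using w(3)[of c] w(3)[of "c + 1"] c inc by (auto simp: inc_after_def)
    qed
  qed
  have "?w (l + 1) < ?w l"
    using w k(1,2) k(3)[of "l + 1"] by (cases "k = l + 1") (auto intro: less_trans)
  then have "\<not> inc_after (l - 1) ?w" using inc_after_less[of "l - 1" ?w l "l + 1"] l by auto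
  then show "last_descent ?w = l"
    using last_descent_le_iff[OF S, of l] last_descent_le_iff[OF S, of "l - 1"] inc' by linarith
qed

text \<open>Row l is exchanged with the last row k beyond it whose value is below
  \<open>w l\<close>. The rows in between have values below \<open>w k = u l\<close>, so
  \<open>next_pos\<close> recovers k.\<close>

lemma add_corner_surj:
  assumes w: "w \<in> S_inf" and l: "l = last_descent w" "1 \<le> l"
  obtains u where "u \<in> S_inf" "inc_after l u" "w = add_corner l u"
proof -
  have inc: "inc_after l w" using last_descent_le_iff[OF w] l by blast
  let ?K = "{k. l < k \<and> w k < w l}"
  obtain n where n: "w permutes {1..n}" "l \<le> n" using S_infE[OF w] .
  have "?K \<subseteq> {..n}"
  proof
    fix k assume "k \<in> ?K"
    then show "k \<in> {..n}" using permutes_less_outside[OF n(1), of k l] by fastforce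
  qed
  then have fin: "finite ?K" using finite_subset by blast
  have "l + 1 \<in> ?K" using last_descent_descent[OF w] l by auto
  define k where "k = Max ?K"
  have k: "l < k" "w k < w l" using Max_in[OF fin] \<open>l + 1 \<in> ?K\<close> unfolding k_def by blast+
  have kmax: "w l < w c" if "k < c" for c
  proof -
    have "c \<notin> ?K" using Max_ge[OF fin, of c] that unfolding k_def by force
    then show ?thesis using that k S_inf_inj[OF w, of c l] by auto
  qed
  define u where "u = w \<circ> transpose l k"
  have u_simps: "u l = w k" "u k = w l" "\<And>x. x \<noteq> l \<Longrightarrow> x \<noteq> k \<Longrightarrow> u x = w x"
    by (auto simp: u_def)
  have u: "u \<in> S_inf" unfolding u_def using w l k by (intro S_inf_swap) auto
  moreover have "inc_after l u" unfolding inc_after_def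
  proof (intro allI impI)
    fix c assume c: "l < c"
    consider "c = k" | "c + 1 = k" | "c \<noteq> k" "c + 1 \<noteq> k" by blast
    then show "u c < u (c + 1)"
    proof cases
      case 1
      then show ?thesis using u_simps(2) u_simps(3)[of "c + 1"] c kmax[of "c + 1"] by auto
    next
      case 2
      have "w c < w k" using inc_after_less[OF inc c, of k] 2 by simp
      then show ?thesis using 2 u_simps(2) u_simps(3)[of c] c k by auto
    next
      case 3
      then show ?thesis using u_simps(3)[of c] u_simps(3)[of "c + 1"] c inc by (auto simp: inc_after_def)
    qed
  qed
  moreover have "next_pos l u = k" unfolding next_pos_def
  proof (rule Least_equality)
    show "l < k \<and> u l < u k" using k u_simps by simp
    fix c assume c: "l < c \<and> u l < u c"
    show "k \<le> c"
    proof (rule ccontr)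
      assume "\<not> k \<le> c"
      then have "w c < w k" using c inc_after_less[OF inc, of c k] by simp
      then show False using c \<open>\<not> k \<le> c\<close> u_simps(1) u_simps(3)[of c] by simp
    qed
  qed
  then have "w = add_corner l u" by (simp add: add_corner_def u_def comp_assoc)
  ultimately show ?thesis using that by blast
qed

text \<open>The boxes of row l lie in the columns of dots in later rows with value below
  \<open>u k\<close>, for k = \<open>next_pos l u\<close>. Rows before k have values below
  \<open>u l\<close>, rows after k values above \<open>u k\<close>, so the last column is
  \<open>u l\<close>, whose dot is now in row k. Maximality of a pivot says that no intermediate
  value spoils the cover.\<close>

lemma corner:
  assumes u: "u \<in> S_inf" and l: "1 \<le> l" and inc: "inc_after l u"
  shows "corner_row (add_corner l u) = l" "corner_col (add_corner l u) = u l"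
    "pivot_rows (add_corner l u) = covered_rows l u"
proof -
  define k where "k = next_pos l u"
  note k = next_pos[OF u, of l, folded k_def] and w = add_corner_apply[OF u, of l, folded k_def]
  let ?w = "add_corner l u"
  note S = add_corner_S_inf[OF u l] and inc' = add_corner_inc_after(1)[OF u l inc]
  have rows: "p \<le> l" if "(p, q) \<in> diagram ?w" for p q
  proof -
    obtain x where x: "q = ?w x" using S_inf_surjE[OF S] .
    then show ?thesis
      using that diagram_iff[OF S, of p x] inc_after_less[OF inc', of p x] by (meson leI less_asym)
  qed
  have lm: "(l, u l) \<in> diagram ?w" using diagram_iff[OF S, of l k] w k l by simp
  show row: "corner_row ?w = l"
    unfolding corner_row_def
  proof (rule Max_eqI)
    show "finite (fst ` diagram ?w)" by (rule finite_subset[of _ "{..l}"]) (use rows in auto)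
    show "l \<in> fst ` diagram ?w" using lm by force
  qed (use rows in auto)
  have cols: "q \<le> u l" if "(l, q) \<in> diagram ?w" for q
  proof -
    obtain x where x: "q = ?w x" using S_inf_surjE[OF S] .
    then have x': "l < x" "?w x < u k" using that diagram_iff[OF S, of l x] w by auto
    consider "x < k" | "x = k" | "k < x" by linarith
    then show ?thesis
    proof cases
      case 1
      then show ?thesis using x x' w(3)[of x] k(3)[of x] by simp
    next
      case 2
      then show ?thesis using x w by simp
    next
      case 3
      then show ?thesis using x x' w(3)[of x] k inc_after_less[OF inc, of k x] by auto
    qed
  qed
  show col: "corner_col ?w = u l"
    unfolding corner_col_def row
  proof (rule Max_eqI)
    show "finite {q. (l, q) \<in> diagram ?w}" by (rule finite_subset[of _ "{..u l}"]) (use cols in auto)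
  qed (use lm cols in auto)
  have "nw_rows ?w = {i. 1 \<le> i \<and> i < l \<and> u i < u l}"
    unfolding nw_rows_def row col using w(3) k(1) by auto
  moreover have wu: "?w a = u a" if "a < l" for a using w(3)[of a] k(1) that by simp
  ultimately have "pivot_rows ?w = {i. 1 \<le> i \<and> i < l \<and> u i < u l \<and>
      \<not> (\<exists>a. 1 \<le> a \<and> a < l \<and> u a < u l \<and> i < a \<and> u i < u a)}"
    unfolding pivot_rows_def by (auto simp: wu)
  also have "\<dots> = covered_rows l u"
  proof -
    have "(\<exists>a. 1 \<le> a \<and> a < l \<and> u a < u l \<and> i < a \<and> u i < u a)
      \<longleftrightarrow> (\<exists>c. i < c \<and> c < l \<and> u i < u c \<and> u c < u l)" for i
      by (rule iff_exI) auto
    then show ?thesis unfolding covered_rows_def cov_def by blast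
  qed
  finally show "pivot_rows ?w = covered_rows l u" .
qed

text \<open>Exchanging rows l and k = \<open>next_pos l u\<close> adds one inversion, with cell (l,
  \<open>u l\<close>). No other cell changes, because values at positions between are below
  \<open>u l\<close> and values after k are above \<open>u k\<close>.\<close>

lemma add_box_add_corner:
  assumes u: "u \<in> S_inf" and l: "1 \<le> l" and inc: "inc_after l u"
  shows "add_box l u = add_corner l u"
proof -
  define k where "k = next_pos l u"
  note k = next_pos[OF u, of l, folded k_def] and w = add_corner_apply[OF u, of l, folded k_def]
  let ?w = "add_corner l u"
  note S = add_corner_S_inf[OF u l]
  have "insert (l, u l) (diagram u) = diagram ?w"
  proof (rule diagram_eqI[OF S])
    fix p x :: nat assume x: "1 \<le> x"
    have D: "(p, u y) \<in> insert (l, u l) (diagram u) \<longleftrightarrow> (p = l \<and> y = l) \<or> 1 \<le> p \<and> p < y \<and> u y < u p" for y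
      using diagram_iff[OF u, of p y] S_inf_inj[OF u, of y l] by auto
    consider "x = l" | "x = k" | "x \<noteq> l" "x \<noteq> k" by blast
    then show "(p, ?w x) \<in> insert (l, u l) (diagram u) \<longleftrightarrow> 1 \<le> p \<and> p < x \<and> ?w x < ?w p"
    proof cases
      case 1
      have "u p \<le> u k" if "l \<le> p" "p < k" using that k(2) k(3)[of p] by (cases "p = l") auto
      then show ?thesis unfolding 1 w(1) D using w(3)[of p] k(1)
        by (cases "p < l") auto
    next
      case 2
      show ?thesis unfolding 2 w(2) D using w(1) w(3)[of p] k(1,2) k(3)[of p] l
        by (cases p l rule: linorder_cases) auto
    next
      case 3
      have wx: "?w x = u x" using w(3) 3 by simp
      consider "p = l" | "p = k" | "p \<noteq> l" "p \<noteq> k" by blast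
      then show ?thesis
      proof cases
        case 1
        have "u x < u l \<longleftrightarrow> u x < u k" if "l < x"
          using k(2) k(3)[of x] inc_after_less[OF inc, of k x] that k(1) 3 by (cases "x < k") auto
        then show ?thesis unfolding wx D unfolding 1 w(1) using 3 by auto
      next
        case 2
        have "u k < u x" if "k < x" using inc_after_less[OF inc, of k x] that k(1) by simp
        then show ?thesis unfolding wx D unfolding 2 w(2) using 3 k by auto
      next
        case 3
        then show ?thesis unfolding wx D using w(3)[of p] by auto
      qed
    qed
  next
    fix p show "(p, 0) \<notin> insert (l, u l) (diagram u)"
      using S_inf_pos[OF u, of l] l by (auto simp: diagram_def)
  qed
  then show ?thesis unfolding add_box_def using perm_of_diagram_diagram[OF S] by simp
qed

section \<open>Marching\<close>

text \<open>Only meaningful if \<open>S\<close> has an element below \<open>p\<close>.\<close>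

definition prv :: "nat set \<Rightarrow> nat \<Rightarrow> nat" where
  "prv S p = Max {r \<in> S. r < p}"

lemma prv_in:
  assumes "i \<in> S" "i < p"
  shows "prv S p \<in> S" "prv S p < p" "\<And>r. r \<in> S \<Longrightarrow> r < p \<Longrightarrow> r \<le> prv S p"
proof -
  have fin: "finite {r \<in> S. r < p}" by (rule finite_subset[of _ "{..p}"]) auto
  have "{r \<in> S. r < p} \<noteq> {}" using assms by auto
  from Max_in[OF fin this] show "prv S p \<in> S" "prv S p < p" by (auto simp: prv_def)
  fix r assume "r \<in> S" "r < p"
  then show "r \<le> prv S p" unfolding prv_def by (intro Max_ge fin) auto
qed

lemma prv_succ:
  assumes "r \<in> S" "p \<in> S" "r < p"
  obtains s where "s \<in> S" "r < s" "s \<le> p" "prv S s = r"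
proof -
  define s where "s = (LEAST s. s \<in> S \<and> r < s)"
  have s: "s \<in> S \<and> r < s" unfolding s_def by (rule LeastI[of _ p]) (use assms in auto)
  have min: "\<And>x. x \<in> S \<Longrightarrow> r < x \<Longrightarrow> s \<le> x" unfolding s_def by (rule Least_le) auto
  have "prv S s = r"
    using prv_in(1,2)[OF assms(1), of s] prv_in(3)[OF assms(1), of s r] min[of "prv S s"] s assms(1)
    by (intro antisym) (auto simp: not_le[symmetric])
  then show ?thesis using that s min assms by blast
qed

lemma prv_inj: "inj_on (prv S) {p \<in> S. i < p}" if "i \<in> S"
proof (rule inj_onI)
  fix p q assume "p \<in> {p \<in> S. i < p}" "q \<in> {p \<in> S. i < p}" "prv S p = prv S q"
  then show "p = q"
    using prv_in(2)[OF that, of p] prv_in(2)[OF that, of q] prv_in(3)[OF that, of p q] prv_in(3)[OF that, of q p]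
    by (cases p q rule: linorder_cases) auto
qed

lemma prv_image:
  assumes "i \<in> S" "l \<in> S" "\<And>p. p \<in> S \<Longrightarrow> i \<le> p \<and> p \<le> l"
  shows "prv S ` {p \<in> S. i < p} = S - {l}"
proof (intro equalityI subsetI)
  fix x assume "x \<in> prv S ` {p \<in> S. i < p}"
  then obtain p where "p \<in> S" "i < p" "x = prv S p" by auto
  then show "x \<in> S - {l}" using prv_in[OF assms(1), of p] assms(3)[of p] by auto
next
  fix x assume "x \<in> S - {l}"
  then have "x \<in> S" "x < l" using assms(3)[of x] by auto
  then obtain s where "s \<in> S" "x < s" "prv S s = x" using prv_succ[OF _ assms(2)] by metis
  then show "x \<in> prv S ` {p \<in> S. i < p}" using assms(3)[of x] \<open>x \<in> S\<close> by force
qed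

definition lexless :: "nat \<times> nat \<Rightarrow> nat \<times> nat \<Rightarrow> bool" where
  "lexless a b \<longleftrightarrow> fst a < fst b \<or> fst a = fst b \<and> snd a < snd b"

lemma sorted_wrt_product: "sorted_wrt (<) xs \<Longrightarrow> sorted_wrt (<) ys \<Longrightarrow> sorted_wrt lexless (List.product xs ys)"
  by (induct xs) (auto simp: sorted_wrt_append sorted_wrt_map lexless_def)

text \<open>\<open>f\<close> gives the target of each box once its predecessors in the list have
  moved and while its successors have not. The last assumption keeps \<open>move_box\<close> from
  deleting an earlier arrival when it removes \<open>x\<close>.\<close>

lemma fold_move_box:
  assumes "\<And>ys x zs. xs = ys @ x # zs \<Longrightarrow>
    (THE c. c \<in> A \<and> c \<notin> (B - set ys) \<union> f ` set ys \<and> fst c < fst x \<and> snd c < snd x) = f x"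
    and "distinct xs" and "\<And>ys x zs. xs = ys @ x # zs \<Longrightarrow> x \<notin> f ` set ys"
  shows "fold (move_box A) xs B = (B - set xs) \<union> f ` set xs"
proof -
  have "fold (move_box A) ys B = (B - set ys) \<union> f ` set ys" if "xs = ys @ zs" for ys zs
    using that
  proof (induct ys arbitrary: zs rule: rev_induct)
    case (snoc x ys)
    have eq: "xs = ys @ x # zs" using snoc(2) by simp
    have "fold (move_box A) (ys @ [x]) B = move_box A x ((B - set ys) \<union> f ` set ys)"
      using snoc(1)[OF eq] by simp
    also have "\<dots> = insert (f x) ((B - set ys) \<union> f ` set ys - {x})"
      unfolding move_box_def using assms(1)[OF eq] by simp
    also have "\<dots> = (B - set (ys @ [x])) \<union> f ` set (ys @ [x])"
      using assms(3)[OF eq] by auto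
    finally show ?case .
  qed simp
  from this[of xs "[]"] show ?thesis by simp
qed

lemma open_cells_iff:
  assumes "w \<in> S_inf"
  shows "(p, w x) \<in> open_cells w i \<longleftrightarrow> 1 \<le> p \<and> 1 \<le> x \<and> (p \<noteq> i \<longrightarrow> w x < w p) \<and> (x \<noteq> i \<longrightarrow> p < x)"
proof -
  have "(p, w x) \<in> hook (a, w a) \<longleftrightarrow> p = a \<and> w a \<le> w x \<or> x = a \<and> a \<le> p" for a
    using S_inf_inj[OF assms, of x a] by (auto simp: hook_def)
  then have "(p, w x) \<in> open_cells w i \<longleftrightarrow>
    1 \<le> p \<and> 1 \<le> x \<and> (\<forall>a. 1 \<le> a \<and> a \<noteq> i \<longrightarrow> \<not> (p = a \<and> w a \<le> w x \<or> x = a \<and> a \<le> p))"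
    unfolding open_cells_def using S_inf_pos[OF assms, of x] by simp
  then show ?thesis by (auto simp: not_le)
qed

text \<open>Since \<open>i\<close> is a pivot row, the boxes of the rectangle form a full grid \<open>R \<times> C\<close>, and marching moves
  each of them to the preceding row and column of the grid enlarged by row \<open>i\<close> and column \<open>u i\<close>.\<close>

theorem march_add_corner:
  assumes u: "u \<in> S_inf" and l: "1 \<le> l" and inc: "inc_after l u" and i: "i \<in> covered_rows l u"
  shows "march (add_corner l u) i = u \<circ> transpose i l"
proof -
  define k where "k = next_pos l u"
  note k = next_pos[OF u, of l, folded k_def]
  define w where "w = add_corner l u"
  note w = add_corner_apply[OF u, of l, folded k_def w_def]
  have S: "w \<in> S_inf" unfolding w_def by (rule add_corner_S_inf[OF u l])
  note inj = S_inf_inj[OF S]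
  define j m where "j = w i" and "m = w k"
  have i': "1 \<le> i" "i < l" "u i < u l" "\<And>c. i < c \<Longrightarrow> c < l \<Longrightarrow> \<not> (u i < u c \<and> u c < u l)"
    using i by (auto simp: covered_rows_def cov_def)
  have wu: "w c = u c" if "c < l" for c using w(3)[of c] k(1) that by simp
  have j: "j = u i" and m: "m = u l" using wu[OF i'(2)] w by (auto simp: j_def m_def)
  have jm: "j < m" using i'(3) j m by simp
  have wl: "m < w l" using k(2) w m by simp
  \<comment> \<open>The pivot property in the form used throughout: in a row between i and l, a dot
    beyond column j is also beyond column m.\<close>
  have btw: "m < w c" if "i < c" "c < l" "j < w c" for c
  proof -
    have "w c \<noteq> m" unfolding m_def inj using that k by simp
    moreover have "\<not> w c < m" using i'(4)[OF that(1,2)] that wu[OF that(2)] j m by auto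
    ultimately show ?thesis by simp
  qed
  have mid: "w c < m" if "l < c" "c < k" for c using k(3)[OF that] w(3)[of c] that m by simp
  have out: "w l < w c" if "k < c" for c
    using inc_after_less[OF inc, of k c] that k(1) w by simp
  define R where "R = {p. i < p \<and> p \<le> l \<and> m < w p}"
  define C where "C = {q. j < q \<and> q \<le> m \<and> (\<exists>x>l. q = w x)}"
  have C_iff: "w x \<in> C \<longleftrightarrow> l < x \<and> j < w x \<and> w x \<le> m" for x
    by (auto simp: C_def inj)
  have rC: "l < x" if "i < x" "j < w x" "w x \<le> m" for x
    using btw[of x] that wl by (cases x l rule: linorder_cases) auto
  define R0 C0 where "R0 = insert i R" and "C0 = insert j C"
  have boxes: "(p, w x) \<in> diagram w \<longleftrightarrow> p \<in> R \<and> w x \<in> C" if "i \<le> p" "p \<le> l" "j \<le> w x" "w x \<le> m" for p x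
  proof
    assume "(p, w x) \<in> diagram w"
    then have px: "p < x" "w x < w p" using diagram_iff[OF S] by auto
    have "p \<noteq> i" using px that j_def by auto
    moreover have "x \<noteq> i" using px that by auto
    then have "j < w x" using that inj[of x i] by (simp add: j_def)
    moreover from this have "l < x" using rC px that by simp
    moreover have "m < w p"
      using btw[of p] px that wl \<open>p \<noteq> i\<close> \<open>j < w x\<close> by (cases "p = l") auto
    ultimately show "p \<in> R \<and> w x \<in> C" using that by (simp add: R_def C_iff)
  next
    assume "p \<in> R \<and> w x \<in> C"
    then show "(p, w x) \<in> diagram w" using diagram_iff[OF S, of p x] i' by (auto simp: R_def C_iff)
  qed
  have lR: "l \<in> R" and mC: "m \<in> C"
    using i' wl jm k by (auto simp: R_def C_iff m_def)
  have RC_diag: "R \<times> C \<subseteq> diagram w"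
  proof clarify
    fix p q assume pq: "p \<in> R" "q \<in> C"
    then obtain x where "q = w x" by (auto simp: C_def)
    then show "(p, q) \<in> diagram w" using pq boxes[of p x] by (auto simp: R_def C_def)
  qed
  define A where "A = open_cells w i"
  have RC_A: "R0 \<times> C0 \<subseteq> A"
  proof clarify
    fix p q assume "p \<in> R0" "q \<in> C0"
    moreover from this obtain x where x: "q = w x" by (auto simp: C0_def C_def j_def)
    ultimately have "p = i \<or> i < p \<and> p \<le> l \<and> m < w p" "x = i \<or> l < x \<and> j < w x \<and> w x \<le> m"
      using inj[of x i] C_iff[of x] by (auto simp: R0_def R_def C0_def j_def)
    then show "(p, q) \<in> A"
      unfolding A_def x open_cells_iff[OF S] using i' jm by (auto simp flip: j_def)
  qed
  have RC_D: "c \<in> R \<times> C" if "c \<in> R0 \<times> C0" "c \<in> diagram w" for c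
  proof -
    obtain p q where c: "c = (p, q)" by (cases c)
    obtain x where x: "q = w x" using S_inf_surjE[OF S] .
    show ?thesis using that boxes[of p x] jm i' unfolding c x by (auto simp: R0_def R_def C0_def C_def)
  qed
  \<comment> \<open>Removing the hook of row i frees only cells of row i and of column j; those
    strictly northwest of the corner that are free belong to the enlarged grid.\<close>
  have A_cases: "c \<in> diagram w \<or> c \<in> R0 \<times> C0" if "c \<in> A" "fst c < l" "snd c < m" for c
  proof -
    obtain p q where c: "c = (p, q)" by (cases c)
    obtain x where x: "q = w x" using S_inf_surjE[OF S] .
    have px: "1 \<le> p" "1 \<le> x" "p \<noteq> i \<longrightarrow> w x < w p" "x \<noteq> i \<longrightarrow> p < x" "p < l" "w x < m"
      using that open_cells_iff[OF S, of p x i] unfolding A_def c x by auto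
    consider "p \<noteq> i" "x \<noteq> i" | "p = i" "x = i" | "p = i" "x \<noteq> i" | "p \<noteq> i" "x = i" by blast
    then show ?thesis
    proof cases
      case 1
      then show ?thesis using px diagram_iff[OF S] c x by simp
    next
      case 2
      then show ?thesis using c x by (simp add: R0_def C0_def j_def)
    next
      case 3
      show ?thesis
      proof (cases "w x < j")
        case True
        then show ?thesis using 3 px diagram_iff[OF S, of i x] c x by (simp add: j_def)
      next
        case False
        then have "j < w x" using inj[of x i] 3 by (simp add: j_def)
        then have "w x \<in> C" using rC[of x] 3 px by (simp add: C_iff)
        then show ?thesis using 3 c x by (simp add: R0_def C0_def)
      qed
    next
      case 4
      show ?thesis
      proof (cases "p < i")
        case True
        then show ?thesis using 4 px diagram_iff[OF S, of p i] c x by simp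
      next
        case False
        then have "i < p" using 4 by simp
        then have "p \<in> R" using btw[of p] px 4 by (simp add: R_def j_def)
        then show ?thesis using 4 c x by (simp add: R0_def C0_def j_def)
      qed
    qed
  qed
  have R0: "i \<in> R0" "l \<in> R0" "\<And>p. p \<in> R0 \<Longrightarrow> i \<le> p \<and> p \<le> l" "{p \<in> R0. i < p} = R"
    using lR i' by (auto simp: R0_def R_def)
  have C0: "j \<in> C0" "m \<in> C0" "\<And>q. q \<in> C0 \<Longrightarrow> j \<le> q \<and> q \<le> m" "{q \<in> C0. j < q} = C"
    using mC jm by (auto simp: C0_def C_def)
  define f where "f c = (prv R0 (fst c), prv C0 (snd c))" for c
  have f_im: "f ` (R \<times> C) = (R0 - {l}) \<times> (C0 - {m})"
  proof -
    have "f ` (R \<times> C) = prv R0 ` R \<times> prv C0 ` C" by (force simp: f_def)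
    then show ?thesis using prv_image[OF R0(1-3)] prv_image[OF C0(1-3)] R0(4) C0(4) by simp
  qed
  have f_inj: "inj_on f (R \<times> C)"
    using prv_inj[OF R0(1)] prv_inj[OF C0(1)] unfolding R0(4) C0(4) f_def inj_on_def by auto
  have f_lt: "fst (f c) < fst c" "snd (f c) < snd c" "f c \<in> R0 \<times> C0" if "c \<in> R \<times> C" for c
    using that prv_in[OF R0(1), of "fst c"] prv_in[OF C0(1), of "snd c"]
    by (auto simp: f_def R_def C_def)
  define xs where "xs = filter (\<lambda>b. b \<in> diagram w) (List.product [i..<l + 1] [j..<m + 1])"
  have set_xs: "set xs = R \<times> C"
  proof (intro equalityI subsetI)
    fix c assume c: "c \<in> set xs"
    obtain p q where pq: "c = (p, q)" by (cases c)
    obtain x where x: "q = w x" using S_inf_surjE[OF S] .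
    have "i \<le> p" "p \<le> l" "j \<le> w x" "w x \<le> m" "(p, w x) \<in> diagram w"
      using c unfolding xs_def pq x by auto
    then show "c \<in> R \<times> C" using boxes[of p x] pq x by simp
  next
    fix c assume c: "c \<in> R \<times> C"
    then show "c \<in> set xs" using RC_diag unfolding xs_def by (auto simp: R_def C_def)
  qed
  have "sorted_wrt lexless (List.product [i..<l + 1] [j..<m + 1])"
    by (intro sorted_wrt_product sorted_wrt_upt)
  then have sorted: "sorted_wrt lexless xs" unfolding xs_def by (rule sorted_wrt_filter)
  have distinct: "distinct xs" unfolding xs_def by (auto intro!: distinct_filter distinct_product)
  have ys: "c \<in> set ys" if xs: "xs = ys @ x # zs" and "c \<in> R \<times> C" and "lexless c x" for c x ys zs
  proof -
    have "c \<in> set ys \<or> c = x \<or> c \<in> set zs" using that set_xs by auto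
    moreover have "lexless x c" if "c \<in> set zs" using sorted that xs by (auto simp: sorted_wrt_append)
    ultimately show ?thesis using that(3) by (auto simp: lexless_def)
  qed
  have "fold (move_box A) xs (diagram w) = (diagram w - set xs) \<union> f ` set xs"
  proof (rule fold_move_box[OF _ distinct])
    fix ys x zs assume eq: "xs = ys @ x # zs"
    have xRC: "x \<in> R \<times> C" and ysRC: "set ys \<subseteq> R \<times> C" using eq set_xs by auto
    have xl: "fst x \<le> l" "snd x \<le> m" using xRC by (auto simp: R_def C_def)
    have before: "lexless y x" if "y \<in> set ys" for y
      using sorted that eq by (auto simp: sorted_wrt_append)
    show "(THE c. c \<in> A \<and> c \<notin> (diagram w - set ys) \<union> f ` set ys \<and> fst c < fst x \<and> snd c < snd x) = f x"
    proof (rule the_equality)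
      have "f x \<notin> f ` set ys"
      proof
        assume "f x \<in> f ` set ys"
        then obtain y where y: "y \<in> set ys" "f x = f y" by blast
        then have "x = y" using inj_onD[OF f_inj _ xRC subsetD[OF ysRC]] by simp
        then show False using distinct y eq by auto
      qed
      \<comment> \<open>A diagram box at \<open>f x\<close> would be a box of the grid preceding x,
        hence one that has already left.\<close>
      moreover have "f x \<notin> diagram w - set ys"
      proof
        assume "f x \<in> diagram w - set ys"
        then have fx: "f x \<in> diagram w" "f x \<notin> set ys" by simp_all
        have "lexless (f x) x" using f_lt(1)[OF xRC] by (simp add: lexless_def)
        then have "f x \<in> set ys" by (rule ys[OF eq RC_D[OF f_lt(3)[OF xRC] fx(1)]])
        then show False using fx by simp
      qed
      ultimately show "f x \<in> A \<and> f x \<notin> (diagram w - set ys) \<union> f ` set ys \<and> fst (f x) < fst x \<and> snd (f x) < snd x"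
        using f_lt(1,2)[OF xRC] subsetD[OF RC_A f_lt(3)[OF xRC]] by (simp only: Un_iff simp_thms)
    next
      \<comment> \<open>A free cell of the enlarged grid is \<open>f (p, q)\<close> for the next row
        p and the next column q. As it is free, (p, q) has not moved yet and so does not precede x;
        since \<open>p \<le> fst x\<close> and \<open>q \<le> snd x\<close>, it is x.\<close>
      fix c assume c: "c \<in> A \<and> c \<notin> (diagram w - set ys) \<union> f ` set ys \<and> fst c < fst x \<and> snd c < snd x"
      then have "c \<in> diagram w \<or> c \<in> R0 \<times> C0" using A_cases[of c] xl by linarith
      moreover have "c \<in> R0 \<times> C0" if "c \<in> diagram w"
      proof -
        have "c \<in> set ys" using c that by simp
        then have "c \<in> R \<times> C" by (rule subsetD[OF ysRC])
        then show ?thesis by (auto simp: R0_def C0_def)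
      qed
      ultimately have c0: "fst c \<in> R0" "snd c \<in> C0" by auto
      have x0: "fst x \<in> R0" "snd x \<in> C0" using xRC by (auto simp: R0_def C0_def)
      obtain p where p: "p \<in> R0" "fst c < p" "p \<le> fst x" "prv R0 p = fst c"
        using prv_succ[OF c0(1) x0(1)] c by blast
      obtain q where q: "q \<in> C0" "snd c < q" "q \<le> snd x" "prv C0 q = snd c"
        using prv_succ[OF c0(2) x0(2)] c by blast
      have "p \<in> R" using p c0 R0(3)[of "fst c"] R0(4) by force
      moreover have "q \<in> C" using q c0 C0(3)[of "snd c"] C0(4) by force
      moreover have fpq: "f (p, q) = c" using p q by (simp add: f_def)
      ultimately have "(p, q) \<notin> set ys" "(p, q) \<in> R \<times> C" using c by auto
      then have "\<not> lexless (p, q) x" using ys[OF eq] by blast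
      then have "(p, q) = x" using p q by (auto simp: lexless_def prod_eq_iff)
      then show "c = f x" using fpq by simp
    qed
    show "x \<notin> f ` set ys"
    proof
      assume "x \<in> f ` set ys"
      then obtain y where y: "y \<in> set ys" "x = f y" by blast
      then show False using f_lt(1)[of y] before[of y] ysRC by (auto simp: lexless_def)
    qed
  qed
  also have "\<dots> = (diagram w - R \<times> C) \<union> (R0 - {l}) \<times> (C0 - {m})"
    unfolding set_xs f_im ..
  finally have fold: "fold (move_box A) xs (diagram w) = (diagram w - R \<times> C) \<union> (R0 - {l}) \<times> (C0 - {m})" .
  define v where "v = u \<circ> transpose i l"
  have v: "v i = m" "v l = j" "\<And>x. x \<noteq> i \<Longrightarrow> x \<noteq> l \<Longrightarrow> v x = u x"
    unfolding v_def j m by auto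
  have vS: "v \<in> S_inf" unfolding v_def using i' l by (intro S_inf_swap[OF u]) auto
  have vw: "v p = w p" if "p \<noteq> i" "p \<noteq> l" "p \<noteq> k" for p using v(3)[of p] w(3)[of p] that by simp
  have vk: "v k = w l" using v(3)[of k] w k i' by simp
  have kR: "k \<notin> R0" using k i' by (auto simp: R0_def R_def)
  have "(diagram w - R \<times> C) \<union> (R0 - {l}) \<times> (C0 - {m}) = diagram v" (is "?B = _")
  proof (rule diagram_eqI[OF vS])
    fix p show "(p, 0) \<notin> ?B"
      using jm S_inf_pos[OF S, of i] i' by (auto simp: diagram_def C0_def C_def j_def)
  next
    fix p x :: nat assume x: "1 \<le> x"
    have B: "(p, w y) \<in> ?B \<longleftrightarrow> (1 \<le> p \<and> p < y \<and> w y < w p \<and> \<not> (p \<in> R \<and> w y \<in> C)) \<or>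
        (p \<in> R0 \<and> p \<noteq> l \<and> w y \<in> C0 \<and> w y \<noteq> m)" for y
      using diagram_iff[OF S, of p y] by auto
    have C0y: "w y \<in> C0 \<longleftrightarrow> y = i \<or> w y \<in> C" for y by (auto simp: C0_def j_def inj)
    have ym: "w y = m \<longleftrightarrow> y = k" for y by (simp add: m_def inj)
    have R0p: "p \<in> R0 \<longleftrightarrow> p = i \<or> p \<in> R" by (simp add: R0_def)
    \<comment> \<open>The columns of \<open>v\<close> are those of \<open>w\<close> renamed:
      \<open>v i = w k\<close>, \<open>v l = w i\<close>, \<open>v k = w l\<close>. Expressed by
      \<open>w\<close>, each case depends only on where p lies relative to i, l and k.\<close>
    consider "x = i" | "x = l" | "x = k" | "x \<noteq> i" "x \<noteq> l" "x \<noteq> k" by blast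
    then show "(p, v x) \<in> ?B \<longleftrightarrow> 1 \<le> p \<and> p < x \<and> v x < v p"
    proof cases
      case 1
      have "(p, w k) \<in> ?B \<longleftrightarrow> 1 \<le> p \<and> p < i \<and> m < v p"
      proof (cases p i rule: linorder_cases)
        case less
        then show ?thesis unfolding B ym using k i' vw[of p] mC
          by (auto simp: R_def m_def)
      next
        case equal
        then show ?thesis unfolding B ym using jm by (auto simp: m_def j_def)
      next
        case greater
        have "\<not> m < w p" if "l < p" "p < k" using mid[OF that] by simp
        then show ?thesis unfolding B ym using greater mC
          by (auto simp: R_def m_def not_le)
      qed
      then show ?thesis using 1 v by (simp add: m_def)
    next
      case 2
      have jC: "w i \<notin> C" by (simp add: C_iff j_def)
      have "(p, w i) \<in> ?B \<longleftrightarrow> 1 \<le> p \<and> p < l \<and> j < v p"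
      proof (cases p i rule: linorder_cases)
        case less
        then show ?thesis unfolding B C0y R0p using jC i' k vw[of p] by (auto simp: R_def j_def)
      next
        case equal
        then show ?thesis unfolding B C0y R0p ym using jC i' k v jm by auto
      next
        case greater
        show ?thesis
        proof (cases "p < l")
          case True
          then have "v p = w p" using vw[of p] greater k by simp
          then show ?thesis unfolding B C0y R0p ym using jC greater True i' k btw[of p] jm
            by (auto simp: R_def)
        next
          case False
          then show ?thesis unfolding B C0y R0p ym using jC greater i' k by (auto simp: R_def)
        qed
      qed
      then show ?thesis using 2 v by (simp add: j_def)
    next
      case 3
      have lC: "w l \<notin> C" "w l \<notin> C0" using wl i' by (auto simp: C_iff C0y)
      have "(p, w l) \<in> ?B \<longleftrightarrow> 1 \<le> p \<and> p < k \<and> w l < v p"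
      proof (cases "p < l \<and> p \<noteq> i")
        case True
        then show ?thesis unfolding B using lC vw[of p] k by auto
      next
        case False
        have "\<not> w l < v p" if "p < k"
        proof -
          consider "p = i" | "p = l" | "l < p" using False by linarith
          then show ?thesis
          proof cases
            case 3
            then show ?thesis using mid[of p] that vw[of p] wl i' by simp
          qed (use v wl jm in auto)
        qed
        moreover have "\<not> (p < l \<and> w l < w p)" using False wl jm by (auto simp flip: j_def)
        ultimately show ?thesis unfolding B using lC by auto
      qed
      then show ?thesis using 3 vk by simp
    next
      case 4
      have vx: "v x = w x" using vw 4 by simp
      have neq: "w x \<noteq> j" "w x \<noteq> m" using 4 by (auto simp: j_def m_def inj)
      consider "p = i" | "p = l" | "p = k" | "p \<noteq> i" "p \<noteq> l" "p \<noteq> k" by blast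
      then show ?thesis
      proof cases
        case 1
        have iR: "i \<notin> R" by (simp add: R_def)
        have "(i < x \<and> w x < j) \<or> w x \<in> C \<longleftrightarrow> i < x \<and> w x < m"
          using rC[of x] neq jm i'(2) by (cases "w x" j rule: linorder_cases) (auto simp: C_iff)
        then show ?thesis unfolding vx B C0y R0p ym unfolding 1 v(1) using iR i' 4 by (auto simp flip: j_def)
      next
        case 2
        have "l < x \<and> w x < w l \<and> w x \<notin> C \<longleftrightarrow> l < x \<and> w x < j"
          using neq jm wl out[of x] mid[of x] 4 by (cases x k rule: linorder_cases) (auto simp: C_iff)
        then show ?thesis unfolding vx B C0y R0p ym unfolding 2 v(2) using lR l by auto
      next
        case 3
        have "\<not> (k < x \<and> w x < w l)" using out[of x] by auto
        moreover from this have "\<not> (k < x \<and> w x < m)" using wl by auto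
        ultimately show ?thesis unfolding vx B unfolding 3 vk using kR by (auto simp flip: m_def)
      next
        case 4
        then show ?thesis unfolding vx B C0y R0p ym vw[OF 4] using RC_diag \<open>x \<noteq> i\<close> \<open>x \<noteq> k\<close>
          using diagram_iff[OF S, of p x] by auto
      qed
    qed
  qed
  then have "perm_of_diagram (fold (move_box A) xs (diagram w)) = v"
    using fold perm_of_diagram_diagram[OF vS] by simp
  then show ?thesis
    unfolding march_def w_def[symmetric] using corner(1,2)[OF u l inc]
    by (simp add: w_def[symmetric] m[symmetric] j_def[symmetric] A_def xs_def v_def)
qed

lemma inc_after_swap: "inc_after l u \<Longrightarrow> i \<le> l \<Longrightarrow> inc_after l (u \<circ> transpose i l)"
  unfolding inc_after_def by (auto simp: transpose_def)

text \<open>A marching returns \<open>u\<close> with rows i and l exchanged, still increasing beyond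
  l, and the added box restores the form \<open>add_corner l\<close>. The remaining rows stay
  covered, so the argument repeats.\<close>

lemma K_march_list_add_corner:
  assumes "u \<in> S_inf" "1 \<le> l" "inc_after l u" "sorted_wrt (<) (i # is)" "set (i # is) \<subseteq> covered_rows l u"
  shows "K_march_list l (add_corner l u) (i # is) = swap_fold l u (i # is)"
  using assms
proof (induct "is" arbitrary: i u)
  case Nil
  then show ?case using march_add_corner[of u l i] by simp
next
  case (Cons i' "is")
  define u' where "u' = u \<circ> transpose i l"
  have i: "cov u i l" "1 \<le> i" "i < l" using Cons(6) by (auto simp: covered_rows_def cov_def)
  have u': "u' \<in> S_inf" unfolding u'_def using i by (intro S_inf_swap Cons(2)) auto
  have inc': "inc_after l u'" unfolding u'_def using Cons(4) i by (intro inc_after_swap) auto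
  have "set (i' # is) \<subseteq> covered_rows l u'" unfolding u'_def by (rule covered_rows_swap[OF Cons(2,5,6)])
  then have "K_march_list l (add_corner l u') (i' # is) = swap_fold l u' (i' # is)"
    using Cons(1)[OF u' Cons(3) inc'] Cons(5) by simp
  moreover have "march (add_corner l u) i = u'"
    unfolding u'_def using Cons by (intro march_add_corner) auto
  moreover have "add_box l u' = add_corner l u'" by (rule add_box_add_corner[OF u' Cons(3) inc'])
  ultimately show ?case by (simp add: u'_def)
qed

theorem K_march_add_corner:
  assumes "u \<in> S_inf" "1 \<le> l" "inc_after l u" "I \<noteq> {}" "I \<subseteq> covered_rows l u"
  shows "K_march (add_corner l u) I = swap_fold l u (sorted_list_of_set I)"
proof -
  have "finite I" using assms(5) finite_subset[OF _ covered_rows_finite] by blast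
  then have s: "set (sorted_list_of_set I) = I" "sorted_wrt (<) (sorted_list_of_set I)" by auto
  then obtain i "is" where "sorted_list_of_set I = i # is"
    using assms(4) by (cases "sorted_list_of_set I") auto
  then show ?thesis
    unfolding K_march_def corner(1)[OF assms(1-3)]
    using K_march_list_add_corner[OF assms(1-3), of i "is"] s assms(5) by auto
qed

section \<open>Trees\<close>

definition col_bound :: "nat \<Rightarrow> (nat \<Rightarrow> nat) \<Rightarrow> bool" where
  "col_bound t w \<longleftrightarrow> (\<forall>b\<ge>1. cc w b \<le> t)"

lemma cc_swap_le:
  assumes cov: "cov v a b"
  shows "cc (v \<circ> transpose a b) a \<le> cc v a"
proof -
  have "{x. 1 \<le> x \<and> x < a \<and> (v \<circ> transpose a b) a < (v \<circ> transpose a b) x} \<subseteq> {x. 1 \<le> x \<and> x < a \<and> v a < v x}"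
    using cov by (auto simp: cov_def)
  then show ?thesis unfolding cc_def by (rule card_mono[rotated]) (rule finite_subset[of _ "{..a}"], auto)
qed

text \<open>With e as in \<open>cc_cover\<close>, the count at b becomes
  \<open>cc v a + e + 1\<close>, while \<open>cc v b\<close> is e plus the new count at a, hence at
  most \<open>cc v a + e\<close>. So both old counts are strictly below the new one at b.\<close>

lemma col_bound_cover:
  assumes v: "v \<in> S_inf" and cov: "cov v a b" and cb: "col_bound t (v \<circ> transpose a b)"
  shows "col_bound t v" "cc v b + 1 \<le> t"
proof -
  have ab: "1 \<le> a" "a < b" using cov by (auto simp: cov_def)
  have b: "cc (v \<circ> transpose a b) b \<le> t" using cb ab unfolding col_bound_def by (meson le_trans less_imp_le)
  note c = cc_cover[OF v cov] cc_swap_le[OF cov]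
  show b1: "cc v b + 1 \<le> t" using b c by linarith
  show "col_bound t v" unfolding col_bound_def
  proof (intro allI impI)
    fix x :: nat assume x: "1 \<le> x"
    consider "x = a" | "x = b" | "x \<noteq> a" "x \<noteq> b" by blast
    then show "cc v x \<le> t"
    proof cases
      case 1
      show ?thesis unfolding 1 using b c by linarith
    next
      case 2
      then show ?thesis using b1 by simp
    next
      case 3
      then show ?thesis using cc_cover_other[OF v cov 3] cb x unfolding col_bound_def by (metis (no_types))
    qed
  qed
qed

text \<open>No value between l and \<open>next_pos l u\<close> exceeds the one at
  \<open>next_pos l u\<close>, so e = 0 in \<open>cc_cover\<close>: the two counts change places and
  one of them grows by one.\<close>

lemma cc_add_corner:
  assumes u: "u \<in> S_inf" and l: "1 \<le> l"
  shows "cc (add_corner l u) (next_pos l u) = cc u l + 1" "cc (add_corner l u) l = cc u (next_pos l u)"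
    "\<And>x. x \<noteq> l \<Longrightarrow> x \<noteq> next_pos l u \<Longrightarrow> cc (add_corner l u) x = cc u x"
proof -
  note k = next_pos[OF u, of l]
  have "{x. l < x \<and> x < next_pos l u \<and> u (next_pos l u) < u x} = {}"
    using k(2) k(3) by (auto dest: less_trans)
  then have "card {x. l < x \<and> x < next_pos l u \<and> u (next_pos l u) < u x} = 0" by (simp only: card.empty)
  then show "cc (add_corner l u) (next_pos l u) = cc u l + 1" "cc (add_corner l u) l = cc u (next_pos l u)"
    using cc_cover[OF u cov_next_pos[OF u l]] unfolding add_corner_def by linarith+
  show "\<And>x. x \<noteq> l \<Longrightarrow> x \<noteq> next_pos l u \<Longrightarrow> cc (add_corner l u) x = cc u x"
    unfolding add_corner_def by (rule cc_cover_other[OF u cov_next_pos[OF u l]])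
qed

lemma col_bound_add_corner_iff:
  assumes u: "u \<in> S_inf" and l: "1 \<le> l"
  shows "col_bound t (add_corner l u) \<longleftrightarrow> col_bound t u \<and> cc u l + 1 \<le> t"
proof -
  have k: "1 \<le> next_pos l u" using next_pos(1)[OF u, of l] by simp
  note c = cc_add_corner[OF u l]
  show ?thesis
  proof
    assume cb: "col_bound t (add_corner l u)"
    then have 1: "cc u l + 1 \<le> t" using c(1) k unfolding col_bound_def by metis
    moreover have "cc u x \<le> t" if "1 \<le> x" for x
    proof -
      consider "x = l" | "x = next_pos l u" | "x \<noteq> l" "x \<noteq> next_pos l u" by blast
      then show ?thesis
      proof cases
        case 1
        then show ?thesis using \<open>cc u l + 1 \<le> t\<close> by simp
      next
        case 2
        then show ?thesis using c(2) cb l unfolding col_bound_def by metis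
      next
        case 3
        then show ?thesis using c(3)[OF 3] cb that unfolding col_bound_def by metis
      qed
    qed
    ultimately show "col_bound t u \<and> cc u l + 1 \<le> t" by (simp add: col_bound_def)
  next
    assume cb: "col_bound t u \<and> cc u l + 1 \<le> t"
    show "col_bound t (add_corner l u)" unfolding col_bound_def
    proof (intro allI impI)
      fix x :: nat assume "1 \<le> x"
      consider "x = l" | "x = next_pos l u" | "x \<noteq> l" "x \<noteq> next_pos l u" by blast
      then show "cc (add_corner l u) x \<le> t"
        using c cb k \<open>1 \<le> x\<close> unfolding col_bound_def by cases auto
    qed
  qed
qed

lemma col_bound_leaf:
  assumes "inc_after t w"
  shows "col_bound t w"
  unfolding col_bound_def
proof (intro allI impI)
  fix b :: nat
  have "{x. 1 \<le> x \<and> x < b \<and> w b < w x} \<subseteq> {1..t}"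
  proof
    fix x assume "x \<in> {x. 1 \<le> x \<and> x < b \<and> w b < w x}"
    then show "x \<in> {1..t}" using inc_after_less[OF assms, of x b] by (cases "t < x") auto
  qed
  then have "card {x. 1 \<le> x \<and> x < b \<and> w b < w x} \<le> card {1..t}" by (intro card_mono) auto
  then show "cc w b \<le> t" by (simp add: cc_def)
qed

lemma swap_fold_props:
  assumes "u \<in> S_inf" "1 \<le> l" "inc_after l u" "sorted_wrt (<) is" "set is \<subseteq> covered_rows l u"
  defines "v \<equiv> swap_fold l u is"
  shows "v \<in> S_inf \<and> inc_after l v \<and> len v = len u + length is \<and> v l \<le> u l \<and> (is \<noteq> [] \<longrightarrow> v l < u l) \<and>
    (col_bound t v \<longrightarrow> col_bound t u \<and> (is \<noteq> [] \<longrightarrow> cc u l + 1 \<le> t))"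
  unfolding v_def using assms(1-5)
proof (induct "is" arbitrary: u)
  case (Cons i "is")
  define u' where "u' = u \<circ> transpose i l"
  have i: "cov u i l" "1 \<le> i" "i < l" "u i < u l" using Cons(6) by (auto simp: covered_rows_def cov_def)
  have u': "u' \<in> S_inf" unfolding u'_def using i by (intro S_inf_swap Cons(2)) auto
  have inc': "inc_after l u'" unfolding u'_def using Cons(4) i by (intro inc_after_swap) auto
  have "set is \<subseteq> covered_rows l u'" unfolding u'_def by (rule covered_rows_swap[OF Cons(2,5,6)])
  note IH = Cons(1)[OF u' Cons(3) inc' _ this]
  have "len u' = len u + 1" unfolding u'_def by (rule len_cover[OF Cons(2) i(1)])
  moreover have "u' l = u i" by (simp add: u'_def)
  moreover have "col_bound t u' \<Longrightarrow> col_bound t u \<and> cc u l + 1 \<le> t"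
    using col_bound_cover[OF Cons(2) i(1), folded u'_def] by blast
  moreover have "swap_fold l u (i # is) = swap_fold l u' is" by (simp add: u'_def)
  ultimately show ?case using IH i(4) Cons(5) by auto
qed simp

lemma swap_fold_set_props:
  assumes "u \<in> S_inf" "1 \<le> l" "inc_after l u" "I \<noteq> {}" "I \<subseteq> covered_rows l u"
  defines "v \<equiv> swap_fold l u (sorted_list_of_set I)"
  shows "v \<in> S_inf" "inc_after l v" "len v = len u + card I" "v l < u l"
    "col_bound t v \<Longrightarrow> col_bound t (add_corner l u)"
proof -
  have "finite I" using assms(5) finite_subset[OF _ covered_rows_finite] by blast
  then have s: "set (sorted_list_of_set I) = I" "sorted_wrt (<) (sorted_list_of_set I)"
    "length (sorted_list_of_set I) = card I" "sorted_list_of_set I \<noteq> []" using assms(4) by auto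
  note p = swap_fold_props[OF assms(1-3) s(2), folded v_def]
  show "v \<in> S_inf" "inc_after l v" "len v = len u + card I" "v l < u l"
    using p[of t] s assms(5) by auto
  show "col_bound t v \<Longrightarrow> col_bound t (add_corner l u)"
    using p[of t] s assms(5) col_bound_add_corner_iff[OF assms(1,2)] by auto
qed

lemma len_add_corner: "u \<in> S_inf \<Longrightarrow> 1 \<le> l \<Longrightarrow> len (add_corner l u) = len u + 1"
  unfolding add_corner_def by (rule len_cover[OF _ cov_next_pos])

text \<open>Termination: the pair of the last descent and the value there drops lexicographically.
  If the last descent stays at l, the value there falls from \<open>u (next_pos l u)\<close> to
  below \<open>u l\<close>.\<close>

lemma march_induct [consumes 1, case_names leaf node]:
  assumes "w \<in> S_inf"
    and leaf: "\<And>w. w \<in> S_inf \<Longrightarrow> last_descent w \<le> t \<Longrightarrow> P w"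
    and node: "\<And>l u. u \<in> S_inf \<Longrightarrow> 1 \<le> l \<Longrightarrow> t < l \<Longrightarrow> inc_after l u \<Longrightarrow>
      (\<And>I. I \<noteq> {} \<Longrightarrow> I \<subseteq> covered_rows l u \<Longrightarrow> P (swap_fold l u (sorted_list_of_set I))) \<Longrightarrow> P (add_corner l u)"
  shows "P w"
proof -
  have "\<forall>w\<in>S_inf. x = (last_descent w, w (last_descent w)) \<longrightarrow> P w" for x
  proof (induct x rule: wf_induct[OF wf_lex_prod[OF wf_less_than wf_less_than]])
    case (1 x)
    show ?case
    proof (intro ballI impI)
      fix w assume w: "w \<in> S_inf" and x: "x = (last_descent w, w (last_descent w))"
      show "P w"
      proof (cases "last_descent w \<le> t")
        case True
        then show ?thesis using leaf w by blast
      next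
        case False
        define l where "l = last_descent w"
        have l: "1 \<le> l" "t < l" using False by (auto simp: l_def)
        obtain u where u: "u \<in> S_inf" "inc_after l u" "w = add_corner l u"
          using add_corner_surj[OF w l_def l(1)] .
        show ?thesis unfolding u(3)
        proof (rule node[OF u(1) l u(2)])
          fix I assume I: "I \<noteq> {}" "I \<subseteq> covered_rows l u"
          let ?v = "swap_fold l u (sorted_list_of_set I)"
          note v = swap_fold_set_props[OF u(1) l(1) u(2) I]
          have "w l = u (next_pos l u)" using add_corner_apply(1)[OF u(1), of l] u(3) by simp
          then have "?v l < w l" using v(4) next_pos(2)[OF u(1), of l] by simp
          moreover have "last_descent ?v \<le> l" using v(2) last_descent_le_iff[OF v(1)] by simp
          ultimately have "((last_descent ?v, ?v (last_descent ?v)), x) \<in> less_than <*lex*> less_than"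
            unfolding x l_def[symmetric] by (cases "last_descent ?v = l") auto
          then show "P ?v" using 1 v(1) by blast
        qed
      qed
    qed
  qed
  then show ?thesis using assms(1) by blast
qed

section \<open>Decomposition of a tree at its root\<close>

definition subtree :: "((nat \<Rightarrow> nat) \<Rightarrow> (nat set \<times> label) set) \<Rightarrow> nat \<Rightarrow> label \<Rightarrow> (nat set list \<times> label) set" where
  "subtree ch t L = (case L of None \<Rightarrow> {([], None)} | Some x \<Rightarrow> tree ch t x)"

lemma tree_leaf: "last_descent w \<le> t \<Longrightarrow> tree ch t w = {([], Some w)}"
proof (intro equalityI subsetI)
  fix v assume v: "v \<in> tree ch t w" and leaf: "last_descent w \<le> t"
  obtain p L where pL: "v = (p, L)" by (cases v)
  from v have "(p, L) \<in> tree ch t w" unfolding pL .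
  then have "(p, L) \<in> {([], Some w)}" by (induct rule: tree.induct) (use leaf in auto)
  then show "v \<in> {([], Some w)}" unfolding pL .
qed (auto intro: tree.root)

text \<open>The inductive definition extends paths at the end, whereas recursion over a tree has to
  split off the first edge.\<close>

lemma tree_node:
  assumes "t < last_descent w"
  shows "tree ch t w = insert ([], Some w) (\<Union>(e, L)\<in>ch w. (\<lambda>(p, L'). (e # p, L')) ` subtree ch t L)"
    (is "?T = ?U")
proof (intro equalityI subsetI)
  fix v assume v: "v \<in> ?T"
  obtain p0 L0 where pL: "v = (p0, L0)" by (cases v)
  from v have "(p0, L0) \<in> ?T" unfolding pL .
  then have "(p0, L0) \<in> ?U"
  proof (induct rule: tree.induct)
    case (child path w' e L)
    from child(2) consider "path = []" "w' = w"
      | e0 L0 p where "(e0, L0) \<in> ch w" "path = e0 # p" "(p, Some w') \<in> subtree ch t L0" by auto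
    then show ?case
    proof cases
      case 1
      then have "(e, L) \<in> ch w" using child by simp
      moreover have "([], L) \<in> subtree ch t L" by (cases L) (auto simp: subtree_def intro: tree.root)
      ultimately show ?thesis using 1 by force
    next
      case (2 e0 L0 p)
      then obtain x where x: "L0 = Some x" "(p, Some w') \<in> tree ch t x"
        by (cases L0) (auto simp: subtree_def)
      have "(p @ [e], L) \<in> subtree ch t L0"
        unfolding x subtree_def using tree.child[OF x(2) child(3,4)] by simp
      then show ?thesis using 2 by force
    qed
  qed simp
  then show "v \<in> ?U" unfolding pL .
next
  fix v assume "v \<in> ?U"
  then consider "v = ([], Some w)" | e L p L' where "(e, L) \<in> ch w" "v = (e # p, L')" "(p, L') \<in> subtree ch t L"
    by auto
  then show "v \<in> ?T"
  proof cases
    case 1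
    then show ?thesis by (auto intro: tree.root)
  next
    case (2 e L p L')
    have e: "([e], L) \<in> ?T" using tree.child[of "[]" w ch t w e L] tree.root[of w ch t] 2(1) assms by simp
    show ?thesis
    proof (cases L)
      case None
      then show ?thesis using 2 e by (auto simp: subtree_def)
    next
      case (Some x)
      have "(p, L') \<in> tree ch t x" using 2 Some by (simp add: subtree_def)
      then have "(e # p, L') \<in> ?T"
      proof (induct rule: tree.induct)
        case root
        then show ?case using e Some by simp
      next
        case (child path w' e' L'')
        then show ?case using tree.child[of "e # path" w' ch t w e' L''] by simp
      qed
      then show ?thesis using 2 by simp
    qed
  qed
qed

definition leaves :: "((nat \<Rightarrow> nat) \<Rightarrow> (nat set \<times> label) set) \<Rightarrow> nat \<Rightarrow> (nat \<Rightarrow> nat) \<Rightarrow> (nat set list \<times> label) set" where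
  "leaves ch t w = {v \<in> tree ch t w. leaf_label t (snd v)}"

lemma leaves_leaf: "last_descent w \<le> t \<Longrightarrow> leaves ch t w = {([], Some w)}"
  unfolding leaves_def tree_leaf by auto

lemma leaves_node:
  assumes "t < last_descent w"
  shows "leaves ch t w = (\<Union>(e, L)\<in>ch w. (\<lambda>(p, L'). (e # p, L')) `
    (case L of None \<Rightarrow> {([], None)} | Some x \<Rightarrow> leaves ch t x))"
  unfolding leaves_def tree_node[OF assms] subtree_def using assms
  by (fastforce split: option.splits)

lemma KT_leaves_eq: "KT_leaves t w = leaves K_march_children t w" and T_leaves_eq: "T_leaves t w = leaves march_children t w"
  by (simp_all add: KT_leaves_def T_leaves_def leaves_def)

lemma KT_leaves_node:
  assumes u: "u \<in> S_inf" and l: "1 \<le> l" "t < l" and inc: "inc_after l u"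
  shows "covered_rows l u = {} \<Longrightarrow> KT_leaves t (add_corner l u) = {([{}], None)}"
    "covered_rows l u \<noteq> {} \<Longrightarrow> KT_leaves t (add_corner l u) =
      (\<Union>I\<in>{I. I \<noteq> {} \<and> I \<subseteq> covered_rows l u}.
        (\<lambda>(p, L). (I # p, L)) ` KT_leaves t (swap_fold l u (sorted_list_of_set I)))"
proof -
  have ld: "t < last_descent (add_corner l u)" using add_corner_inc_after(2)[OF u l(1) inc] l by simp
  note piv = corner(3)[OF u l(1) inc]
  show "covered_rows l u = {} \<Longrightarrow> KT_leaves t (add_corner l u) = {([{}], None)}"
    unfolding KT_leaves_eq leaves_node[OF ld] by (simp add: K_march_children_def piv)
  assume "covered_rows l u \<noteq> {}"
  then have ch: "K_march_children (add_corner l u)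
    = (\<lambda>I. (I, Some (swap_fold l u (sorted_list_of_set I)))) ` {I. I \<noteq> {} \<and> I \<subseteq> covered_rows l u}"
    using K_march_add_corner[OF u l(1) inc] by (auto simp: K_march_children_def piv)
  show "KT_leaves t (add_corner l u) =
      (\<Union>I\<in>{I. I \<noteq> {} \<and> I \<subseteq> covered_rows l u}.
        (\<lambda>(p, L). (I # p, L)) ` KT_leaves t (swap_fold l u (sorted_list_of_set I)))"
    unfolding KT_leaves_eq leaves_node[OF ld] ch by auto
qed

text \<open>d is meant to be the length of the root; d + \<open>len \<pi>\<close> has the parity of
  their difference and needs no subtraction of natural numbers.\<close>

definition leaf_val :: "nat \<Rightarrow> nat set list \<times> label \<Rightarrow> int_mpoly" where
  "leaf_val d v = (case snd v of None \<Rightarrow> 0 | Some \<pi> \<Rightarrow> (-1) ^ (d + len \<pi>) * Gr \<pi>)"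

theorem trunc_Gr_leaves:
  assumes "w \<in> S_inf"
  shows "finite (KT_leaves t w) \<and> (\<forall>v\<in>KT_leaves t w. \<forall>\<pi>. snd v = Some \<pi> \<longrightarrow> \<pi> \<in> S_inf) \<and>
    trunc t (Gr w) = (\<Sum>v\<in>KT_leaves t w. leaf_val (len w) v)"
  using assms
proof (induct rule: march_induct[where t = t])
  case (leaf w)
  have inc: "inc_after t w" using leaf last_descent_le_iff by blast
  have "KT_leaves t w = {([], Some w)}" unfolding KT_leaves_eq by (rule leaves_leaf[OF leaf(2)])
  then show ?case using leaf trunc_Gr[OF leaf(1) inc order.refl] by (simp add: leaf_val_def flip: mult_2)
next
  case (node l u)
  let ?Is = "{I. I \<noteq> {} \<and> I \<subseteq> covered_rows l u}"
  let ?v = "\<lambda>I. swap_fold l u (sorted_list_of_set I)"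
  let ?w = "add_corner l u"
  note props = swap_fold_set_props[OF node(1,2,4)]
  show ?case
  proof (cases "covered_rows l u = {}")
    case True
    then have "?Is = {}" by auto
    then have "trunc t (Gr ?w) = 0" using transition[OF node(1-4)] by (simp only: sum.empty)
    then show ?thesis using KT_leaves_node(1)[OF node(1-4) True] by (simp add: leaf_val_def)
  next
    case False
    note L = KT_leaves_node(2)[OF node(1-4) False]
    have fin: "finite ?Is" by (rule finite_subset[of _ "Pow (covered_rows l u)"]) auto
    let ?c = "\<lambda>I. (\<lambda>(p, L). (I # p, L)) :: nat set list \<times> label \<Rightarrow> nat set list \<times> label"
    have finI: "finite (KT_leaves t (?v I))" if "I \<in> ?Is" for I using node(5)[of I] that by simp
    have "finite (KT_leaves t ?w)" unfolding L using fin finI by simp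
    moreover have "\<forall>v\<in>KT_leaves t ?w. \<forall>\<pi>. snd v = Some \<pi> \<longrightarrow> \<pi> \<in> S_inf"
    proof (intro ballI allI impI)
      fix v \<pi> assume v: "v \<in> KT_leaves t ?w" "snd v = Some \<pi>"
      then obtain I v' where "I \<in> ?Is" "v' \<in> KT_leaves t (?v I)" "v = ?c I v'" unfolding L by blast
      moreover from this v have "snd v' = Some \<pi>" by (cases v') simp
      ultimately show "\<pi> \<in> S_inf" using node(5)[of I] by blast
    qed
    moreover have "trunc t (Gr ?w) = (\<Sum>v\<in>KT_leaves t ?w. leaf_val (len ?w) v)"
    proof -
      have "(\<Sum>v\<in>KT_leaves t ?w. leaf_val (len ?w) v)
        = (\<Sum>I\<in>?Is. \<Sum>v\<in>?c I ` KT_leaves t (?v I). leaf_val (len ?w) v)"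
        unfolding L
      proof (rule sum.UNION_disjoint[OF fin])
        show "\<forall>I\<in>?Is. finite (?c I ` KT_leaves t (?v I))" using finI by simp
      qed auto
      also have "\<dots> = (\<Sum>I\<in>?Is. (-1) ^ (card I + 1) * trunc t (Gr (?v I)))"
      proof (rule sum.cong[OF refl])
        fix I assume I: "I \<in> ?Is"
        \<comment> \<open>A K-marching along I changes the length by \<open>card I - 1\<close>,
          which has the parity of the exponent in the transition formula. So signs relative to the
          child become signs relative to the parent.\<close>
        have len: "len (?v I) = len u + card I" "len ?w = len u + 1"
          using props(3)[of I] I len_add_corner[OF node(1,2)] by auto
        have val: "leaf_val (len ?w) (?c I v) = (-1) ^ (card I + 1) * leaf_val (len (?v I)) v" for v
        proof (cases v)
          case (Pair p L)
          have "(-1) ^ (len u + 1 + len \<pi>) = (-1) ^ (card I + 1) * (-1 :: int_mpoly) ^ (len u + card I + len \<pi>)" for \<pi>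
          proof -
            have "card I + 1 + (len u + card I + len \<pi>) = len u + 1 + len \<pi> + 2 * card I" by simp
            then show ?thesis unfolding power_add[symmetric] by (simp only: power_add power_mult) simp
          qed
          then show ?thesis unfolding Pair leaf_val_def len by (cases L) (simp_all only: option.simps snd_conv prod.case mult_zero_right mult.assoc)
        qed
        have "(\<Sum>v\<in>?c I ` KT_leaves t (?v I). leaf_val (len ?w) v)
          = (\<Sum>v\<in>KT_leaves t (?v I). leaf_val (len ?w) (?c I v))"
          by (subst sum.reindex) (auto simp: inj_on_def)
        also have "\<dots> = (-1) ^ (card I + 1) * (\<Sum>v\<in>KT_leaves t (?v I). leaf_val (len (?v I)) v)"
          unfolding val by (simp only: sum_distrib_left)
        also have "(\<Sum>v\<in>KT_leaves t (?v I). leaf_val (len (?v I)) v) = trunc t (Gr (?v I))"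
          using node(5)[of I] I by simp
        finally show "(\<Sum>v\<in>?c I ` KT_leaves t (?v I). leaf_val (len ?w) v) = (-1) ^ (card I + 1) * trunc t (Gr (?v I))" .
      qed
      also have "\<dots> = trunc t (Gr ?w)" by (rule transition[OF node(1-4), symmetric])
      finally show ?thesis by simp
    qed
    ultimately show ?thesis by blast
  qed
qed

text \<open>A permutation has a nonempty leaf exactly if no column of its diagram has more than \<open>t\<close>
  boxes. Marching towards the pivot with the largest column keeps this bound.\<close>

lemma col_bound_of_leaf:
  assumes "w \<in> S_inf" "v \<in> KT_leaves t w" "snd v \<noteq> None"
  shows "col_bound t w"
  using assms
proof (induct arbitrary: v rule: march_induct[where t = t])
  case (leaf w)
  then show ?case using col_bound_leaf last_descent_le_iff by blast
next
  case (node l u)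
  show ?case
  proof (cases "covered_rows l u = {}")
    case True
    then show ?thesis using KT_leaves_node(1)[OF node(1-4) True] node(6,7) by simp
  next
    case False
    obtain I v' where I': "I \<in> {I. I \<noteq> {} \<and> I \<subseteq> covered_rows l u}"
      "v' \<in> KT_leaves t (swap_fold l u (sorted_list_of_set I))" "v = (\<lambda>(p, L). (I # p, L)) v'"
      using node(6) unfolding KT_leaves_node(2)[OF node(1-4) False] by blast
    then have I: "I \<noteq> {}" "I \<subseteq> covered_rows l u"
      "v' \<in> KT_leaves t (swap_fold l u (sorted_list_of_set I))" "snd v' = snd v"
      by (auto split: prod.splits)
    have "col_bound t (swap_fold l u (sorted_list_of_set I))"
      by (rule node(5)[OF I(1-3)]) (use I(4) node(7) in simp)
    then show ?thesis using swap_fold_set_props(5)[OF node(1,2,4) I(1,2)] by blast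
  qed
qed

text \<open>If no dot were northwest of the corner, \<open>cc u l\<close> would be l - 1 \<ge> t,
  against the bound. Otherwise i is the row of the largest value below \<open>u l\<close>. No
  position before l has a value between the two, so the count at i is unchanged and the count at l
  rises only by one, for which the bound on \<open>add_corner l u\<close> leaves room.\<close>

lemma col_bound_pivot:
  assumes u: "u \<in> S_inf" and l: "1 \<le> l" "t < l" and cb: "col_bound t (add_corner l u)"
  obtains i where "i \<in> covered_rows l u" "col_bound t (u \<circ> transpose i l)"
proof -
  have cbu: "col_bound t u" "cc u l + 1 \<le> t" using cb col_bound_add_corner_iff[OF u l(1)] by auto
  let ?N = "{x. 1 \<le> x \<and> x < l \<and> u x < u l}"
  have fin: "finite ?N" by (rule finite_subset[of _ "{..l}"]) auto
  have "?N \<noteq> {}"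
  proof
    assume "?N = {}"
    then have "u l < u x" if "1 \<le> x" "x < l" for x using that S_inf_inj[OF u, of x l] by fastforce
    then have "{x. 1 \<le> x \<and> x < l \<and> u l < u x} = {1..<l}" by auto
    then have "cc u l = l - 1" by (simp add: cc_def)
    then show False using cbu l by simp
  qed
  then have "Max (u ` ?N) \<in> u ` ?N" using fin by (intro Max_in) auto
  then obtain i where i0: "i \<in> ?N" "u i = Max (u ` ?N)" by force
  have i: "i \<in> ?N" "\<And>x. x \<in> ?N \<Longrightarrow> u x \<le> u i"
    using i0 fin by (auto intro!: Max_ge)
  have cov: "cov u i l"
    unfolding cov_def
  proof (intro conjI allI impI)
    fix c assume c: "i < c \<and> c < l"
    show "\<not> (u i < u c \<and> u c < u l)" using c i(2)[of c] by auto
  qed (use i(1) in auto)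
  note c = cc_cover[OF u cov]
  have same: "cc (u \<circ> transpose i l) i = cc u i"
  proof -
    have "u l < u x \<longleftrightarrow> u i < u x" if "1 \<le> x" "x < i" for x
      using i(1) i(2)[of x] that S_inf_inj[OF u, of x l] by fastforce
    then have "{x. 1 \<le> x \<and> x < i \<and> (u \<circ> transpose i l) i < (u \<circ> transpose i l) x} = {x. 1 \<le> x \<and> x < i \<and> u i < u x}"
      using i(1) by (auto simp: transpose_def)
    then show ?thesis by (simp only: cc_def)
  qed
  have "cc (u \<circ> transpose i l) x \<le> t" if "1 \<le> x" for x
  proof -
    consider "x = i" | "x = l" | "x \<noteq> i" "x \<noteq> l" by blast
    then show ?thesis
    proof cases
      case 1
      then show ?thesis using same cbu(1) that by (simp add: col_bound_def)
    next
      case 2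
      show ?thesis unfolding 2 using c same cbu(2) by linarith
    next
      case 3
      then show ?thesis using cc_cover_other[OF u cov 3] cbu(1) that unfolding col_bound_def by metis
    qed
  qed
  then show ?thesis using that[of i] cov by (simp add: covered_rows_def col_bound_def)
qed

text \<open>Every step marches towards a single pivot, so the length never changes, and the bound on
  the columns provides a pivot as long as no leaf is reached.\<close>

lemma T_leaf_exists:
  assumes "w \<in> S_inf" "col_bound t w"
  shows "\<exists>p \<pi>. (p, Some \<pi>) \<in> T_leaves t w \<and> len \<pi> = len w"
  using assms
proof (induct rule: march_induct[where t = t])
  case (leaf w)
  then show ?case unfolding T_leaves_eq leaves_leaf[OF leaf(2)] by auto
next
  case (node l u)
  obtain i where i: "i \<in> covered_rows l u" "col_bound t (u \<circ> transpose i l)"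
    using col_bound_pivot[OF node(1-3,6)] .
  let ?v = "swap_fold l u (sorted_list_of_set {i})"
  have v: "?v = u \<circ> transpose i l" by simp
  have "len ?v = len (add_corner l u)"
    using swap_fold_set_props(3)[OF node(1,2,4), of "{i}"] i len_add_corner[OF node(1,2)] by simp
  moreover have "col_bound t ?v" unfolding v by (rule i(2))
  from node(5)[OF _ _ this] i(1) obtain p \<pi> where p: "(p, Some \<pi>) \<in> T_leaves t ?v" "len \<pi> = len ?v"
    by (metis empty_subsetI insert_not_empty insert_subset)
  moreover have "t < last_descent (add_corner l u)" using add_corner_inc_after(2)[OF node(1,2,4)] node(3) by simp
  note ld = this
  have "({i} # p, Some \<pi>) \<in> T_leaves t (add_corner l u)"
    unfolding T_leaves_eq leaves_node[OF ld]
  proof (rule UN_I)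
    show "({i}, Some (march (add_corner l u) i)) \<in> march_children (add_corner l u)"
      using i(1) corner(3)[OF node(1,2,4)] by (auto simp: march_children_def)
    show "({i} # p, Some \<pi>) \<in> (case ({i}, Some (march (add_corner l u) i)) of (e, L) \<Rightarrow> (\<lambda>(p, L'). (e # p, L')) `
      (case L of None \<Rightarrow> {([], None)} | Some x \<Rightarrow> leaves march_children t x))"
      using p(1) unfolding march_add_corner[OF node(1,2,4) i(1)] v T_leaves_eq
      by (auto intro!: image_eqI[of _ _ "(p, Some \<pi>)"])
  qed
  ultimately show ?case by auto
qed

section \<open>Marching trees inside K-marching trees, and lengths along their paths\<close>

lemma T_subset_KT: "tree march_children t w \<subseteq> tree K_march_children t w"
proof
  fix v assume v: "v \<in> tree march_children t w"
  obtain p L where pL: "v = (p, L)" by (cases v)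
  from v have "(p, L) \<in> tree march_children t w" unfolding pL .
  then have "(p, L) \<in> tree K_march_children t w"
  proof (induct rule: tree.induct)
    case root
    show ?case by (rule tree.root)
  next
    case (child path w' e L)
    have "march_children w' \<subseteq> K_march_children w'"
    proof (cases "pivot_rows w' = {}")
      case False
      have K: "march w' i = K_march w' {i}" for i by (simp add: K_march_def)
      have "({i}, Some (march w' i)) \<in> K_march_children w'" if "i \<in> pivot_rows w'" for i
        using that False unfolding K_march_children_def K by (simp only: if_False) blast
      then show ?thesis unfolding march_children_def using False by auto
    qed (simp add: march_children_def K_march_children_def)
    then show ?case using child by (intro tree.child) auto
  qed
  then show "v \<in> tree K_march_children t w" unfolding pL .
qed

text \<open>An edge e raises the length by \<open>card e - 1\<close>. Hence a vertex as long as the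
  root is reached through singletons only, which are the edges of the marching tree.\<close>

lemma KT_len:
  assumes w: "w \<in> S_inf" and "(p, L) \<in> tree K_march_children t w" "L = Some x"
  shows "x \<in> S_inf \<and> len w \<le> len x \<and> (len x = len w \<longrightarrow> (p, L) \<in> tree march_children t w)"
  using assms(2,3)
proof (induct arbitrary: x rule: tree.induct)
  case root
  then show ?case using w by (auto intro: tree.root)
next
  case (child path y e L)
  have y: "y \<in> S_inf" "len w \<le> len y" "len y = len w \<Longrightarrow> (path, Some y) \<in> tree march_children t w"
    using child(2) by auto
  define l where "l = last_descent y"
  have l: "1 \<le> l" using child(3) by (simp add: l_def)
  obtain u where u: "u \<in> S_inf" "inc_after l u" "y = add_corner l u" using add_corner_surj[OF y(1) l_def l] .
  have e: "e \<noteq> {}" "e \<subseteq> covered_rows l u" "x = K_march y e"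
    using child(4,5) corner(3)[OF u(1) l u(2)] unfolding K_march_children_def u(3)[symmetric] by (auto split: if_splits)
  have x: "x = swap_fold l u (sorted_list_of_set e)" using e K_march_add_corner[OF u(1) l u(2) e(1,2)] u(3) by simp
  note props = swap_fold_set_props[OF u(1) l u(2) e(1,2), folded x]
  have fin: "finite e" using e(2) finite_subset[OF _ covered_rows_finite] by blast
  then have card: "1 \<le> card e" using e(1) by (simp add: Suc_le_eq card_gt_0_iff)
  have len: "len x + 1 = len y + card e" using props(3) len_add_corner[OF u(1) l] u(3) by simp
  have "(path @ [e], L) \<in> tree march_children t w" if "len x = len w"
  proof -
    have "card e = 1" "len y = len w" using len card that y(2) by auto
    then obtain i where i: "e = {i}" using card_1_singletonE by blast
    have "(e, L) \<in> march_children y"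
      using e(2,3) i child(5) corner(3)[OF u(1) l u(2)] unfolding march_children_def u(3)[symmetric]
      by (auto simp: K_march_def)
    then show ?thesis using tree.child[OF y(3)[OF \<open>len y = len w\<close>] child(3)] by blast
  qed
  then show ?case using props(1) len card y(2) by auto
qed

lemma T_leaves_eq_KT_leaves:
  assumes "w \<in> S_inf" "len \<pi> = len w"
  shows "{v \<in> T_leaves t w. snd v = Some \<pi>} = {v \<in> KT_leaves t w. snd v = Some \<pi>}"
proof -
  have "v \<in> tree march_children t w \<longleftrightarrow> v \<in> tree K_march_children t w" if "snd v = Some \<pi>" for v
    using KT_len[OF assms(1), of "fst v" "snd v" t \<pi>] subsetD[OF T_subset_KT, of v t w] that assms(2)
    unfolding prod.collapse by blast
  then show ?thesis by (auto simp: T_leaves_def KT_leaves_def)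
qed

lemma sum_leaf_val:
  assumes "finite V"
  shows "(\<Sum>v\<in>V. leaf_val d v)
    = (\<Sum>\<pi>\<in>{\<pi>. \<exists>v\<in>V. snd v = Some \<pi>}. of_int ((-1) ^ (d + len \<pi>) * int (card {v \<in> V. snd v = Some \<pi>})) * Gr \<pi>)"
proof -
  let ?P = "{\<pi>. \<exists>v\<in>V. snd v = Some \<pi>}"
  have P: "?P = the ` snd ` {v \<in> V. snd v \<noteq> None}" by force
  have "(\<Sum>v\<in>V. leaf_val d v) = (\<Sum>v\<in>{v \<in> V. snd v \<noteq> None}. leaf_val d v)"
    by (rule sum.mono_neutral_right) (use assms in \<open>auto simp: leaf_val_def\<close>)
  also have "\<dots> = (\<Sum>\<pi>\<in>?P. \<Sum>v\<in>{v \<in> {v \<in> V. snd v \<noteq> None}. the (snd v) = \<pi>}. leaf_val d v)"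
    by (rule sum.group[symmetric]) (use assms P in auto)
  also have "\<dots> = (\<Sum>\<pi>\<in>?P. of_int ((-1) ^ (d + len \<pi>) * int (card {v \<in> V. snd v = Some \<pi>})) * Gr \<pi>)"
  proof (rule sum.cong[OF refl])
    fix \<pi>
    have "{v \<in> {v \<in> V. snd v \<noteq> None}. the (snd v) = \<pi>} = {v \<in> V. snd v = Some \<pi>}" by auto
    then have "(\<Sum>v\<in>{v \<in> {v \<in> V. snd v \<noteq> None}. the (snd v) = \<pi>}. leaf_val d v)
      = (\<Sum>v\<in>{v \<in> V. snd v = Some \<pi>}. (-1) ^ (d + len \<pi>) * Gr \<pi>)"
      by (intro sum.cong) (auto simp: leaf_val_def)
    then show "(\<Sum>v\<in>{v \<in> {v \<in> V. snd v \<noteq> None}. the (snd v) = \<pi>}. leaf_val d v)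
      = of_int ((-1) ^ (d + len \<pi>) * int (card {v \<in> V. snd v = Some \<pi>})) * Gr \<pi>"
      by (simp add: mult_ac)
  qed
  finally show ?thesis .
qed

theorem theorem1:
  fixes n t :: nat and \<sigma> \<alpha> \<rho> :: "nat \<Rightarrow> nat"
  assumes "n \<ge> 1"
    and "\<sigma> permutes {1..n}"
    and "last_descent \<sigma> \<le> t" and "t \<le> 2 * n"
    and "\<alpha> permutes {1..n}"
    and "\<exists>!v. v \<in> KT_leaves t (star n id \<alpha>) \<and> snd v \<noteq> None"
    and "\<exists>v \<in> KT_leaves t (star n id \<alpha>). snd v = Some \<rho>"
  shows "\<forall>\<pi> \<in> S_inf.
    (-1) powi (int (len \<sigma>) + int (len \<rho>) - int (len \<pi>)) * rat_of_int (struct_const \<sigma> \<rho> \<pi>)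
      = rat_of_nat (card {v \<in> KT_leaves t (star n \<sigma> \<alpha>). snd v = Some \<pi>}) \<and>
    (len \<sigma> + len \<rho> = len \<pi> \<longrightarrow>
      struct_const \<sigma> \<rho> \<pi> = int (card {v \<in> T_leaves t (star n \<sigma> \<alpha>). snd v = Some \<pi>}))"
proof -
  define b g where "b = star n \<sigma> \<alpha>" and "g = star n id \<alpha>"
  have S: "\<sigma> \<in> S_inf" "b \<in> S_inf" "g \<in> S_inf"
    using assms(2) star_permutes[OF assms(2,5)] star_permutes[OF permutes_id assms(5)]
    by (auto simp: b_def g_def intro: S_infI)
  obtain v0 where v0: "v0 \<in> KT_leaves t g" "snd v0 = Some \<rho>" using assms(7) by (auto simp: g_def)
  have uniq: "v = v0" if "v \<in> KT_leaves t g" "snd v \<noteq> None" for v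
    using assms(6) v0 that unfolding g_def[symmetric] by (metis option.distinct(1))
  have \<rho>: "\<rho> \<in> S_inf" using trunc_Gr_leaves[OF S(3), of t] v0 by blast
  have len_\<rho>: "len \<rho> = len g"
  proof -
    have "col_bound t g" using col_bound_of_leaf[OF S(3) v0(1)] v0(2) by simp
    then obtain p \<pi> where p: "(p, Some \<pi>) \<in> T_leaves t g" "len \<pi> = len g"
      using T_leaf_exists[OF S(3)] by blast
    then have "(p, Some \<pi>) \<in> KT_leaves t g"
      using T_subset_KT[of t g] by (auto simp: T_leaves_def KT_leaves_def)
    then have "(p, Some \<pi>) = v0" by (intro uniq) auto
    then show ?thesis using p(2) v0(2) by auto
  qed
  have len_b: "len b = len \<sigma> + len \<rho>" using len_star[OF assms(2,5)] len_\<rho> by (simp add: b_def g_def)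
  \<comment> \<open>All other leaves are empty and contribute 0; the remaining one has sign +
    because \<open>len \<rho> = len g\<close>.\<close>
  have "(\<Sum>v\<in>KT_leaves t g. leaf_val (len g) v) = (\<Sum>v\<in>{v0}. leaf_val (len g) v)"
    by (rule sum.mono_neutral_right) (use trunc_Gr_leaves[OF S(3), of t] v0 uniq in \<open>force simp: leaf_val_def\<close>)+
  also have "\<dots> = Gr \<rho>" using v0(2) len_\<rho> by (simp add: leaf_val_def flip: mult_2)
  finally have tg: "trunc t (Gr g) = Gr \<rho>" using trunc_Gr_leaves[OF S(3), of t] by simp
  have ts: "trunc t (Gr \<sigma>) = Gr \<sigma>"
    using trunc_Gr[OF S(1), of t t] assms(3) last_descent_le_iff[OF S(1)] by simp
  let ?V = "KT_leaves t b"
  define c where "c \<pi> = (-1) ^ (len b + len \<pi>) * int (card {v \<in> ?V. snd v = Some \<pi>})" for \<pi>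
  have V: "finite ?V" "\<And>v \<pi>. v \<in> ?V \<Longrightarrow> snd v = Some \<pi> \<Longrightarrow> \<pi> \<in> S_inf"
    "trunc t (Gr b) = (\<Sum>v\<in>?V. leaf_val (len b) v)" using trunc_Gr_leaves[OF S(2), of t] by auto
  have supp: "{\<pi>. c \<pi> \<noteq> 0} = {\<pi>. \<exists>v\<in>?V. snd v = Some \<pi>}"
  proof -
    have "c \<pi> \<noteq> 0 \<longleftrightarrow> {v \<in> ?V. snd v = Some \<pi>} \<noteq> {}" for \<pi>
      using V(1) by (simp add: c_def card_eq_0_iff)
    then show ?thesis by blast
  qed
  have "finite {\<pi>. c \<pi> \<noteq> 0}"
  proof -
    have "{\<pi>. \<exists>v\<in>?V. snd v = Some \<pi>} \<subseteq> the ` snd ` ?V" by force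
    then show ?thesis unfolding supp using V(1) finite_subset by blast
  qed
  moreover have "{\<pi>. c \<pi> \<noteq> 0} \<subseteq> S_inf" unfolding supp using V(2) by blast
  moreover have "Gr \<sigma> * Gr \<rho> = (\<Sum>\<pi> | c \<pi> \<noteq> 0. of_int (c \<pi>) * Gr \<pi>)"
  proof -
    have "Gr \<sigma> * Gr \<rho> = trunc t (Gr b)"
      using Gr_star[OF assms(2,5)] tg ts by (simp only: b_def g_def trunc_simps)
    also have "\<dots> = (\<Sum>\<pi> | c \<pi> \<noteq> 0. of_int (c \<pi>) * Gr \<pi>)"
      unfolding V(3) sum_leaf_val[OF V(1)] supp by (simp only: c_def)
    finally show ?thesis .
  qed
  ultimately have C: "struct_const \<sigma> \<rho> = c" using S(1) \<rho> by (intro struct_const_eqI) auto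
  show ?thesis
  proof (intro ballI conjI impI)
    fix \<pi> assume "\<pi> \<in> S_inf"
    \<comment> \<open>The exponent may be negative, but for the base -1 only its parity counts, and
      that is the parity of \<open>len b + len \<pi>\<close>.\<close>
    have "(-1 :: rat) powi (int (len \<sigma>) + int (len \<rho>) - int (len \<pi>)) = (-1) ^ (len b + len \<pi>)"
      by (simp add: len_b power_int_diff power_add flip: of_nat_add) (simp add: divide_simps)
    then have "(-1) powi (int (len \<sigma>) + int (len \<rho>) - int (len \<pi>)) * rat_of_int (struct_const \<sigma> \<rho> \<pi>)
      = ((-1) ^ (len b + len \<pi>) * (-1) ^ (len b + len \<pi>)) * rat_of_nat (card {v \<in> ?V. snd v = Some \<pi>})"
      by (simp add: C c_def)
    then show "(-1) powi (int (len \<sigma>) + int (len \<rho>) - int (len \<pi>)) * rat_of_int (struct_const \<sigma> \<rho> \<pi>)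
      = rat_of_nat (card {v \<in> KT_leaves t (star n \<sigma> \<alpha>). snd v = Some \<pi>})"
      by (simp add: b_def flip: power_add mult_2)
    assume eq: "len \<sigma> + len \<rho> = len \<pi>"
    then show "struct_const \<sigma> \<rho> \<pi> = int (card {v \<in> T_leaves t (star n \<sigma> \<alpha>). snd v = Some \<pi>})"
      using T_leaves_eq_KT_leaves[OF S(2), of \<pi> t] len_b
      by (simp add: C c_def b_def flip: mult_2)
  qed
qed

end
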